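(* Let $K$, $w$, $a$ and $\mu_0$ satisfy the following conditions: (i) $K(y,z)\leq w(y)w(z)$ for all $y,z>0$, with $w:(0,\infty)\to(0,\infty)$ a non-decreasing sublinear function; (ii) for some $\delta>0$, $\mu_0\mathbf{1}_{y<\delta}=0$; (iii) the diffusivity $a$ is strictly positive and measurable. Let $(\mu^1_t)_{t\leq T}$ and $(\mu^2_t)_{t\leq T}$ be solutions, with initial kernel $\mu_0$, of the coagulation-diffusion equation such that $\sup_{t\leq T}\|\langle w^2,\mu^i_t\rangle\|_\infty<\infty$ for $i=1,2$. Then $\mu^1=\mu^2$.
   Context: Let $d\geq3$, let $K:(0,\infty)\times(0,\infty)\to(0,\infty)$ be measurable (coagulation kernel) and $a:(0,\infty)\to(0,\infty)$ (diffusivity as a function of mass). For $t>0$ and $x,x'\in\mathbb{R}^d$ put $p^{t,x',x}(y)=(2\pi a(y)t)^{-d/2}e^{-|x'-x|^2/(2a(y)t)}$, and for a kernel $\mu$ on $\mathbb{R}^d\times\mathcal{B}(0,\infty)$ put $P_t\mu(x,dy)=\int_{\mathbb{R}^d}\mu(x',dy)p^{t,x',x}(y)\,dx'$ ($P_0$ is the identity). Put $$K^+(\mu)(x,A)=\tfrac12\int_0^\infty\!\!\int_0^\infty\mathbf{1}_{y+y'\in A}K(y,y')\mu(x,dy)\mu(x,dy'),\qquad K^-(\mu)(x,A)=\int_{y\in A}\int_0^\infty K(y,y')\mu(x,dy)\mu(x,dy').$$ The coagulation-diffusion equation with initial kernel $\mu_0$ is $$\mu_t+\int_0^tP_{t-s}K^-(\mu_s)\,ds=P_t\mu_0+\int_0^tP_{t-s}K^+(\mu_s)\,ds.$$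 $\mathcal{M}[0,T]$ is the set of measurable kernels $\mu:[0,T]\times\mathbb{R}^d\times\mathcal{B}(0,\infty)\to[0,\infty]$ (for each $t,x$, $\mu_t(x,\cdot)$ is a measure on $(0,\infty)$). For $f:(0,\infty)\to(0,\infty)$, $\langle f,\mu_t\rangle(x)=\int_0^\infty f(y)\mu_t(x,dy)$; $\langle y,\mu_t\rangle$ means $f(y)=y$. $\|\cdot\|_1$ and $\|\cdot\|_\infty$ are the $L^1$ and $L^\infty$ norms over $x\in\mathbb{R}^d$. A solution (up to time $T$) is a $\mu\in\mathcal{M}[0,T]$ satisfying the equation for $t\leq T$ and $\sup_{t\leq T}\|\langle y,\mu_t\rangle\|_1<\infty$. A function $f$ on $(0,\infty)$ is sublinear if $f(\lambda y)\leq\lambda f(y)$ for all $y>0$, $\lambda\geq1$ (i.e. $f(y)/y$ is non-increasing).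
   Formalization: A solution is also required to have a loss term ∫P_{t-s}K^-(μ_s)ds of finite L^1 norm on compact sets of masses (else ∞=∞ admits spurious solutions; automatic if there is no mass below δ), and the coagulation kernel K is taken to be symmetric, as is standard. *)

theory Defs
  imports "HOL-Probability.Probability"
begin

text \<open>The measurable space of masses, i.e. the half line \<open>(0,\<infinity>)\<close> with its Borel sets.\<close>

definition masses :: "real measure"
  where "masses = restrict_space borel {0<..}"

definition measurable_kernel :: "'b measure \<Rightarrow> ('b \<Rightarrow> real measure) \<Rightarrow> bool"
  where "measurable_kernel X \<kappa> \<longleftrightarrow>
    (\<forall>x\<in>space X. sets (\<kappa> x) = sets masses) \<and>
    (\<forall>A\<in>sets masses. (\<lambda>x. emeasure (\<kappa> x) A) \<in> borel_measurable X)"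

text \<open>The class \<open>\<M>[0,T]\<close>; the values of \<open>\<mu> t\<close> for \<open>t\<close> outside \<open>[0,T]\<close> are irrelevant.\<close>

definition time_kernels :: "real \<Rightarrow> (real \<Rightarrow> real ^ 'd \<Rightarrow> real measure) set"
  where "time_kernels T =
    {\<mu>. measurable_kernel (restrict_space borel {0..T} \<Otimes>\<^sub>M borel) (\<lambda>(t, x). \<mu> t x)}"

definition pairing :: "(real \<Rightarrow> real) \<Rightarrow> real measure \<Rightarrow> ennreal"
  where "pairing f M = (\<integral>\<^sup>+ y. ennreal (f y) \<partial>M)"

definition sublinear :: "(real \<Rightarrow> real) \<Rightarrow> bool"
  where "sublinear f \<longleftrightarrow> (\<forall>y>0. \<forall>c\<ge>1. f (c * y) \<le> c * f y)"

text \<open>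
  \<open>K y z\<close> is the rate at which an unordered pair of particles of masses \<open>y\<close> and \<open>z\<close>
  merges, so a coagulation kernel is symmetric.  The gain term below (factor one half over ordered
  pairs) balances the loss term in total mass only under this convention.
\<close>

definition coagulation_kernel :: "(real \<Rightarrow> real \<Rightarrow> real) \<Rightarrow> bool"
  where "coagulation_kernel K \<longleftrightarrow>
    (\<lambda>(y, z). K y z) \<in> borel_measurable (masses \<Otimes>\<^sub>M masses) \<and>
    (\<forall>y>0. \<forall>z>0. 0 < K y z) \<and>
    (\<forall>y>0. \<forall>z>0. K y z = K z y)"

text \<open>
  The operators \<open>K\<^sup>+\<close> and \<open>K\<^sup>-\<close> act at each point \<open>x\<close> separately; \<open>M\<close> stands for
  \<open>\<mu>(x,\<cdot>)\<close>.  The set functions are the defining iterated integrals; they are measures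
  whenever \<open>M\<close> is sigma-finite (lemmas below), and \<^const>\<open>measure_of\<close> yields the zero measure
  should countable additivity fail.  For a solution, \<open>\<mu>\<^sub>t(x,\<cdot>)\<close> is sigma-finite for
  almost every \<open>x\<close>, because its first moment is finite.
\<close>

definition coag_gain :: "(real \<Rightarrow> real \<Rightarrow> real) \<Rightarrow> real measure \<Rightarrow> real measure"
  where "coag_gain K M = measure_of (space masses) (sets masses)
    (\<lambda>A. ennreal (1 / 2) *
      (\<integral>\<^sup>+ y. (\<integral>\<^sup>+ y'. indicator A (y + y') * ennreal (K y y') \<partial>M) \<partial>M))"

definition coag_loss :: "(real \<Rightarrow> real \<Rightarrow> real) \<Rightarrow> real measure \<Rightarrow> real measure"
  where "coag_loss K M = measure_of (space masses) (sets masses)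
    (\<lambda>A. \<integral>\<^sup>+ y. indicator A y * (\<integral>\<^sup>+ y'. ennreal (K y y') \<partial>M) \<partial>M)"

definition heat_density ::
    "(real \<Rightarrow> real) \<Rightarrow> real \<Rightarrow> real ^ 'd \<Rightarrow> real ^ 'd \<Rightarrow> real \<Rightarrow> real"
  where "heat_density a t x' x y =
    (2 * pi * a y * t) powr (- (real CARD('d) / 2)) *
    exp (- ((norm (x' - x))\<^sup>2 / (2 * a y * t)))"

text \<open>\<open>heat_flow a t \<kappa> x A\<close> is \<open>P\<^sub>t\<kappa>(x,A)\<close>.\<close>

definition heat_flow ::
    "(real \<Rightarrow> real) \<Rightarrow> real \<Rightarrow> (real ^ 'd \<Rightarrow> real measure) \<Rightarrow> real ^ 'd \<Rightarrow> real set \<Rightarrow> ennreal"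
  where "heat_flow a t \<kappa> x A =
    (if t = 0 then emeasure (\<kappa> x) A
     else (\<integral>\<^sup>+ x'. (\<integral>\<^sup>+ y. indicator A y * ennreal (heat_density a t x' x y) \<partial>\<kappa> x') \<partial>lborel))"

text \<open>\<open>duhamel a t \<kappa> x A\<close> is \<open>\<integral>\<^sub>0\<^sup>t P\<^bsub>t-s\<^esub>\<kappa>\<^sub>s(x,A) ds\<close>.\<close>

definition duhamel ::
    "(real \<Rightarrow> real) \<Rightarrow> real \<Rightarrow> (real \<Rightarrow> real ^ 'd \<Rightarrow> real measure) \<Rightarrow> real ^ 'd \<Rightarrow> real set \<Rightarrow> ennreal"
  where "duhamel a t \<kappa> x A = (\<integral>\<^sup>+ s\<in>{0..t}. heat_flow a (t - s) (\<kappa> s) x A \<partial>lborel)"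

definition coag_diff_equation ::
    "(real \<Rightarrow> real \<Rightarrow> real) \<Rightarrow> (real \<Rightarrow> real) \<Rightarrow> (real ^ 'd \<Rightarrow> real measure) \<Rightarrow>
     (real \<Rightarrow> real ^ 'd \<Rightarrow> real measure) \<Rightarrow> real \<Rightarrow> bool"
  where "coag_diff_equation K a \<mu>0 \<mu> t \<longleftrightarrow>
    (\<forall>x. \<forall>A\<in>sets masses.
      emeasure (\<mu> t x) A + duhamel a t (\<lambda>s x. coag_loss K (\<mu> s x)) x A =
      heat_flow a t \<mu>0 x A + duhamel a t (\<lambda>s x. coag_gain K (\<mu> s x)) x A)"

text \<open>
  The equation carries information only where its loss term is finite: if both time integrals are
  infinite it reads \<open>\<infinity> = \<infinity>\<close>.  For instance, take \<open>K y z = sqrt (y * z)\<close>,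
  \<open>\<mu>0 = 0\<close>, an everywhere positive bounded integrable \<open>g\<close>, and let \<open>\<mu>\<^sub>t(x,\<cdot>)\<close>
  for \<open>t > 0\<close> have density \<open>g x * y powr (-3/2) * exp (-y)\<close>.  Then \<open>\<langle>y,\<mu>\<^sub>t\<rangle>\<close> is bounded and
  integrable, while \<open>K\<^sup>+(\<mu>\<^sub>t)(x,A)\<close> and \<open>K\<^sup>-(\<mu>\<^sub>t)(x,A)\<close> are both infinite for every \<open>A\<close>
  of positive Lebesgue measure and both zero for every other \<open>A\<close>, so the equation holds in
  \<open>[0,\<infinity>]\<close> although nothing was there initially.  That the equation makes sense is therefore
  part of being a solution: its loss term, on compact sets of masses, has finite \<open>L\<^sup>1\<close> norm.
  This holds automatically if \<open>\<mu>\<close> has no mass below some \<open>\<delta> > 0\<close>, \<open>K y z \<le> w y * w z\<close>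
  with \<open>w\<close> positive, non-decreasing and sublinear, and \<open>\<langle>w\<^sup>2,\<mu>\<^sub>t\<rangle>\<close> is bounded uniformly in
  \<open>t\<close>: then \<open>K\<^sup>-(\<mu>\<^sub>t)(x,A) \<le> \<langle>w,\<mu>\<^sub>t\<rangle>\<^sup>2\<close>, with \<open>\<langle>w,\<mu>\<^sub>t\<rangle> \<le> \<langle>w\<^sup>2,\<mu>\<^sub>t\<rangle> / w \<delta>\<close> and
  \<open>\<langle>w,\<mu>\<^sub>t\<rangle> \<le> (w \<delta> / \<delta>) \<langle>y,\<mu>\<^sub>t\<rangle>\<close>.
\<close>

definition loss_term_integrable ::
    "(real \<Rightarrow> real \<Rightarrow> real) \<Rightarrow> (real \<Rightarrow> real) \<Rightarrow> (real \<Rightarrow> real ^ 'd \<Rightarrow> real measure) \<Rightarrow> real \<Rightarrow> bool"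
  where "loss_term_integrable K a \<mu> t \<longleftrightarrow>
    (\<forall>A. compact A \<and> A \<subseteq> {0<..} \<longrightarrow>
      (\<integral>\<^sup>+ x. duhamel a t (\<lambda>s x. coag_loss K (\<mu> s x)) x A \<partial>lborel) < \<infinity>)"

definition coag_diff_solution ::
    "(real \<Rightarrow> real \<Rightarrow> real) \<Rightarrow> (real \<Rightarrow> real) \<Rightarrow> (real ^ 'd \<Rightarrow> real measure) \<Rightarrow> real \<Rightarrow>
     (real \<Rightarrow> real ^ 'd \<Rightarrow> real measure) \<Rightarrow> bool"
  where "coag_diff_solution K a \<mu>0 T \<mu> \<longleftrightarrow>
    \<mu> \<in> time_kernels T \<and>
    (\<forall>t\<in>{0..T}. loss_term_integrable K a \<mu> t \<and> coag_diff_equation K a \<mu>0 \<mu> t) \<and>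
    (SUP t\<in>{0..T}. \<integral>\<^sup>+ x. pairing (\<lambda>y. y) (\<mu> t x) \<partial>lborel) < \<infinity>"

lemma emeasure_coag_gain:
  assumes "sigma_finite_measure M" "sets M = sets masses" "coagulation_kernel K" "A \<in> sets masses"
  shows "emeasure (coag_gain K M) A = ennreal (1 / 2) *
      (\<integral>\<^sup>+ y. (\<integral>\<^sup>+ y'. indicator A (y + y') * ennreal (K y y') \<partial>M) \<partial>M)"
proof -
  interpret sigma_finite_measure M by fact
  define F where "F = (\<lambda>A. ennreal (1 / 2) *
      (\<integral>\<^sup>+ y. (\<integral>\<^sup>+ y'. indicator A (y + y') * ennreal (K y y') \<partial>M) \<partial>M))"
  have K [measurable]: "(\<lambda>(y, z). K y z) \<in> borel_measurable (M \<Otimes>\<^sub>M M)"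
    using assms(2,3) by (simp add: coagulation_kernel_def cong: measurable_cong_sets sets_pair_measure_cong)
  have id: "(\<lambda>y. y) \<in> borel_measurable M"
    using measurable_restrict_space1[of "\<lambda>y::real. y" borel borel "{0<..}"] assms(2)
    by (simp add: masses_def cong: measurable_cong_sets)
  have spM: "space M = {0<..}"
    using sets_eq_imp_space_eq[OF assms(2)] by (simp add: masses_def)
  have plus: "(\<lambda>p. fst p + snd p) \<in> M \<Otimes>\<^sub>M M \<rightarrow>\<^sub>M masses"
    unfolding masses_def
  proof (rule measurable_restrict_space2)
    show "(\<lambda>p. fst p + snd p) \<in> space (M \<Otimes>\<^sub>M M) \<rightarrow> {0<..}"
      by (auto simp: space_pair_measure spM intro: add_pos_pos)
    show "(\<lambda>p. fst p + snd p) \<in> M \<Otimes>\<^sub>M M \<rightarrow>\<^sub>M borel"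
      using measurable_compose[OF measurable_fst id] measurable_compose[OF measurable_snd id]
      by (intro borel_measurable_add) auto
  qed
  have m: "(\<lambda>(y, y'). indicator B (y + y') * ennreal (K y y')) \<in> borel_measurable (M \<Otimes>\<^sub>M M)"
    if "B \<in> sets masses" for B
  proof -
    have "(\<lambda>p. indicator B (fst p + snd p) :: ennreal) \<in> borel_measurable (M \<Otimes>\<^sub>M M)"
      using that by (intro measurable_compose[OF plus]) auto
    moreover have "(\<lambda>p. ennreal (K (fst p) (snd p))) \<in> borel_measurable (M \<Otimes>\<^sub>M M)"
      using K by (simp add: case_prod_beta')
    ultimately show ?thesis
      by (simp add: case_prod_beta')
  qed
  have F: "F B = ennreal (1 / 2) *
      (\<integral>\<^sup>+ p. indicator B (fst p + snd p) * ennreal (K (fst p) (snd p)) \<partial>(M \<Otimes>\<^sub>M M))"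
    if "B \<in> sets masses" for B
    using nn_integral_fst[OF m[OF that]] by (simp add: F_def case_prod_beta')
  have "countably_additive (sets masses) F"
  proof (rule countably_additiveI)
    fix B :: "nat \<Rightarrow> real set"
    assume B: "range B \<subseteq> sets masses" "disjoint_family B" "(\<Union>i. B i) \<in> sets masses"
    have Bi: "B i \<in> sets masses" for i using B(1) by auto
    have "(\<Sum>i. F (B i)) = ennreal (1 / 2) * (\<Sum>i.
        \<integral>\<^sup>+ p. indicator (B i) (fst p + snd p) * ennreal (K (fst p) (snd p)) \<partial>(M \<Otimes>\<^sub>M M))"
      by (simp add: F[OF Bi])
    also have "\<dots> = ennreal (1 / 2) * (\<integral>\<^sup>+ p. (\<Sum>i.
        indicator (B i) (fst p + snd p) * ennreal (K (fst p) (snd p))) \<partial>(M \<Otimes>\<^sub>M M))"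
      using m[OF Bi] by (subst nn_integral_suminf) (auto simp: case_prod_beta')
    also have "\<dots> = F (\<Union>i. B i)"
      using B(2) by (simp add: F[OF B(3)] suminf_indicator)
    finally show "(\<Sum>i. F (B i)) = F (\<Union>i. B i)" .
  qed
  moreover have "positive (sets masses) F"
    by (simp add: positive_def F_def)
  ultimately have "emeasure (measure_of (space masses) (sets masses) F) A = F A"
    using assms(4) by (intro emeasure_measure_of_sigma) (auto simp: sets.sigma_algebra_axioms)
  then show ?thesis
    by (simp add: coag_gain_def F_def)
qed

lemma emeasure_coag_loss:
  assumes "sigma_finite_measure M" "sets M = sets masses" "coagulation_kernel K" "A \<in> sets masses"
  shows "emeasure (coag_loss K M) A =
      (\<integral>\<^sup>+ y. indicator A y * (\<integral>\<^sup>+ y'. ennreal (K y y') \<partial>M) \<partial>M)"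
proof -
  interpret sigma_finite_measure M by fact
  have K [measurable]: "(\<lambda>(y, z). K y z) \<in> borel_measurable (M \<Otimes>\<^sub>M M)"
    using assms(2,3) by (simp add: coagulation_kernel_def cong: measurable_cong_sets sets_pair_measure_cong)
  have "(\<lambda>y. \<integral>\<^sup>+ y'. ennreal (K y y') \<partial>M) \<in> borel_measurable M"
    by measurable
  moreover have "coag_loss K M = density M (\<lambda>y. \<integral>\<^sup>+ y'. ennreal (K y y') \<partial>M)"
    using assms(2) sets_eq_imp_space_eq[OF assms(2)]
    by (simp add: coag_loss_def density_def mult.commute)
  ultimately show ?thesis
    using assms(2,4) by (simp add: emeasure_density mult.commute)
qed

end

theory Submission
  imports Defs
begin

text \<open>
  All estimates are carried out on the measure \<open>dt dx \<mu>\<^sub>t(x,dy)\<close> and its analogue for pairs of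
  masses.  Testing the equation against \<open>\<Phi>(t,x,y)\<close> moves the heat semigroup onto \<open>\<Phi>\<close> (\<open>resolvent\<close>
  with \<open>\<Lambda> = 0\<close>).

  No mass appears below \<open>\<delta>\<close>: test with \<open>y * max 0 (min 1 (1 + ln y / n))\<close> on \<open>y < \<delta>\<close>.  Since
  \<open>y * ln (1 + y' / y) \<le> 2 * sqrt (y * y')\<close>, gain minus loss is at most
  a multiple of \<open>(1 / n) \<integral> \<langle>y,\<mu>\<rangle> \<langle>w\<^sup>2,\<mu>\<rangle>\<close>, and \<open>n \<rightarrow> \<infinity>\<close>.

  Uniqueness: write \<open>\<mu>\<^sup>1 - \<mu>\<^sup>2 = g \<rho>\<close> with \<open>\<rho> = \<mu>\<^sup>1 + \<mu>\<^sup>2\<close> and let \<open>U\<^sub>\<Lambda>\<close> be the resolvent of the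
  backward heat flow.  The identity \<open>U\<^sub>0 = U\<^sub>\<Lambda> + \<Lambda> U\<^sub>0 U\<^sub>\<Lambda>\<close> turns the equation tested with
  \<open>\<Phi> = exp (- \<gamma> t) w sgn g\<close> into one tested with \<open>\<psi> = U\<^sub>\<Lambda> \<Phi>\<close>, where
  \<open>\<bar>\<psi>\<bar> \<le> exp (- \<gamma> t) w / (\<Lambda> + \<gamma>)\<close>.  The unbounded loss rate \<open>r\<close> then enters only through
  \<open>\<bar>\<Lambda> - r\<bar> + r = \<Lambda> + 2 max 0 (r - \<Lambda>)\<close>, so that \<open>S = \<integral> exp (- \<gamma> t) w \<bar>g\<bar> d\<rho>\<close> satisfies
  \<open>(\<Lambda> + \<gamma>) S \<le> (\<Lambda> + \<beta>) S + o(1)\<close> as \<open>\<Lambda> \<rightarrow> \<infinity>\<close>; hence \<open>S = 0\<close> for \<open>\<gamma> > \<beta>\<close>.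
  This replaces Kato's inequality for \<open>\<bar>\<mu>\<^sup>1 - \<mu>\<^sup>2\<bar>\<close>.
\<close>

section \<open>Kernels with finite first moment\<close>

text \<open>The equation is available only in mild form and in [0,\<infinity>], and \<open>a\<close>
  is merely measurable and positive, so nothing uniform in the mass can be said about regularity in
  x. Apart from the semigroup law at a fixed mass, the integral estimates use only that the heat
  kernel has total mass one, so the diffusivity drops out of the bounds. Differences may be taken
  only between finite quantities, and w is known to be integrable against a solution only above a
  positive mass; hence small masses are excluded before two solutions are compared. A large
  \<Lambda> is needed because the sign of U_0 \<Phi> at a point need not be that of g there: the
  loss then contributes - r \<psi> g, which has no sign, with r unbounded. The additional term
  \<Lambda> \<psi> g absorbs this up to the level \<Lambda>, and above that level dominated
  convergence applies. The estimate gives equality for almost every (t,x). To reach every (t,x), the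
  Duhamel terms of the two solutions are seen to coincide there, and the loss is cancelled on masses
  with 1/n \<le> a \<le> n, where it is finite at each point.\<close>

definition moment_kernel :: "'a measure \<Rightarrow> ('a \<Rightarrow> real measure) \<Rightarrow> bool"
  where "moment_kernel X \<kappa> \<longleftrightarrow>
    (\<forall>z\<in>space X. sets (\<kappa> z) = sets borel \<and> emeasure (\<kappa> z) {..0} = 0 \<and> pairing (\<lambda>y. y) (\<kappa> z) < \<infinity>) \<and>
    (\<forall>A\<in>sets borel. (\<lambda>z. emeasure (\<kappa> z) A) \<in> borel_measurable X)"

text \<open>The measure X(dz) \<kappa>_z(dy). A moment kernel may have infinite mass near 0, so it
  is not a subprobability kernel; the set function is written down directly and its additivity is
  shown in \<open>emeasure_semiprod\<close>. The finite first moment makes y \<kappa>_z(dy) a finite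
  measure, and the absence of mass on \<open>{..0}\<close> lets this measure determine
  \<kappa>_z.\<close>

definition semiprod :: "'a measure \<Rightarrow> ('a \<Rightarrow> real measure) \<Rightarrow> ('a \<times> real) measure"
  where "semiprod X \<kappa> = measure_of (space (X \<Otimes>\<^sub>M borel)) (sets (X \<Otimes>\<^sub>M borel))
    (\<lambda>E. \<integral>\<^sup>+ z. (\<integral>\<^sup>+ y. indicator E (z, y) \<partial>\<kappa> z) \<partial>X)"

lemma sets_semiprod [simp, measurable_cong]: "sets (semiprod X \<kappa>) = sets (X \<Otimes>\<^sub>M borel)"
  by (simp add: semiprod_def)

lemma space_semiprod [simp]: "space (semiprod X \<kappa>) = space X \<times> UNIV"
  using sets_eq_imp_space_eq[OF sets_semiprod[of X \<kappa>]] by (simp add: space_pair_measure)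

text \<open>Stated for a general \<open>N\<close> because it serves both the kernels on the real
  line and the original kernels on \<open>masses\<close>.\<close>

lemma kernel_nn_integral_measurable:
  assumes \<kappa>: "\<And>z. z \<in> space X \<Longrightarrow> sets (\<kappa> z) = sets N"
      "\<And>A. A \<in> sets N \<Longrightarrow> (\<lambda>z. emeasure (\<kappa> z) A) \<in> borel_measurable X"
    and f: "f \<in> borel_measurable N"
  shows "(\<lambda>z. \<integral>\<^sup>+ y. f y \<partial>\<kappa> z) \<in> borel_measurable X"
  using f
proof induct
  case (cong f g)
  moreover have "(\<integral>\<^sup>+ y. f y \<partial>\<kappa> z) = (\<integral>\<^sup>+ y. g y \<partial>\<kappa> z)" if "z \<in> space X" for z
    using cong sets_eq_imp_space_eq[OF \<kappa>(1)[OF that]] by (intro nn_integral_cong) simp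
  ultimately show ?case by (simp cong: measurable_cong)
next
  case (set A)
  then have "(\<integral>\<^sup>+ y. indicator A y \<partial>\<kappa> z) = emeasure (\<kappa> z) A" if "z \<in> space X" for z
    using \<kappa>(1)[OF that] by simp
  with \<kappa>(2)[OF set] show ?case by (simp cong: measurable_cong)
next
  case (mult u c)
  then have "(\<integral>\<^sup>+ y. c * u y \<partial>\<kappa> z) = c * (\<integral>\<^sup>+ y. u y \<partial>\<kappa> z)" if "z \<in> space X" for z
    using \<kappa>(1)[OF that] by (intro nn_integral_cmult) (simp cong: measurable_cong_sets)
  with mult show ?case by (simp cong: measurable_cong)
next
  case (add u v)
  then have "(\<integral>\<^sup>+ y. v y + u y \<partial>\<kappa> z) = (\<integral>\<^sup>+ y. v y \<partial>\<kappa> z) + (\<integral>\<^sup>+ y. u y \<partial>\<kappa> z)" if "z \<in> space X" for z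
    using \<kappa>(1)[OF that] by (intro nn_integral_add) (simp_all cong: measurable_cong_sets)
  with add show ?case by (simp cong: measurable_cong)
next
  case (seq U)
  have "(\<integral>\<^sup>+ y. (SUP i. U i) y \<partial>\<kappa> z) = (SUP i. \<integral>\<^sup>+ y. U i y \<partial>\<kappa> z)" if "z \<in> space X" for z
    unfolding SUP_apply using \<kappa>(1)[OF that] seq
    by (intro nn_integral_monotone_convergence_SUP) (simp_all cong: measurable_cong_sets)
  with seq show ?case by (simp cong: measurable_cong)
qed

lemma moment_kernelD:
  assumes "moment_kernel X \<kappa>" "z \<in> space X"
  shows "sets (\<kappa> z) = sets borel" "space (\<kappa> z) = UNIV" "AE y in \<kappa> z. 0 < y"
    "(\<integral>\<^sup>+ y. ennreal y \<partial>\<kappa> z) < \<infinity>"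
proof -
  show s: "sets (\<kappa> z) = sets borel" and "(\<integral>\<^sup>+ y. ennreal y \<partial>\<kappa> z) < \<infinity>"
    using assms by (auto simp: moment_kernel_def pairing_def)
  show sp: "space (\<kappa> z) = UNIV"
    using sets_eq_imp_space_eq[OF s] by simp
  show "AE y in \<kappa> z. 0 < y"
    using assms s by (intro AE_I[of _ _ "{..0}"]) (auto simp: moment_kernel_def)
qed

lemma moment_kernel_measurable:
  assumes \<kappa>: "moment_kernel X \<kappa>" and f: "f \<in> borel_measurable borel"
  shows "(\<lambda>z. \<integral>\<^sup>+ y. f y \<partial>\<kappa> z) \<in> borel_measurable X"
  using \<kappa> by (intro kernel_nn_integral_measurable[OF _ _ f]) (auto simp: moment_kernel_def)

text \<open>Joint measurability is reduced to subprobability kernels by normalising \<open>y \<kappa>\<^sub>z(dy)\<close>.\<close>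

lemma moment_kernel_measurable2:
  assumes \<kappa>: "moment_kernel X \<kappa>"
    and f [measurable]: "(\<lambda>(z, y). f z y) \<in> borel_measurable (X \<Otimes>\<^sub>M borel)"
  shows "(\<lambda>z. \<integral>\<^sup>+ y. f z y \<partial>\<kappa> z) \<in> borel_measurable X"
proof -
  define m where "m z = (\<integral>\<^sup>+ y. ennreal y \<partial>\<kappa> z)" for z
  \<comment> \<open>Dividing by \<open>1 + m z\<close> rather than \<open>m z\<close> avoids a zero
    denominator where the kernel vanishes; the total mass becomes m / (1 + m) \<le> 1.\<close>
  define \<kappa>' where "\<kappa>' z = density (\<kappa> z) (\<lambda>y. ennreal y / (1 + m z))" for z
  have m [measurable]: "m \<in> borel_measurable X"
    unfolding m_def by (rule moment_kernel_measurable[OF \<kappa>]) simp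
  have m_fin: "m z < \<infinity>" if "z \<in> space X" for z
    using moment_kernelD(4)[OF \<kappa> that] by (simp add: m_def)
  have s: "sets (\<kappa> z) = sets borel" if "z \<in> space X" for z
    using moment_kernelD(1)[OF \<kappa> that] .
  have K': "\<kappa>' \<in> X \<rightarrow>\<^sub>M subprob_algebra borel"
  proof (rule measurable_subprob_algebra)
    fix z assume z: "z \<in> space X"
    note [measurable_cong] = s[OF z]
    show "subprob_space (\<kappa>' z)"
    proof
      have "emeasure (\<kappa>' z) (space (\<kappa>' z)) = (\<integral>\<^sup>+ y. ennreal y / (1 + m z) \<partial>\<kappa> z)"
        unfolding \<kappa>'_def by (subst emeasure_density) (auto intro!: nn_integral_cong)
      also have "\<dots> = m z / (1 + m z)"
        unfolding m_def by (rule nn_integral_divide) simp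
      also have "\<dots> \<le> 1"
        using m_fin[OF z] by (intro divide_le_posI_ennreal) (auto simp: add_pos_nonneg intro: le_add_same_cancel2[THEN iffD2])
      finally show "emeasure (\<kappa>' z) (space (\<kappa>' z)) \<le> 1" .
      show "space (\<kappa>' z) \<noteq> {}"
        using moment_kernelD(2)[OF \<kappa> z] by (simp add: \<kappa>'_def)
    qed
    show "sets (\<kappa>' z) = sets borel" using s[OF z] by (simp add: \<kappa>'_def)
  next
    fix A :: "real set" assume A [measurable]: "A \<in> sets borel"
    have "emeasure (\<kappa>' z) A = (\<integral>\<^sup>+ y. ennreal y * indicator A y \<partial>\<kappa> z) / (1 + m z)" if z: "z \<in> space X" for z
    proof -
      note [measurable_cong] = s[OF z]
      have "A \<in> sets (\<kappa> z)" using A s[OF z] by simp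
      then have "emeasure (\<kappa>' z) A = (\<integral>\<^sup>+ y. (ennreal y * indicator A y) / (1 + m z) \<partial>\<kappa> z)"
        unfolding \<kappa>'_def by (subst emeasure_density) (auto intro!: nn_integral_cong simp: divide_ennreal_def ac_simps)
      also have "\<dots> = (\<integral>\<^sup>+ y. ennreal y * indicator A y \<partial>\<kappa> z) / (1 + m z)"
        by (rule nn_integral_divide) simp
      finally show ?thesis .
    qed
    moreover have "(\<lambda>z. (\<integral>\<^sup>+ y. ennreal y * indicator A y \<partial>\<kappa> z) / (1 + m z)) \<in> borel_measurable X"
      by (intro borel_measurable_divide_ennreal moment_kernel_measurable[OF \<kappa>] borel_measurable_add) auto
    ultimately show "(\<lambda>z. emeasure (\<kappa>' z) A) \<in> borel_measurable X"
      by (simp cong: measurable_cong)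
  qed
  \<comment> \<open>The factor \<open>(1 + m z) / ennreal y\<close> undoes the normalisation. The
    cancellation below uses that \<open>m z\<close> is finite and that almost every y is
    positive.\<close>
  have "(\<lambda>z. integral\<^sup>N (\<kappa>' z) (\<lambda>y. f z y * (1 + m z) / ennreal y)) \<in> borel_measurable X"
    by (rule nn_integral_measurable_subprob_algebra2[OF _ K']) simp
  moreover have "integral\<^sup>N (\<kappa>' z) (\<lambda>y. f z y * (1 + m z) / ennreal y) = (\<integral>\<^sup>+ y. f z y \<partial>\<kappa> z)"
    if z: "z \<in> space X" for z
  proof -
    note [measurable_cong] = s[OF z]
    have fz [measurable]: "(\<lambda>y. f z y) \<in> borel_measurable borel"
      using measurable_Pair2[OF f z] by simp
    have "integral\<^sup>N (\<kappa>' z) (\<lambda>y. f z y * (1 + m z) / ennreal y)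
        = (\<integral>\<^sup>+ y. (ennreal y / (1 + m z)) * (f z y * (1 + m z) / ennreal y) \<partial>\<kappa> z)"
      unfolding \<kappa>'_def by (rule nn_integral_density) auto
    also have "\<dots> = (\<integral>\<^sup>+ y. f z y \<partial>\<kappa> z)"
    proof (rule nn_integral_cong_AE, use moment_kernelD(3)[OF \<kappa> z] in eventually_elim)
      fix y :: real assume y: "0 < y"
      have "1 + m z \<noteq> 0" "1 + m z \<noteq> \<infinity>" "ennreal y \<noteq> 0" "ennreal y \<noteq> \<infinity>"
        using m_fin[OF z] y by auto
      then have *: "(1 + m z) * inverse (1 + m z) = 1" "ennreal y * inverse (ennreal y) = 1"
        by (auto simp: ennreal_mult_divide_eq divide_ennreal_def[symmetric] top.not_eq_extremum)
      have "(ennreal y / (1 + m z)) * (f z y * (1 + m z) / ennreal y)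
          = f z y * ((1 + m z) * inverse (1 + m z)) * (ennreal y * inverse (ennreal y))"
        by (simp add: divide_ennreal_def ac_simps)
      then show "(ennreal y / (1 + m z)) * (f z y * (1 + m z) / ennreal y) = f z y"
        unfolding * by simp
    qed
    finally show ?thesis .
  qed
  ultimately show ?thesis by (simp cong: measurable_cong)
qed

lemma moment_kernel_compose:
  assumes "moment_kernel X \<kappa>" "h \<in> Y \<rightarrow>\<^sub>M X"
  shows "moment_kernel Y (\<lambda>z. \<kappa> (h z))"
  using assms measurable_space[OF assms(2)] unfolding moment_kernel_def
  by (auto intro: measurable_compose[OF assms(2)])

lemma moment_kernel_nn_section:
  assumes \<kappa>: "moment_kernel X \<kappa>" and f: "f \<in> borel_measurable (X \<Otimes>\<^sub>M borel)" and z: "z \<in> space X"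
  shows "(\<lambda>y. f (z, y)) \<in> borel_measurable (\<kappa> z)"
  using measurable_Pair2[OF f z] moment_kernelD(1)[OF \<kappa> z] by (simp cong: measurable_cong_sets)

lemma moment_kernel_measurable_pair:
  assumes "moment_kernel X \<kappa>" and "f \<in> borel_measurable (X \<Otimes>\<^sub>M borel)"
  shows "(\<lambda>z. \<integral>\<^sup>+ y. f (z, y) \<partial>\<kappa> z) \<in> borel_measurable X"
  using assms by (intro moment_kernel_measurable2) auto

lemma emeasure_semiprod:
  assumes \<kappa>: "moment_kernel X \<kappa>" and E: "E \<in> sets (X \<Otimes>\<^sub>M borel)"
  shows "emeasure (semiprod X \<kappa>) E = (\<integral>\<^sup>+ z. (\<integral>\<^sup>+ y. indicator E (z, y) \<partial>\<kappa> z) \<partial>X)"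
proof -
  let ?F = "\<lambda>E. \<integral>\<^sup>+ z. (\<integral>\<^sup>+ y. indicator E (z, y) \<partial>\<kappa> z) \<partial>X"
  have "countably_additive (sets (X \<Otimes>\<^sub>M borel)) ?F"
  proof (rule countably_additiveI)
    fix B :: "nat \<Rightarrow> ('a \<times> real) set"
    assume B: "range B \<subseteq> sets (X \<Otimes>\<^sub>M borel)" "disjoint_family B" "(\<Union>i. B i) \<in> sets (X \<Otimes>\<^sub>M borel)"
    have Bi [measurable]: "B i \<in> sets (X \<Otimes>\<^sub>M borel)" for i using B(1) by auto
    have "(\<Sum>i. ?F (B i)) = (\<integral>\<^sup>+ z. (\<Sum>i. \<integral>\<^sup>+ y. indicator (B i) (z, y) \<partial>\<kappa> z) \<partial>X)"
      by (intro nn_integral_suminf[symmetric] moment_kernel_measurable_pair[OF \<kappa>]) measurable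
    also have "\<dots> = (\<integral>\<^sup>+ z. (\<integral>\<^sup>+ y. (\<Sum>i. indicator (B i) (z, y)) \<partial>\<kappa> z) \<partial>X)"
      by (intro nn_integral_cong nn_integral_suminf[symmetric] moment_kernel_nn_section[OF \<kappa>]) measurable
    also have "\<dots> = ?F (\<Union>i. B i)"
      using B(2) by (simp add: suminf_indicator)
    finally show "(\<Sum>i. ?F (B i)) = ?F (\<Union>i. B i)" .
  qed
  moreover have "positive (sets (X \<Otimes>\<^sub>M borel)) ?F"
    by (simp add: positive_def)
  ultimately show ?thesis
    unfolding semiprod_def using E
    by (intro emeasure_measure_of_sigma) (auto simp: sets.sigma_algebra_axioms)
qed

lemma nn_integral_semiprod:
  assumes \<kappa>: "moment_kernel X \<kappa>" and f: "f \<in> borel_measurable (X \<Otimes>\<^sub>M borel)"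
  shows "(\<integral>\<^sup>+ q. f q \<partial>semiprod X \<kappa>) = (\<integral>\<^sup>+ z. (\<integral>\<^sup>+ y. f (z, y) \<partial>\<kappa> z) \<partial>X)"
  using f
proof induct
  case (cong f g)
  have "(\<integral>\<^sup>+ q. f q \<partial>semiprod X \<kappa>) = (\<integral>\<^sup>+ q. g q \<partial>semiprod X \<kappa>)"
    using cong by (intro nn_integral_cong) (simp add: space_pair_measure)
  moreover have "(\<integral>\<^sup>+ z. (\<integral>\<^sup>+ y. f (z, y) \<partial>\<kappa> z) \<partial>X) = (\<integral>\<^sup>+ z. (\<integral>\<^sup>+ y. g (z, y) \<partial>\<kappa> z) \<partial>X)"
    using cong by (intro nn_integral_cong) (simp add: space_pair_measure)
  ultimately show ?case using cong by simp
next
  case (set A)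
  then show ?case by (simp add: emeasure_semiprod[OF \<kappa>])
next
  case (mult u c)
  then show ?case
    by (simp add: nn_integral_cmult moment_kernel_nn_section[OF \<kappa>] moment_kernel_measurable_pair[OF \<kappa>]
        cong: nn_integral_cong_simp measurable_cong_sets)
next
  case (add u v)
  then show ?case
    by (simp add: nn_integral_add moment_kernel_nn_section[OF \<kappa>] moment_kernel_measurable_pair[OF \<kappa>]
        cong: nn_integral_cong_simp measurable_cong_sets)
next
  case (seq U)
  have U: "incseq (\<lambda>i. U i q)" for q
    using monoD[OF seq(4)] by (auto intro!: monoI simp: le_fun_def simp del: split_paired_All)
  have "(\<integral>\<^sup>+ q. (SUP i. U i) q \<partial>semiprod X \<kappa>) = (SUP i. \<integral>\<^sup>+ q. U i q \<partial>semiprod X \<kappa>)"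
    unfolding SUP_apply using seq by (intro nn_integral_monotone_convergence_SUP) simp_all
  also have "\<dots> = (SUP i. \<integral>\<^sup>+ z. (\<integral>\<^sup>+ y. U i (z, y) \<partial>\<kappa> z) \<partial>X)"
    using seq by simp
  also have "\<dots> = (\<integral>\<^sup>+ z. (SUP i. \<integral>\<^sup>+ y. U i (z, y) \<partial>\<kappa> z) \<partial>X)"
    using seq moment_kernel_measurable_pair[OF \<kappa>]
    by (intro nn_integral_monotone_convergence_SUP[symmetric])
       (auto simp: incseq_def le_fun_def intro!: nn_integral_mono)
  also have "\<dots> = (\<integral>\<^sup>+ z. (\<integral>\<^sup>+ y. (SUP i. U i (z, y)) \<partial>\<kappa> z) \<partial>X)"
    using U moment_kernel_nn_section[OF \<kappa> seq(1)]
    by (intro nn_integral_cong nn_integral_monotone_convergence_SUP[symmetric])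
       (auto simp: incseq_def le_fun_def)
  finally show ?case by (simp add: SUP_apply image_comp)
qed

lemma AE_semiprod:
  assumes \<kappa>: "moment_kernel X \<kappa>" and P: "Measurable.pred (X \<Otimes>\<^sub>M borel) P"
  shows "(AE q in semiprod X \<kappa>. P q) \<longleftrightarrow> (AE z in X. AE y in \<kappa> z. P (z, y))"
proof -
  let ?N = "{q \<in> space (X \<Otimes>\<^sub>M borel). \<not> P q}"
  have N [measurable]: "?N \<in> sets (X \<Otimes>\<^sub>M borel)" using P by measurable
  have "(AE q in semiprod X \<kappa>. P q) \<longleftrightarrow> emeasure (semiprod X \<kappa>) ?N = 0"
    using N by (intro AE_iff_measurable) (auto simp: space_pair_measure)
  also have "\<dots> \<longleftrightarrow> (AE z in X. (\<integral>\<^sup>+ y. indicator ?N (z, y) \<partial>\<kappa> z) = 0)"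
    using N by (simp add: emeasure_semiprod[OF \<kappa> N] nn_integral_0_iff_AE moment_kernel_measurable_pair[OF \<kappa>])
  also have "\<dots> \<longleftrightarrow> (AE z in X. AE y in \<kappa> z. P (z, y))"
  proof (rule AE_cong)
    fix z assume z: "z \<in> space X"
    have "(\<integral>\<^sup>+ y. indicator ?N (z, y) \<partial>\<kappa> z) = 0 \<longleftrightarrow> (AE y in \<kappa> z. indicator ?N (z, y) = (0::ennreal))"
      by (rule nn_integral_0_iff_AE, rule moment_kernel_nn_section[OF \<kappa> _ z, of "indicator ?N"])
         (simp add: N)
    also have "\<dots> \<longleftrightarrow> (AE y in \<kappa> z. P (z, y))"
      using z by (intro AE_cong) (auto simp: indicator_def space_pair_measure)
    finally show "(\<integral>\<^sup>+ y. indicator ?N (z, y) \<partial>\<kappa> z) = 0 \<longleftrightarrow> (AE y in \<kappa> z. P (z, y))" .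
  qed
  finally show ?thesis .
qed

text \<open>The pointwise form of Markov's inequality: the mass above 1/(k+1) is at most k+1 times
  the first moment. This is the source of sigma-finiteness for moment kernels.\<close>

lemma indicator_le_multiple:
  "indicator {1 / real (Suc k)<..} y \<le> of_nat (Suc k) * ennreal y"
proof (cases "y > 1 / real (Suc k)")
  case y: True
  have "0 < y" using y by (smt (verit) divide_pos_pos of_nat_0_less_iff zero_less_Suc)
  have "1 \<le> ennreal (real (Suc k) * y)"
    using y by (simp add: field_simps del: of_nat_Suc)
  also have "\<dots> = of_nat (Suc k) * ennreal y"
    using \<open>0 < y\<close> by (simp add: ennreal_mult ennreal_of_nat_eq_real_of_nat del: of_nat_Suc)
  finally show ?thesis by (simp add: indicator_def)
qed simp

lemma sigma_finite_semiprod: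
  assumes "sigma_finite_measure X" and \<kappa>: "moment_kernel X \<kappa>"
  shows "sigma_finite_measure (semiprod X \<kappa>)"
proof -
  interpret sigma_finite_measure X by fact
  obtain B :: "nat \<Rightarrow> 'a set" where B: "range B \<subseteq> sets X" "(\<Union>i. B i) = space X" "\<And>i. emeasure X (B i) \<noteq> \<infinity>"
    using sigma_finite by blast
  then have Bs [measurable]: "B i \<in> sets X" for i by auto
  define m where "m z = (\<integral>\<^sup>+ y. ennreal y \<partial>\<kappa> z)" for z
  have m [measurable]: "m \<in> borel_measurable X"
    unfolding m_def by (rule moment_kernel_measurable[OF \<kappa>]) simp
  \<comment> \<open>By Markov's inequality the set with indices i, j, k has measure at most (k+1) j
    X(B i). These sets exhaust all positive masses; the remaining ones form the null set
    \<open>N\<close>.\<close>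
  define C :: "nat \<times> nat \<times> nat \<Rightarrow> ('a \<times> real) set" where
    "C = (\<lambda>(i, j, k). {z \<in> B i. m z \<le> of_nat j} \<times> {1 / real (Suc k)<..})"
  define N :: "('a \<times> real) set" where "N = space X \<times> {..0}"
  have Bm: "{z \<in> B i. m z \<le> of_nat j} \<in> sets X" for i j
  proof -
    have "{z \<in> space X. z \<in> B i \<and> m z \<le> of_nat j} \<in> sets X" by measurable
    also have "{z \<in> space X. z \<in> B i \<and> m z \<le> of_nat j} = {z \<in> B i. m z \<le> of_nat j}"
      using sets.sets_into_space[OF Bs] by auto
    finally show ?thesis .
  qed
  have Cs: "C p \<in> sets (X \<Otimes>\<^sub>M borel)" for p
    using Bm by (cases p) (auto simp: C_def)
  have Ns: "N \<in> sets (X \<Otimes>\<^sub>M borel)" by (simp add: N_def)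
  have "emeasure (semiprod X \<kappa>) N = (\<integral>\<^sup>+ z. 0 \<partial>X)"
    unfolding emeasure_semiprod[OF \<kappa> Ns]
  proof (rule nn_integral_cong)
    fix z assume z: "z \<in> space X"
    have "(\<integral>\<^sup>+ y. indicator N (z, y) \<partial>\<kappa> z) = (\<integral>\<^sup>+ y. 0 \<partial>\<kappa> z)"
      by (rule nn_integral_cong_AE, use moment_kernelD(3)[OF \<kappa> z] in eventually_elim) (auto simp: N_def)
    then show "(\<integral>\<^sup>+ y. indicator N (z, y) \<partial>\<kappa> z) = 0" by simp
  qed
  then have N0: "emeasure (semiprod X \<kappa>) N \<noteq> \<infinity>" by simp
  have Cfin: "emeasure (semiprod X \<kappa>) (C (i, j, k)) \<noteq> \<infinity>" for i j k
  proof -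
    have "emeasure (semiprod X \<kappa>) (C (i, j, k)) \<le> (\<integral>\<^sup>+ z. (of_nat (Suc k) * of_nat j) * indicator (B i) z \<partial>X)"
      unfolding emeasure_semiprod[OF \<kappa> Cs]
    proof (rule nn_integral_mono)
      fix z assume z: "z \<in> space X"
      show "(\<integral>\<^sup>+ y. indicator (C (i, j, k)) (z, y) \<partial>\<kappa> z) \<le> (of_nat (Suc k) * of_nat j) * indicator (B i) z"
      proof (cases "z \<in> B i \<and> m z \<le> of_nat j")
        case True
        have "(\<integral>\<^sup>+ y. indicator (C (i, j, k)) (z, y) \<partial>\<kappa> z) \<le> (\<integral>\<^sup>+ y. of_nat (Suc k) * ennreal y \<partial>\<kappa> z)"
        proof (rule nn_integral_mono)
          fix y
          have "indicator (C (i, j, k)) (z, y) \<le> (indicator {1 / real (Suc k)<..} y :: ennreal)"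
            by (simp add: C_def indicator_def)
          also note indicator_le_multiple
          finally show "indicator (C (i, j, k)) (z, y) \<le> of_nat (Suc k) * ennreal y" .
        qed
        also have "\<dots> = of_nat (Suc k) * m z"
          unfolding m_def using moment_kernelD(1)[OF \<kappa> z]
          by (intro nn_integral_cmult) (simp cong: measurable_cong_sets)
        also have "\<dots> \<le> of_nat (Suc k) * of_nat j"
          using True by (intro mult_left_mono) auto
        finally show ?thesis using True by simp
      qed (auto simp: C_def)
    qed
    also have "\<dots> = (of_nat (Suc k) * of_nat j) * emeasure X (B i)"
      by (simp add: nn_integral_cmult)
    also have "\<dots> < \<infinity>"
      using B(3)[of i] by (simp add: ennreal_mult_less_top top.not_eq_extremum of_nat_less_top)
    finally show ?thesis by simp
  qed
  show ?thesis
  proof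
    show "\<exists>A. countable A \<and> A \<subseteq> sets (semiprod X \<kappa>) \<and> \<Union> A = space (semiprod X \<kappa>) \<and>
        (\<forall>a\<in>A. emeasure (semiprod X \<kappa>) a \<noteq> \<infinity>)"
    proof (intro exI conjI)
      show "countable (insert N (range C))" by simp
      show "insert N (range C) \<subseteq> sets (semiprod X \<kappa>)" using Cs Ns by auto
      show "\<forall>a\<in>insert N (range C). emeasure (semiprod X \<kappa>) a \<noteq> \<infinity>"
        using Cfin N0 by auto
      show "\<Union> (insert N (range C)) = space (semiprod X \<kappa>)"
      proof (intro antisym subsetI)
        fix q assume "q \<in> \<Union> (insert N (range C))"
        then show "q \<in> space (semiprod X \<kappa>)"
          using sets.sets_into_space[OF Bs] by (auto simp: C_def N_def)
      next
        fix q :: "'a \<times> real" assume q: "q \<in> space (semiprod X \<kappa>)"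
        obtain z y where zy: "q = (z, y)" "z \<in> space X" using q by (cases q) auto
        show "q \<in> \<Union> (insert N (range C))"
        proof (cases "y \<le> 0")
          case False
          obtain i where "z \<in> B i" using zy B(2) by blast
          moreover obtain j :: nat where "m z \<le> of_nat j"
            using moment_kernelD(4)[OF \<kappa> zy(2)] ennreal_Ex_less_of_nat[of "m z"]
            by (auto simp: m_def intro: less_imp_le)
          moreover obtain k where "1 / real (Suc k) < y"
            using False reals_Archimedean[of y] by (auto simp: inverse_eq_divide)
          ultimately have "q \<in> C (i, j, k)" by (simp add: C_def zy)
          then show ?thesis by blast
        qed (use zy in \<open>auto simp: N_def\<close>)
      qed
    qed
  qed
qed

lemma sigma_finite_moment_kernel:
  assumes \<kappa>: "moment_kernel X \<kappa>" and z: "z \<in> space X"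
  shows "sigma_finite_measure (\<kappa> z)"
proof
  have s: "sets (\<kappa> z) = sets borel" "space (\<kappa> z) = UNIV" using moment_kernelD[OF \<kappa> z] by auto
  have fin: "emeasure (\<kappa> z) {1 / real (Suc k)<..} \<noteq> \<infinity>" for k
  proof -
    have "emeasure (\<kappa> z) {1 / real (Suc k)<..} = (\<integral>\<^sup>+ y. indicator {1 / real (Suc k)<..} y \<partial>\<kappa> z)"
      using s by simp
    also have "\<dots> \<le> (\<integral>\<^sup>+ y. of_nat (Suc k) * ennreal y \<partial>\<kappa> z)"
      by (intro nn_integral_mono indicator_le_multiple)
    also have "\<dots> = of_nat (Suc k) * (\<integral>\<^sup>+ y. ennreal y \<partial>\<kappa> z)"
      using s by (intro nn_integral_cmult) (simp cong: measurable_cong_sets)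
    also have "\<dots> < \<infinity>"
      using moment_kernelD(4)[OF \<kappa> z] by (simp add: ennreal_mult_less_top of_nat_less_top del: of_nat_Suc)
    finally show ?thesis by simp
  qed
  have un: "\<Union> (insert {..0} (range (\<lambda>k. {1 / real (Suc k)<..}))) = (UNIV::real set)"
  proof -
    have "\<exists>k. 1 / real (Suc k) < y" if "\<not> y \<le> 0" for y
      using that reals_Archimedean[of y] by (auto simp: inverse_eq_divide simp del: of_nat_Suc)
    then have "y \<in> {..0} \<union> (\<Union>k. {1 / real (Suc k)<..})" for y by (cases "y \<le> 0") auto
    then show ?thesis by blast
  qed
  show "\<exists>A. countable A \<and> A \<subseteq> sets (\<kappa> z) \<and> \<Union> A = space (\<kappa> z) \<and> (\<forall>a\<in>A. emeasure (\<kappa> z) a \<noteq> \<infinity>)"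
    using s fin un \<kappa> z
    by (intro exI[of _ "insert {..0} (range (\<lambda>k. {1 / real (Suc k)<..}))"])
       (auto simp: moment_kernel_def)
qed

section \<open>The heat kernel and its resolvent\<close>

lemma heat_density_measurable [measurable (raw)]:
  fixes x' x :: "'m \<Rightarrow> real ^ 'd"
  assumes [measurable]: "a \<in> borel_measurable borel" "t \<in> borel_measurable M" "x' \<in> borel_measurable M"
    "x \<in> borel_measurable M" "y \<in> borel_measurable M"
  shows "(\<lambda>m. heat_density a (t m) (x' m) (x m) (y m)) \<in> borel_measurable M"
  unfolding heat_density_def by measurable

lemma heat_density_nonneg [simp]: "0 \<le> heat_density a t x' x y"
  by (simp add: heat_density_def)

lemma heat_density_sym: "heat_density a t x' x y = heat_density a t x x' y"
  by (simp add: heat_density_def norm_minus_commute)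

text \<open>A product of one-dimensional Gaussians of variance \<open>a y * t\<close>, one per
  coordinate. Total mass and semigroup law are thereby reduced to
  \<open>normal_density\<close>.\<close>

lemma heat_density_eq_prod:
  fixes x x' :: "real ^ 'd"
  assumes v: "0 < a y * t"
  shows "heat_density a t x' x y = (\<Prod>b\<in>Basis. normal_density (x' \<bullet> b) (sqrt (a y * t)) (x \<bullet> b))"
proof -
  define v where "v = a y * t"
  have v0: "0 < v" using v by (simp add: v_def)
  have "(\<Prod>b\<in>Basis. normal_density (x' \<bullet> b) (sqrt v) (x \<bullet> b))
      = (\<Prod>b\<in>(Basis :: (real^'d) set). 1 / sqrt (2 * pi * v)) * (\<Prod>b\<in>Basis. exp (- (x \<bullet> b - x' \<bullet> b)\<^sup>2 / (2 * v)))"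
    using v0 by (simp only: prod.distrib[symmetric]) (simp add: normal_density_def)
  also have "(\<Prod>b\<in>Basis. exp (- (x \<bullet> b - x' \<bullet> b)\<^sup>2 / (2 * v))) = exp (\<Sum>b\<in>Basis. - (x \<bullet> b - x' \<bullet> b)\<^sup>2 / (2 * v))"
    by (simp add: exp_sum)
  also have "(\<Sum>b\<in>Basis. - (x \<bullet> b - x' \<bullet> b)\<^sup>2 / (2 * v)) = - ((norm (x' - x))\<^sup>2 / (2 * v))"
  proof -
    have "(norm (x' - x))\<^sup>2 = (\<Sum>b\<in>Basis. (x \<bullet> b - x' \<bullet> b)\<^sup>2)"
      unfolding norm_minus_commute[of x' x] power2_norm_eq_inner
      by (subst euclidean_inner) (simp add: inner_diff_left power2_eq_square)
    then show ?thesis by (simp add: sum_negf sum_divide_distrib)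
  qed
  also have "(\<Prod>b\<in>(Basis :: (real^'d) set). 1 / sqrt (2 * pi * v)) = (2 * pi * v) powr (- (real CARD('d) / 2))"
  proof -
    have "1 / sqrt (2 * pi * v) = (2 * pi * v) powr (- 1 / 2)"
      using v0 by (simp add: powr_half_sqrt powr_minus_divide)
    then have "(\<Prod>b\<in>(Basis :: (real^'d) set). 1 / sqrt (2 * pi * v)) = ((2 * pi * v) powr (- 1 / 2)) ^ CARD('d)"
      by simp
    also have "\<dots> = ((2 * pi * v) powr (- 1 / 2)) powr real CARD('d)"
      using v0 by (subst powr_realpow) auto
    also have "\<dots> = (2 * pi * v) powr (- 1 / 2 * real CARD('d))"
      by (rule powr_powr)
    finally show ?thesis by (simp add: field_simps)
  qed
  finally show ?thesis
    by (simp add: heat_density_def v_def mult.assoc)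
qed

lemma nn_integral_normal_density_shift:
  assumes "0 < \<sigma>"
  shows "(\<integral>\<^sup>+ x. ennreal (normal_density \<mu> \<sigma> x) \<partial>lborel) = 1"
  using integrable_normal_density[OF assms] integral_normal_density[OF assms]
  by (subst nn_integral_eq_integral) auto

lemma nn_integral_heat_density:
  fixes x' :: "real ^ 'd"
  assumes v: "0 < a y" "0 < t"
  shows "(\<integral>\<^sup>+ x. ennreal (heat_density a t x' x y) \<partial>lborel) = 1"
proof -
  have v: "0 < a y * t" using v by simp
  have "(\<integral>\<^sup>+ x. ennreal (heat_density a t x' x y) \<partial>lborel)
      = (\<integral>\<^sup>+ x. (\<Prod>b\<in>Basis. ennreal (normal_density (x' \<bullet> b) (sqrt (a y * t)) (x \<bullet> b))) \<partial>lborel)"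
    unfolding heat_density_eq_prod[of a y, OF v] by (simp add: prod_ennreal)
  also have "\<dots> = (\<Prod>b\<in>(Basis :: (real^'d) set). \<integral>\<^sup>+ u. ennreal (normal_density (x' \<bullet> b) (sqrt (a y * t)) u) \<partial>lborel)"
    by (rule nn_integral_lborel_prod) auto
  also have "\<dots> = 1"
    using v by (subst nn_integral_normal_density_shift) (auto simp: zero_less_mult_iff)
  finally show ?thesis .
qed

lemma nn_integral_heat_density':
  fixes x :: "real ^ 'd"
  assumes "0 < a y" "0 < t"
  shows "(\<integral>\<^sup>+ x'. ennreal (heat_density a t x' x y) \<partial>lborel) = 1"
  using nn_integral_heat_density[of a y, OF assms, of x] by (simp add: heat_density_sym[of a t _ x])

text \<open>Translation by u turns both factors into centred Gaussians, for which convolution adds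
  the variances.\<close>

lemma normal_density_convolution:
  assumes "0 < \<sigma>" "0 < \<tau>"
  shows "(\<integral>\<^sup>+ z. ennreal (normal_density u \<sigma> z * normal_density z \<tau> v) \<partial>lborel)
      = ennreal (normal_density u (sqrt (\<sigma>\<^sup>2 + \<tau>\<^sup>2)) v)"
proof -
  have eq: "normal_density z \<tau> v = normal_density 0 \<tau> ((v - u) - (z - u))"
    "normal_density u \<sigma> z = normal_density 0 \<sigma> (z - u)" for z
    by (simp_all add: normal_density_def)
  have "(\<integral>\<^sup>+ z. ennreal (normal_density u \<sigma> z * normal_density z \<tau> v) \<partial>lborel)
      = (\<integral>\<^sup>+ z. ennreal (normal_density 0 \<tau> ((v - u) - (z - u)) * normal_density 0 \<sigma> (z - u)) \<partial>lborel)"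
    unfolding eq by (simp add: mult.commute)
  also have "\<dots> = (\<integral>\<^sup>+ z. ennreal (normal_density 0 \<tau> ((v - u) - z) * normal_density 0 \<sigma> z) \<partial>lborel)"
    by (subst nn_integral_real_affine[where c = 1 and t = "u"]) auto
  also have "\<dots> = ennreal (normal_density 0 (sqrt (\<tau>\<^sup>2 + \<sigma>\<^sup>2)) (v - u))"
    using fun_cong[OF conv_normal_density_zero_mean[OF assms(2,1)]] .
  finally show ?thesis by (simp add: normal_density_def add.commute)
qed

text \<open>Chapman-Kolmogorov, coordinate by coordinate: the variances \<open>a y * s\<close> and
  \<open>a y * t\<close> add. The mass is the same in both factors, as the diffusivity depends on
  it.\<close>

lemma heat_density_semigroup:
  fixes x x' :: "real ^ 'd"
  assumes a: "0 < a y" and s: "0 < s" and t: "0 < t"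
  shows "(\<integral>\<^sup>+ z. ennreal (heat_density a s x z y) * ennreal (heat_density a t z x' y) \<partial>lborel)
    = ennreal (heat_density a (s + t) x x' y)"
proof -
  have p: "0 < a y * s" "0 < a y * t" "0 < a y * (s + t)" using assms by auto
  have "(\<integral>\<^sup>+ z. ennreal (heat_density a s x z y) * ennreal (heat_density a t z x' y) \<partial>lborel)
      = (\<integral>\<^sup>+ z. (\<Prod>b\<in>Basis. ennreal (normal_density (x \<bullet> b) (sqrt (a y * s)) (z \<bullet> b) *
            normal_density (z \<bullet> b) (sqrt (a y * t)) (x' \<bullet> b))) \<partial>lborel)"
    unfolding heat_density_eq_prod[of a y, OF p(1)] heat_density_eq_prod[of a y, OF p(2)]
    by (simp add: prod_ennreal prod_nonneg prod.distrib ennreal_mult)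
  also have "\<dots> = (\<Prod>b\<in>(Basis :: (real^'d) set). \<integral>\<^sup>+ u. ennreal (normal_density (x \<bullet> b) (sqrt (a y * s)) u *
            normal_density u (sqrt (a y * t)) (x' \<bullet> b)) \<partial>lborel)"
    by (rule nn_integral_lborel_prod) (auto simp: normal_density_def)
  also have "\<dots> = (\<Prod>b\<in>(Basis :: (real^'d) set). ennreal (normal_density (x \<bullet> b) (sqrt (a y * (s + t))) (x' \<bullet> b)))"
    using p by (subst normal_density_convolution) (simp_all add: less_imp_le distrib_left)
  also have "\<dots> = ennreal (heat_density a (s + t) x x' y)"
    unfolding heat_density_eq_prod[of a y, OF p(3)] by (simp add: prod_ennreal)
  finally show ?thesis .
qed

text \<open>The prefactor is largest at diffusivity 1/n and the exponential at diffusivity n; moving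
  the prefactor from 1/n to n costs (n^2)^(d/2) = n^d. The majorant does not depend on the mass,
  which permits bounds at a single point (t,x).\<close>

lemma heat_density_le_const:
  fixes x x' :: "real ^ 'd"
  assumes n: "1 \<le> n" "1 / n \<le> a y" "a y \<le> n" and t: "0 < t"
  shows "heat_density a t x' x y \<le> n ^ CARD('d) * heat_density (\<lambda>_. n) t x' x y"
proof -
  have a0: "0 < a y" using n by (smt (verit) divide_pos_pos)
  have "(2 * pi * a y * t) powr (- (real CARD('d) / 2)) \<le> (2 * pi * (1 / n) * t) powr (- (real CARD('d) / 2))"
  proof (rule powr_mono2')
    have "2 * pi * (1 / n) \<le> 2 * pi * a y" using n(2) by (intro mult_left_mono) auto
    then show "2 * pi * (1 / n) * t \<le> 2 * pi * a y * t" using t by (intro mult_right_mono) auto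
  qed (use n t in auto)
  also have "2 * pi * (1 / n) * t = (2 * pi * n * t) * (n powr - 2)"
    using n by (simp add: powr_minus_divide power2_eq_square)
  also have "((2 * pi * n * t) * (n powr - 2)) powr (- (real CARD('d) / 2))
      = (2 * pi * n * t) powr (- (real CARD('d) / 2)) * n ^ CARD('d)"
    using n t by (subst powr_mult) (auto simp: powr_powr powr_realpow)
  finally have *: "(2 * pi * a y * t) powr (- (real CARD('d) / 2))
      \<le> (2 * pi * n * t) powr (- (real CARD('d) / 2)) * n ^ CARD('d)" .
  have "exp (- ((norm (x' - x))\<^sup>2 / (2 * a y * t))) \<le> exp (- ((norm (x' - x))\<^sup>2 / (2 * n * t)))"
    using n t a0 by (simp add: frac_le)
  from mult_mono[OF * this] show ?thesis
    unfolding heat_density_def using n by (simp add: mult_ac)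
qed

section \<open>Space-time, phase space and the backward resolvent\<close>

abbreviation spacetime :: "(real \<times> (real ^ 'd)) measure"
  where "spacetime \<equiv> lborel \<Otimes>\<^sub>M lborel"

abbreviation phase :: "((real \<times> (real ^ 'd)) \<times> real) measure"
  where "phase \<equiv> spacetime \<Otimes>\<^sub>M borel"

abbreviation phase2 :: "(((real \<times> (real ^ 'd)) \<times> real) \<times> real) measure"
  where "phase2 \<equiv> phase \<Otimes>\<^sub>M borel"

lemma sigma_finite_spacetime: "sigma_finite_measure (spacetime :: (real \<times> (real ^ 'd)) measure)"
  by (simp add: lborel_prod lborel.sigma_finite_measure_axioms)

lemma nn_integral_spacetime:
  assumes [measurable]: "f \<in> borel_measurable (spacetime :: (real \<times> (real ^ 'd)) measure)"
  shows "(\<integral>\<^sup>+ z. f z \<partial>spacetime) = (\<integral>\<^sup>+ t. (\<integral>\<^sup>+ x. f (t, x) \<partial>lborel) \<partial>lborel)"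
  by (rule lborel.nn_integral_fst[symmetric]) simp

text \<open>The condition \<open>0 \<le> s\<close> keeps the resolvent of a function supported in \<open>[0,T]\<close> supported there.\<close>

definition resolvent_density ::
    "(real \<Rightarrow> real) \<Rightarrow> real \<Rightarrow> real \<Rightarrow> real \<times> (real ^ 'd) \<Rightarrow> real \<times> (real ^ 'd) \<Rightarrow> real"
  where "resolvent_density a \<Lambda> y z z' =
    (if 0 \<le> fst z \<and> fst z < fst z'
     then exp (- \<Lambda> * (fst z' - fst z)) * heat_density a (fst z' - fst z) (snd z) (snd z') y else 0)"

text \<open>Formally, \<psi> = U_\<Lambda> \<Phi> solves the backward equation d\<psi>/ds + (a(y)/2)
  Laplace \<psi> - \<Lambda> \<psi> = - \<Phi> for s \<ge> 0, with the mass y as a parameter. Values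
  in [0,\<infinity>] make it available for every nonnegative measurable \<Phi>.\<close>

definition resolvent ::
    "(real \<Rightarrow> real) \<Rightarrow> real \<Rightarrow> ((real \<times> (real ^ 'd)) \<times> real \<Rightarrow> ennreal) \<Rightarrow> (real \<times> (real ^ 'd)) \<times> real \<Rightarrow> ennreal"
  where "resolvent a \<Lambda> \<Phi> q =
    (\<integral>\<^sup>+ z'. ennreal (resolvent_density a \<Lambda> (snd q) (fst q) z') * \<Phi> (z', snd q) \<partial>spacetime)"

lemma resolvent_density_measurable [measurable (raw)]:
  fixes z z' :: "'m \<Rightarrow> real \<times> (real ^ 'd)"
  assumes [measurable]: "a \<in> borel_measurable borel" "z \<in> M \<rightarrow>\<^sub>M borel \<Otimes>\<^sub>M borel" "z' \<in> M \<rightarrow>\<^sub>M borel \<Otimes>\<^sub>M borel"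
    "y \<in> borel_measurable M"
  shows "(\<lambda>m. resolvent_density a \<Lambda> (y m) (z m) (z' m)) \<in> borel_measurable M"
  unfolding resolvent_density_def by measurable

lemma resolvent_density_nonneg [simp]: "0 \<le> resolvent_density a \<Lambda> y z z'"
  by (simp add: resolvent_density_def)

lemma resolvent_measurable [measurable]:
  assumes [measurable]: "a \<in> borel_measurable borel" "\<Phi> \<in> borel_measurable phase"
  shows "resolvent a \<Lambda> \<Phi> \<in> borel_measurable phase"
proof -
  interpret sigma_finite_measure "spacetime :: (real \<times> (real ^ 'd)) measure"
    by (rule sigma_finite_spacetime)
  show ?thesis
    unfolding resolvent_def[abs_def] by measurable
qed

lemma resolvent_mono:
  "(\<And>z. \<Phi> (z, snd q) \<le> \<Psi> (z, snd q)) \<Longrightarrow> resolvent a \<Lambda> \<Phi> q \<le> resolvent a \<Lambda> \<Psi> q"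
  unfolding resolvent_def by (intro nn_integral_mono mult_left_mono) auto

text \<open>Space integrates out because the heat kernel has mass one in its target variable; a
  function of time and mass alone is mapped to a function of the same kind.\<close>

lemma resolvent_time_mass:
  assumes [measurable]: "a \<in> borel_measurable borel" "\<eta> \<in> borel_measurable borel" and a: "0 < a y"
  shows "resolvent a \<Lambda> (\<lambda>q. \<eta> (fst (fst q)) * h (snd q)) ((s, x), y)
    = (\<integral>\<^sup>+ t. (if 0 \<le> s \<and> s < t then ennreal (exp (- \<Lambda> * (t - s))) else 0) * \<eta> t \<partial>lborel) * h y"
proof -
  have "resolvent a \<Lambda> (\<lambda>q. \<eta> (fst (fst q)) * h (snd q)) ((s, x), y)
      = (\<integral>\<^sup>+ t. (\<integral>\<^sup>+ x'. ((if 0 \<le> s \<and> s < t then ennreal (exp (- \<Lambda> * (t - s))) else 0) * \<eta> t * h y) *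
            ennreal (heat_density a (t - s) x x' y) \<partial>lborel) \<partial>lborel)"
    unfolding resolvent_def
    by (subst nn_integral_spacetime)
       (auto simp: resolvent_density_def ennreal_mult mult_ac intro!: nn_integral_cong)
  also have "\<dots> = (\<integral>\<^sup>+ t. ((if 0 \<le> s \<and> s < t then ennreal (exp (- \<Lambda> * (t - s))) else 0) * \<eta> t) * h y \<partial>lborel)"
  proof (rule nn_integral_cong)
    fix t :: real
    show "(\<integral>\<^sup>+ x'. ((if 0 \<le> s \<and> s < t then ennreal (exp (- \<Lambda> * (t - s))) else 0) * \<eta> t * h y) *
            ennreal (heat_density a (t - s) x x' y) \<partial>lborel)
        = ((if 0 \<le> s \<and> s < t then ennreal (exp (- \<Lambda> * (t - s))) else 0) * \<eta> t) * h y"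
      using nn_integral_heat_density[of a y "t - s" x, OF a] by (subst nn_integral_cmult) auto
  qed
  also have "\<dots> = (\<integral>\<^sup>+ t. (if 0 \<le> s \<and> s < t then ennreal (exp (- \<Lambda> * (t - s))) else 0) * \<eta> t \<partial>lborel) * h y"
    by (rule nn_integral_multc) measurable
  finally show ?thesis .
qed

lemma nn_integral_interval_FTC:
  fixes f F :: "real \<Rightarrow> real"
  assumes "\<And>x. DERIV F x :> f x" "\<And>x. 0 \<le> f x" "f \<in> borel_measurable borel" "a \<le> b"
  shows "(\<integral>\<^sup>+ x. ennreal (f x) * indicator {a<..<b} x \<partial>lborel) = ennreal (F b - F a)"
proof -
  have "(\<integral>\<^sup>+ x. ennreal (f x) * indicator {a<..<b} x \<partial>lborel) = (\<integral>\<^sup>+ x. ennreal (f x) * indicator {a..b} x \<partial>lborel)"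
  proof (rule nn_integral_cong_AE)
    show "AE x in lborel. ennreal (f x) * indicator {a<..<b} x = ennreal (f x) * indicator {a..b} x"
      using AE_lborel_singleton[of a] AE_lborel_singleton[of b]
      by eventually_elim (auto simp: indicator_def)
  qed
  also have "\<dots> = ennreal (F b - F a)"
    using assms by (intro nn_integral_FTC_Icc) auto
  finally show ?thesis .
qed

text \<open>At an intermediate time r the semigroup law makes the spatial integral independent of r.
  What remains is the integral of exp (- \<Lambda> (t - r)) over r from s to t, which is (1 - exp (-
  \<Lambda> (t - s))) / \<Lambda>.\<close>

lemma resolvent_density_convolution:
  fixes z z' :: "real \<times> (real ^ 'd)"
  assumes [measurable]: "a \<in> borel_measurable borel" and a: "0 < a y" and \<Lambda>: "0 < \<Lambda>"
  shows "(\<integral>\<^sup>+ u. ennreal (resolvent_density a 0 y z u) * ennreal (resolvent_density a \<Lambda> y u z') \<partial>spacetime)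
    = ennreal ((resolvent_density a 0 y z z' - resolvent_density a \<Lambda> y z z') / \<Lambda>)"
proof -
  obtain s x where z: "z = (s, x)" by (cases z)
  obtain t x' where z': "z' = (t, x')" by (cases z')
  let ?H = "\<lambda>r w. ennreal (heat_density a (r - s) x w y) * ennreal (heat_density a (t - r) w x' y)"
  have "(\<integral>\<^sup>+ u. ennreal (resolvent_density a 0 y z u) * ennreal (resolvent_density a \<Lambda> y u z') \<partial>spacetime)
    = (\<integral>\<^sup>+ r. (\<integral>\<^sup>+ w. (if 0 \<le> s \<and> s < r \<and> r < t then ennreal (exp (- \<Lambda> * (t - r))) else 0) * ?H r w \<partial>lborel) \<partial>lborel)"
    by (subst nn_integral_spacetime)
       (auto simp: resolvent_density_def z z' ennreal_mult mult_ac intro!: nn_integral_cong)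
  also have "\<dots> = (\<integral>\<^sup>+ r. (if 0 \<le> s \<and> s < t then ennreal (heat_density a (t - s) x x' y) else 0) *
      (ennreal (exp (- \<Lambda> * (t - r))) * indicator {s<..<t} r) \<partial>lborel)"
  proof (rule nn_integral_cong)
    fix r :: real
    show "(\<integral>\<^sup>+ w. (if 0 \<le> s \<and> s < r \<and> r < t then ennreal (exp (- \<Lambda> * (t - r))) else 0) * ?H r w \<partial>lborel)
      = (if 0 \<le> s \<and> s < t then ennreal (heat_density a (t - s) x x' y) else 0) *
        (ennreal (exp (- \<Lambda> * (t - r))) * indicator {s<..<t} r)"
      using heat_density_semigroup[of a y "r - s" "t - r" x x', OF a]
      by (subst nn_integral_cmult) (auto simp: indicator_def mult.commute)
  qed
  also have "\<dots> = (if 0 \<le> s \<and> s < t then ennreal (heat_density a (t - s) x x' y) else 0) *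
      (\<integral>\<^sup>+ r. ennreal (exp (- \<Lambda> * (t - r))) * indicator {s<..<t} r \<partial>lborel)"
    by (rule nn_integral_cmult) measurable
  also have "\<dots> = ennreal ((resolvent_density a 0 y z z' - resolvent_density a \<Lambda> y z z') / \<Lambda>)"
  proof (cases "0 \<le> s \<and> s < t")
    case True
    have "(\<integral>\<^sup>+ r. ennreal (exp (- \<Lambda> * (t - r))) * indicator {s<..<t} r \<partial>lborel)
        = ennreal (exp (- \<Lambda> * (t - t)) / \<Lambda> - exp (- \<Lambda> * (t - s)) / \<Lambda>)"
      using True \<Lambda> by (intro nn_integral_interval_FTC) (auto intro!: derivative_eq_intros)
    then show ?thesis
      using True \<Lambda> by (simp add: resolvent_density_def z z' ennreal_mult[symmetric] field_simps)
  next
    case False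
    then have "(if 0 \<le> s \<and> s < t then c else 0) = 0" for c :: ennreal by auto
    moreover have "resolvent_density a \<Lambda> y z z' = 0" for \<Lambda>
      using False by (auto simp: resolvent_density_def z z')
    ultimately show ?thesis by simp
  qed
  finally show ?thesis .
qed

lemma resolvent_density_antimono:
  "0 \<le> \<Lambda> \<Longrightarrow> resolvent_density a \<Lambda> y z z' \<le> resolvent_density a 0 y z z'"
  by (auto simp: resolvent_density_def intro!: mult_left_le_one_le)

text \<open>Fubini reduces the identity to the kernels. In additive form it holds in [0,\<infinity>]
  for every nonnegative \<Phi>, with no finiteness to check; subtraction is postponed to
  \<open>resolvent_difference\<close>.\<close>

lemma resolvent_identity:
  fixes q :: "(real \<times> (real ^ 'd)) \<times> real"
  assumes [measurable]: "a \<in> borel_measurable borel" "\<Phi> \<in> borel_measurable phase"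
    and a: "0 < a (snd q)" and \<Lambda>: "0 < \<Lambda>"
  shows "resolvent a 0 \<Phi> q = resolvent a \<Lambda> \<Phi> q + resolvent a 0 (\<lambda>q. ennreal \<Lambda> * resolvent a \<Lambda> \<Phi> q) q"
proof -
  interpret S: sigma_finite_measure "spacetime :: (real \<times> (real ^ 'd)) measure"
    by (rule sigma_finite_spacetime)
  interpret SS: pair_sigma_finite "spacetime :: (real \<times> (real ^ 'd)) measure" "spacetime :: (real \<times> (real ^ 'd)) measure"
    by standard
  have [simp]: "u \<in> space (borel \<Otimes>\<^sub>M borel)" for u :: "real \<times> (real ^ 'd)"
    by (simp add: space_pair_measure)
  obtain z y where q: "q = (z, y)" by (cases q)
  have a: "0 < a y" using a by (simp add: q)
  have \<Phi>y [measurable]: "(\<lambda>z'. \<Phi> (z', y)) \<in> borel_measurable spacetime" by measurable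
  let ?k = "\<lambda>\<Lambda> z z'. ennreal (resolvent_density a \<Lambda> y z z')"
  have "resolvent a 0 (\<lambda>q. ennreal \<Lambda> * resolvent a \<Lambda> \<Phi> q) q
      = (\<integral>\<^sup>+ u. (\<integral>\<^sup>+ z'. ennreal \<Lambda> * (?k 0 z u * ?k \<Lambda> u z' * \<Phi> (z', y)) \<partial>spacetime) \<partial>spacetime)"
    unfolding resolvent_def q
  proof (intro nn_integral_cong)
    fix u :: "real \<times> (real ^ 'd)"
    have "(\<integral>\<^sup>+ z'. ennreal \<Lambda> * (?k 0 z u * ?k \<Lambda> u z' * \<Phi> (z', y)) \<partial>spacetime)
        = (\<integral>\<^sup>+ z'. (ennreal \<Lambda> * ?k 0 z u) * (?k \<Lambda> u z' * \<Phi> (z', y)) \<partial>spacetime)"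
      by (simp add: mult_ac)
    also have "\<dots> = (ennreal \<Lambda> * ?k 0 z u) * (\<integral>\<^sup>+ z'. ?k \<Lambda> u z' * \<Phi> (z', y) \<partial>spacetime)"
      by (rule nn_integral_cmult) measurable
    finally show "ennreal (resolvent_density a 0 (snd (z, y)) (fst (z, y)) u) *
         (ennreal \<Lambda> * (\<integral>\<^sup>+ z'. ennreal (resolvent_density a \<Lambda> (snd (u, snd (z, y))) (fst (u, snd (z, y))) z') *
            \<Phi> (z', snd (u, snd (z, y))) \<partial>spacetime))
       = (\<integral>\<^sup>+ z'. ennreal \<Lambda> * (?k 0 z u * ?k \<Lambda> u z' * \<Phi> (z', y)) \<partial>spacetime)"
      by (simp add: mult_ac)
  qed
  also have "\<dots> = (\<integral>\<^sup>+ z'. (\<integral>\<^sup>+ u. (ennreal \<Lambda> * \<Phi> (z', y)) * (?k 0 z u * ?k \<Lambda> u z') \<partial>spacetime) \<partial>spacetime)"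
    by (subst SS.Fubini') (auto simp: mult_ac)
  also have "\<dots> = (\<integral>\<^sup>+ z'. ennreal (resolvent_density a 0 y z z' - resolvent_density a \<Lambda> y z z') * \<Phi> (z', y) \<partial>spacetime)"
  proof (rule nn_integral_cong)
    fix z' :: "real \<times> (real ^ 'd)"
    have "(\<integral>\<^sup>+ u. (ennreal \<Lambda> * \<Phi> (z', y)) * (?k 0 z u * ?k \<Lambda> u z') \<partial>spacetime)
        = (ennreal \<Lambda> * \<Phi> (z', y)) * (\<integral>\<^sup>+ u. ?k 0 z u * ?k \<Lambda> u z' \<partial>spacetime)"
      by (rule nn_integral_cmult) measurable
    also have "\<dots> = (ennreal \<Lambda> * \<Phi> (z', y)) * ennreal ((resolvent_density a 0 y z z' - resolvent_density a \<Lambda> y z z') / \<Lambda>)"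
      using resolvent_density_convolution[of a y \<Lambda> z z'] a \<Lambda> by simp
    also have "\<dots> = (ennreal \<Lambda> * ennreal ((resolvent_density a 0 y z z' - resolvent_density a \<Lambda> y z z') / \<Lambda>)) * \<Phi> (z', y)"
      by (simp add: mult_ac)
    also have "ennreal \<Lambda> * ennreal ((resolvent_density a 0 y z z' - resolvent_density a \<Lambda> y z z') / \<Lambda>)
        = ennreal (resolvent_density a 0 y z z' - resolvent_density a \<Lambda> y z z')"
      using \<Lambda> by (subst ennreal_mult'[symmetric]) auto
    finally show "(\<integral>\<^sup>+ u. (ennreal \<Lambda> * \<Phi> (z', y)) * (?k 0 z u * ?k \<Lambda> u z') \<partial>spacetime)
        = ennreal (resolvent_density a 0 y z z' - resolvent_density a \<Lambda> y z z') * \<Phi> (z', y)" .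
  qed
  finally have eq: "resolvent a 0 (\<lambda>q. ennreal \<Lambda> * resolvent a \<Lambda> \<Phi> q) q =
    (\<integral>\<^sup>+ z'. ennreal (resolvent_density a 0 y z z' - resolvent_density a \<Lambda> y z z') * \<Phi> (z', y) \<partial>spacetime)" .
  have "resolvent a \<Lambda> \<Phi> q + resolvent a 0 (\<lambda>q. ennreal \<Lambda> * resolvent a \<Lambda> \<Phi> q) q
    = (\<integral>\<^sup>+ z'. ?k \<Lambda> z z' * \<Phi> (z', y) +
        ennreal (resolvent_density a 0 y z z' - resolvent_density a \<Lambda> y z z') * \<Phi> (z', y) \<partial>spacetime)"
    unfolding eq by (subst nn_integral_add) (auto simp: resolvent_def q)
  also have "\<dots> = resolvent a 0 \<Phi> q"
    unfolding resolvent_def q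
  proof (intro nn_integral_cong)
    fix z' :: "real \<times> (real ^ 'd)"
    have "?k \<Lambda> z z' + ennreal (resolvent_density a 0 y z z' - resolvent_density a \<Lambda> y z z') = ?k 0 z z'"
      using resolvent_density_antimono[of \<Lambda> a y z z'] \<Lambda> by (subst ennreal_plus[symmetric]) auto
    then show "?k \<Lambda> z z' * \<Phi> (z', y) + ennreal (resolvent_density a 0 y z z' - resolvent_density a \<Lambda> y z z') * \<Phi> (z', y)
       = ennreal (resolvent_density a 0 (snd (z, y)) (fst (z, y)) z') * \<Phi> (z', snd (z, y))"
      by (simp add: distrib_right[symmetric])
  qed
  finally show ?thesis by simp
qed

text \<open>Over t \<ge> s the product exp (- \<Lambda> (t - s)) exp (- \<gamma> t) integrates to
  exp (- \<gamma> s) / (\<Lambda> + \<gamma>), and the cut at T only lowers this. The denominator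
  \<Lambda> + \<gamma> in place of \<Lambda> is what closes the final estimate.\<close>

lemma resolvent_exp_weight:
  assumes [measurable]: "a \<in> borel_measurable borel" and a: "0 < a y" and \<gamma>: "0 < \<Lambda> + \<gamma>"
  shows "resolvent a \<Lambda> (\<lambda>q. (ennreal (exp (- \<gamma> * fst (fst q))) * indicator {0..T} (fst (fst q))) * h (snd q)) ((s, x), y)
    \<le> ennreal (exp (- \<gamma> * s) / (\<Lambda> + \<gamma>)) * h y"
proof -
  have "(\<integral>\<^sup>+ t. (if 0 \<le> s \<and> s < t then ennreal (exp (- \<Lambda> * (t - s))) else 0) *
      (ennreal (exp (- \<gamma> * t)) * indicator {0..T} t) \<partial>lborel) \<le> ennreal (exp (- \<gamma> * s) / (\<Lambda> + \<gamma>))"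
  proof (cases "s \<le> T")
    case True
    have "(\<integral>\<^sup>+ t. (if 0 \<le> s \<and> s < t then ennreal (exp (- \<Lambda> * (t - s))) else 0) *
        (ennreal (exp (- \<gamma> * t)) * indicator {0..T} t) \<partial>lborel)
      \<le> (\<integral>\<^sup>+ t. ennreal (exp (\<Lambda> * s - (\<Lambda> + \<gamma>) * t)) * indicator {s..T} t \<partial>lborel)"
      by (intro nn_integral_mono)
         (auto simp: indicator_def ennreal_mult[symmetric] exp_add[symmetric] algebra_simps)
    also have "\<dots> = ennreal (- exp (\<Lambda> * s - (\<Lambda> + \<gamma>) * T) / (\<Lambda> + \<gamma>) - (- exp (\<Lambda> * s - (\<Lambda> + \<gamma>) * s) / (\<Lambda> + \<gamma>)))"
    proof (rule nn_integral_FTC_Icc)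
      fix t
      define c where "c = \<Lambda> + \<gamma>"
      have "DERIV (\<lambda>t. - exp (\<Lambda> * s - c * t) / c) t :> exp (\<Lambda> * s - c * t)"
        using \<gamma> by (auto intro!: derivative_eq_intros simp: c_def[symmetric])
      then show "DERIV (\<lambda>t. - exp (\<Lambda> * s - (\<Lambda> + \<gamma>) * t) / (\<Lambda> + \<gamma>)) t :> exp (\<Lambda> * s - (\<Lambda> + \<gamma>) * t)"
        by (simp add: c_def)
    qed (use True in auto)
    also have "\<dots> \<le> ennreal (exp (- \<gamma> * s) / (\<Lambda> + \<gamma>))"
      using \<gamma> by (intro ennreal_leI) (simp add: algebra_simps)
    finally show ?thesis .
  next
    case False
    have "(\<integral>\<^sup>+ t. (if 0 \<le> s \<and> s < t then ennreal (exp (- \<Lambda> * (t - s))) else 0) *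
        (ennreal (exp (- \<gamma> * t)) * indicator {0..T} t) \<partial>lborel) = (\<integral>\<^sup>+ (t::real). 0 \<partial>lborel)"
      by (intro nn_integral_cong) (use False in \<open>auto simp: indicator_def\<close>)
    then show ?thesis by simp
  qed
  then show ?thesis
    by (subst resolvent_time_mass[of a _ y, OF _ _ a]) (auto intro!: mult_right_mono)
qed

text \<open>Since \<open>ennreal\<close> sends negative numbers to 0, the factor
  \<open>ennreal (T - s)\<close> also covers s > T; the indicator covers s < 0.\<close>

lemma resolvent_interval:
  assumes [measurable]: "a \<in> borel_measurable borel" and a: "0 < a y"
  shows "resolvent a 0 (\<lambda>q. indicator {0..T} (fst (fst q)) * h (snd q)) ((s, x), y)
    = ennreal (T - s) * indicator {0..} s * h y"
proof -
  have "(\<integral>\<^sup>+ t. (if 0 \<le> s \<and> s < t then ennreal (exp (- 0 * (t - s))) else 0) * indicator {0..T} t \<partial>lborel)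
      = (\<integral>\<^sup>+ t. indicator {0..} s * indicator {s<..T} t \<partial>lborel)"
    by (intro nn_integral_cong) (auto simp: indicator_def)
  also have "\<dots> = ennreal (T - s) * indicator {0..} s"
    by (cases "s \<le> T") (auto simp: nn_integral_cmult mult.commute ennreal_neg)
  finally show ?thesis
    by (subst resolvent_time_mass[of a _ y, OF _ _ a]) auto
qed

section \<open>Weak formulation\<close>

text \<open>To have only Borel spaces around, functions on \<open>(0,\<infinity>)\<close> are extended to the real line by a constant
  and measures by zero.\<close>

definition extend1 :: "real \<Rightarrow> (real \<Rightarrow> real) \<Rightarrow> real \<Rightarrow> real"
  where "extend1 c f y = (if 0 < y then f y else c)"

definition extend2 :: "(real \<Rightarrow> real \<Rightarrow> real) \<Rightarrow> real \<Rightarrow> real \<Rightarrow> real"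
  where "extend2 K y y' = (if 0 < y \<and> 0 < y' then K y y' else 0)"

lemma space_masses [simp]: "space masses = {0<..}"
  by (simp add: masses_def)

lemma sets_masses: "A \<in> sets masses \<longleftrightarrow> A \<in> sets borel \<and> A \<subseteq> {0<..}"
  by (auto simp: masses_def sets_restrict_space_iff)

lemma measurable_masses_borel: "f \<in> borel \<rightarrow>\<^sub>M N \<Longrightarrow> f \<in> masses \<rightarrow>\<^sub>M N"
  unfolding masses_def by (rule measurable_restrict_space1)

lemma extend1_measurable [measurable]:
  assumes "f \<in> borel_measurable masses"
  shows "extend1 c f \<in> borel_measurable borel"
proof -
  have "(\<lambda>y. if 0 < y then f y else c) \<in> borel_measurable borel"
    using assms unfolding masses_def greaterThan_def
    by (subst measurable_If_restrict_space_iff) auto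
  then show ?thesis by (simp add: extend1_def[abs_def])
qed

lemma extend2_measurable:
  assumes "(\<lambda>(y, z). K y z) \<in> borel_measurable (masses \<Otimes>\<^sub>M masses)"
  shows "(\<lambda>p. extend2 K (fst p) (snd p)) \<in> borel_measurable (borel \<Otimes>\<^sub>M borel)"
proof -
  let ?S = "restrict_space (borel \<Otimes>\<^sub>M borel) {p. 0 < fst p \<and> 0 < snd p} :: (real \<times> real) measure"
  have "(\<lambda>p. (fst p, snd p)) \<in> ?S \<rightarrow>\<^sub>M masses \<Otimes>\<^sub>M masses"
    unfolding masses_def
    by (intro measurable_Pair measurable_restrict_space2 measurable_restrict_space1)
       (auto simp: space_restrict_space)
  from measurable_compose[OF this assms]
  have "(\<lambda>p. K (fst p) (snd p)) \<in> borel_measurable ?S" by (simp only: prod.case)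
  then have "(\<lambda>p. if 0 < fst p \<and> 0 < snd p then K (fst p) (snd p) else 0) \<in> borel_measurable (borel \<Otimes>\<^sub>M borel)"
    by (subst measurable_If_restrict_space_iff) auto
  then show ?thesis by (simp add: extend2_def)
qed

lemma coagulation_kernel_extend2:
  assumes K: "coagulation_kernel K" and [measurable]: "f \<in> borel_measurable M" "g \<in> borel_measurable M"
  shows "(\<lambda>m. extend2 K (f m) (g m)) \<in> borel_measurable M"
proof -
  have "(\<lambda>m. (f m, g m)) \<in> M \<rightarrow>\<^sub>M borel \<Otimes>\<^sub>M borel" by measurable
  from measurable_compose[OF this extend2_measurable, of K] show ?thesis
    using K by (simp add: coagulation_kernel_def)
qed

lemma extend2_nonneg: "coagulation_kernel K \<Longrightarrow> 0 \<le> extend2 K y y'"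
  by (auto simp: extend2_def coagulation_kernel_def intro: less_imp_le)

lemma extend2_commute: "coagulation_kernel K \<Longrightarrow> extend2 K y y' = extend2 K y' y"
  by (auto simp: extend2_def coagulation_kernel_def)

definition on_reals :: "real measure \<Rightarrow> real measure"
  where "on_reals M = distr M borel (\<lambda>y. y)"

lemma sets_on_reals [simp, measurable_cong]: "sets (on_reals M) = sets borel"
  by (simp add: on_reals_def)

lemma masses_id_measurable:
  assumes "sets M = sets masses"
  shows "(\<lambda>y. y) \<in> borel_measurable M"
  unfolding measurable_cong_sets[OF assms refl] by (rule measurable_masses_borel) simp

lemma nn_integral_on_reals:
  assumes "sets M = sets masses" "f \<in> borel_measurable borel"
  shows "(\<integral>\<^sup>+ y. f y \<partial>M) = (\<integral>\<^sup>+ y. f y \<partial>on_reals M)"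
  unfolding on_reals_def
  by (rule nn_integral_distr[OF masses_id_measurable[OF assms(1)], symmetric]) (simp add: assms(2))

lemma emeasure_on_reals:
  assumes M: "sets M = sets masses" and A: "A \<in> sets borel"
  shows "emeasure (on_reals M) A = emeasure M (A \<inter> {0<..})"
  using sets_eq_imp_space_eq[OF M]
  unfolding on_reals_def emeasure_distr[OF masses_id_measurable[OF M] A] by simp

lemma sigma_finite_of_on_reals:
  assumes "sets M = sets masses" "sigma_finite_measure (on_reals M)"
  shows "sigma_finite_measure M"
  using assms sigma_finite_measure_distr[OF _ masses_id_measurable[OF assms(1)]] by (simp add: on_reals_def)

lemma sets_coag_loss [simp]: "sets (coag_loss K M) = sets masses"
  unfolding coag_loss_def by (simp add: sets.sigma_sets_eq del: space_masses)

lemma sets_coag_gain [simp]: "sets (coag_gain K M) = sets masses"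
  unfolding coag_gain_def by (simp add: sets.sigma_sets_eq del: space_masses)

text \<open>Both formulas come from identifying the extended measure itself: the loss is a density
  with respect to \<open>on_reals M\<close>, the gain is the image under addition of the density K/2
  on its square. Sigma-finiteness is what allows Fubini.\<close>

lemma
  assumes sf: "sigma_finite_measure (on_reals M)" and M: "sets M = sets masses" and K: "coagulation_kernel K"
    and h [measurable]: "h \<in> borel_measurable borel"
  shows nn_integral_coag_loss: "(\<integral>\<^sup>+ u. h u \<partial>coag_loss K M) =
      (\<integral>\<^sup>+ y. (\<integral>\<^sup>+ y'. h y * ennreal (extend2 K y y') \<partial>on_reals M) \<partial>on_reals M)" (is ?loss)
    and nn_integral_coag_gain: "(\<integral>\<^sup>+ u. h u \<partial>coag_gain K M) =
      (\<integral>\<^sup>+ y. (\<integral>\<^sup>+ y'. h (y + y') * ennreal (extend2 K y y' / 2) \<partial>on_reals M) \<partial>on_reals M)" (is ?gain)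
proof -
  define N where "N = on_reals M"
  have sN [measurable_cong, simp]: "sets N = sets borel" by (simp add: N_def)
  interpret N: sigma_finite_measure N using sf by (simp add: N_def)
  have sp: "space M = {0<..}" using sets_eq_imp_space_eq[OF M] by simp
  have sfM: "sigma_finite_measure M" by (rule sigma_finite_of_on_reals) fact+
  note K' [measurable (raw)] = coagulation_kernel_extend2[OF K]
  have MN: "(\<integral>\<^sup>+ y. f y \<partial>M) = (\<integral>\<^sup>+ y. f y \<partial>N)" if "f \<in> borel_measurable borel" for f
    unfolding N_def by (rule nn_integral_on_reals[OF M that])
  have MMN: "(\<integral>\<^sup>+ y. (\<integral>\<^sup>+ y'. f y y' \<partial>M) \<partial>M) = (\<integral>\<^sup>+ y. (\<integral>\<^sup>+ y'. f y y' \<partial>N) \<partial>N)"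
    if f [measurable]: "(\<lambda>p. f (fst p) (snd p)) \<in> borel_measurable (borel \<Otimes>\<^sub>M borel)" for f :: "real \<Rightarrow> real \<Rightarrow> ennreal"
  proof -
    have "f y \<in> borel_measurable borel" for y
      using measurable_Pair2[OF f, of y] by simp
    then have "(\<integral>\<^sup>+ y. (\<integral>\<^sup>+ y'. f y y' \<partial>M) \<partial>M) = (\<integral>\<^sup>+ y. (\<integral>\<^sup>+ y'. f y y' \<partial>N) \<partial>M)"
      by (simp add: MN)
    also have "\<dots> = (\<integral>\<^sup>+ y. (\<integral>\<^sup>+ y'. f y y' \<partial>N) \<partial>N)"
      using f by (intro MN N.borel_measurable_nn_integral) (simp add: case_prod_beta')
    finally show ?thesis .
  qed
  have "on_reals (coag_loss K M) = density N (\<lambda>y. \<integral>\<^sup>+ y'. ennreal (extend2 K y y') \<partial>N)"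
  proof (rule measure_eqI)
    fix A assume "A \<in> sets (on_reals (coag_loss K M))"
    then have A [measurable]: "A \<in> sets borel" by simp
    then have Am: "A \<inter> {0<..} \<in> sets masses" by (simp add: sets_masses)
    have "emeasure (on_reals (coag_loss K M)) A = emeasure (coag_loss K M) (A \<inter> {0<..})"
      by (rule emeasure_on_reals) auto
    also have "\<dots> = (\<integral>\<^sup>+ y. indicator (A \<inter> {0<..}) y * (\<integral>\<^sup>+ y'. ennreal (K y y') \<partial>M) \<partial>M)"
      by (rule emeasure_coag_loss) fact+
    also have "\<dots> = (\<integral>\<^sup>+ y. (\<integral>\<^sup>+ y'. indicator A y * ennreal (extend2 K y y') \<partial>M) \<partial>M)"
    proof (rule nn_integral_cong)
      fix y assume y: "y \<in> space M"
      have "(\<integral>\<^sup>+ y'. ennreal (K y y') \<partial>M) = (\<integral>\<^sup>+ y'. ennreal (extend2 K y y') \<partial>M)"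
        using y by (intro nn_integral_cong) (auto simp: extend2_def sp)
      then show "indicator (A \<inter> {0<..}) y * (\<integral>\<^sup>+ y'. ennreal (K y y') \<partial>M) = (\<integral>\<^sup>+ y'. indicator A y * ennreal (extend2 K y y') \<partial>M)"
        using y by (auto simp: indicator_def sp)
    qed
    also have "\<dots> = (\<integral>\<^sup>+ y. (\<integral>\<^sup>+ y'. indicator A y * ennreal (extend2 K y y') \<partial>N) \<partial>N)"
      by (rule MMN) measurable
    also have "\<dots> = (\<integral>\<^sup>+ y. (\<integral>\<^sup>+ y'. ennreal (extend2 K y y') \<partial>N) * indicator A y \<partial>N)"
      by (simp add: nn_integral_cmult mult.commute)
    also have "\<dots> = emeasure (density N (\<lambda>y. \<integral>\<^sup>+ y'. ennreal (extend2 K y y') \<partial>N)) A"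
      by (rule emeasure_density[symmetric]) measurable
    finally show "emeasure (on_reals (coag_loss K M)) A = emeasure (density N (\<lambda>y. \<integral>\<^sup>+ y'. ennreal (extend2 K y y') \<partial>N)) A" .
  qed simp
  then have "(\<integral>\<^sup>+ u. h u \<partial>coag_loss K M) = (\<integral>\<^sup>+ u. h u \<partial>density N (\<lambda>y. \<integral>\<^sup>+ y'. ennreal (extend2 K y y') \<partial>N))"
    by (simp add: nn_integral_on_reals[OF sets_coag_loss h])
  also have "\<dots> = (\<integral>\<^sup>+ y. (\<integral>\<^sup>+ y'. ennreal (extend2 K y y') \<partial>N) * h y \<partial>N)"
    by (rule nn_integral_density) measurable
  also have "\<dots> = (\<integral>\<^sup>+ y. (\<integral>\<^sup>+ y'. h y * ennreal (extend2 K y y') \<partial>N) \<partial>N)"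
    by (simp add: nn_integral_cmult mult.commute)
  finally show ?loss unfolding N_def .
  let ?D = "density (N \<Otimes>\<^sub>M N) (\<lambda>p. ennreal (extend2 K (fst p) (snd p) / 2))"
  have "on_reals (coag_gain K M) = distr ?D borel (\<lambda>p. fst p + snd p)"
  proof (rule measure_eqI)
    fix A assume "A \<in> sets (on_reals (coag_gain K M))"
    then have A [measurable]: "A \<in> sets borel" by simp
    then have Am: "A \<inter> {0<..} \<in> sets masses" by (simp add: sets_masses)
    have "emeasure (on_reals (coag_gain K M)) A = emeasure (coag_gain K M) (A \<inter> {0<..})"
      by (rule emeasure_on_reals) auto
    also have "\<dots> = ennreal (1 / 2) *
        (\<integral>\<^sup>+ y. (\<integral>\<^sup>+ y'. indicator (A \<inter> {0<..}) (y + y') * ennreal (K y y') \<partial>M) \<partial>M)"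
      by (rule emeasure_coag_gain) fact+
    also have "\<dots> = ennreal (1 / 2) *
        (\<integral>\<^sup>+ y. (\<integral>\<^sup>+ y'. indicator A (y + y') * ennreal (extend2 K y y') \<partial>M) \<partial>M)"
      by (intro arg_cong[where f="\<lambda>u. ennreal (1 / 2) * u"] nn_integral_cong)
         (auto simp: sp extend2_def indicator_def)
    also have "\<dots> = ennreal (1 / 2) *
        (\<integral>\<^sup>+ y. (\<integral>\<^sup>+ y'. indicator A (y + y') * ennreal (extend2 K y y') \<partial>N) \<partial>N)"
      by (subst MMN) auto
    also have "\<dots> = ennreal (1 / 2) *
        (\<integral>\<^sup>+ p. indicator A (fst p + snd p) * ennreal (extend2 K (fst p) (snd p)) \<partial>(N \<Otimes>\<^sub>M N))"
      by (subst N.nn_integral_fst[symmetric]) auto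
    also have "\<dots> = (\<integral>\<^sup>+ p. ennreal (1 / 2) * (indicator A (fst p + snd p) * ennreal (extend2 K (fst p) (snd p))) \<partial>(N \<Otimes>\<^sub>M N))"
      by (rule nn_integral_cmult[symmetric]) measurable
    also have "\<dots> = (\<integral>\<^sup>+ p. ennreal (extend2 K (fst p) (snd p) / 2) * indicator A (fst p + snd p) \<partial>(N \<Otimes>\<^sub>M N))"
    proof (rule nn_integral_cong)
      fix p :: "real \<times> real"
      have "ennreal (extend2 K (fst p) (snd p) / 2) = ennreal (1 / 2) * ennreal (extend2 K (fst p) (snd p))"
        using extend2_nonneg[OF K] by (subst ennreal_mult[symmetric]) auto
      then show "ennreal (1 / 2) * (indicator A (fst p + snd p) * ennreal (extend2 K (fst p) (snd p)))
          = ennreal (extend2 K (fst p) (snd p) / 2) * indicator A (fst p + snd p)"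
        by (simp only: mult_ac)
    qed
    also have "\<dots> = (\<integral>\<^sup>+ p. indicator A (fst p + snd p) \<partial>?D)"
      by (rule nn_integral_density[symmetric]) measurable
    also have "\<dots> = (\<integral>\<^sup>+ u. indicator A u \<partial>distr ?D borel (\<lambda>p. fst p + snd p))"
      by (rule nn_integral_distr[symmetric]) measurable
    finally show "emeasure (on_reals (coag_gain K M)) A = emeasure (distr ?D borel (\<lambda>p. fst p + snd p)) A"
      by simp
  qed simp
  then have "(\<integral>\<^sup>+ u. h u \<partial>coag_gain K M) = (\<integral>\<^sup>+ u. h u \<partial>distr ?D borel (\<lambda>p. fst p + snd p))"
    by (simp add: nn_integral_on_reals[OF sets_coag_gain h])
  also have "\<dots> = (\<integral>\<^sup>+ p. h (fst p + snd p) \<partial>?D)"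
    by (rule nn_integral_distr) measurable
  also have "\<dots> = (\<integral>\<^sup>+ p. ennreal (extend2 K (fst p) (snd p) / 2) * h (fst p + snd p) \<partial>(N \<Otimes>\<^sub>M N))"
    by (rule nn_integral_density) measurable
  also have "\<dots> = (\<integral>\<^sup>+ y. (\<integral>\<^sup>+ y'. h (y + y') * ennreal (extend2 K y y' / 2) \<partial>N) \<partial>N)"
    by (subst N.nn_integral_fst[symmetric]) (auto simp: mult.commute)
  finally show ?gain unfolding N_def .
qed


section \<open>Pairs of masses and the Duhamel terms\<close>

lemma moment_kernel_second:
  assumes "moment_kernel X \<nu>"
  shows "moment_kernel (semiprod X \<nu>) (\<lambda>q. \<nu> (fst q))"
  by (rule moment_kernel_compose[OF assms]) measurable

text \<open>The measure X(dz) \<nu>_z(dy) \<nu>_z(dy') on pairs of particles at the same point z.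
  Nesting \<open>semiprod\<close> lets the statements about one particle apply to pairs.\<close>

abbreviation semiprod2 :: "'a measure \<Rightarrow> ('a \<Rightarrow> real measure) \<Rightarrow> (('a \<times> real) \<times> real) measure"
  where "semiprod2 X \<nu> \<equiv> semiprod (semiprod X \<nu>) (\<lambda>q. \<nu> (fst q))"

lemma nn_integral_semiprod2:
  assumes \<nu>: "moment_kernel X \<nu>" and F: "F \<in> borel_measurable ((X \<Otimes>\<^sub>M borel) \<Otimes>\<^sub>M borel)"
  shows "(\<integral>\<^sup>+ p. F p \<partial>semiprod2 X \<nu>) = (\<integral>\<^sup>+ z. (\<integral>\<^sup>+ y. (\<integral>\<^sup>+ y'. F ((z, y), y') \<partial>\<nu> z) \<partial>\<nu> z) \<partial>X)"
proof -
  have \<nu>2: "moment_kernel (X \<Otimes>\<^sub>M borel) (\<lambda>q. \<nu> (fst q))"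
    by (rule moment_kernel_compose[OF \<nu>]) measurable
  have "(\<integral>\<^sup>+ p. F p \<partial>semiprod2 X \<nu>) = (\<integral>\<^sup>+ q. (\<integral>\<^sup>+ y'. F (q, y') \<partial>\<nu> (fst q)) \<partial>semiprod X \<nu>)"
    using F by (intro nn_integral_semiprod moment_kernel_second \<nu>) (simp cong: measurable_cong_sets sets_pair_measure_cong)
  also have "\<dots> = (\<integral>\<^sup>+ z. (\<integral>\<^sup>+ y. (\<integral>\<^sup>+ y'. F ((z, y), y') \<partial>\<nu> z) \<partial>\<nu> z) \<partial>X)"
    using nn_integral_semiprod[OF \<nu> moment_kernel_measurable_pair[OF \<nu>2 F]] by simp
  finally show ?thesis .
qed

lemma sigma_finite_semiprod2:
  assumes "sigma_finite_measure X" "moment_kernel X \<nu>"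
  shows "sigma_finite_measure (semiprod2 X \<nu>)"
  using assms by (intro sigma_finite_semiprod moment_kernel_second)

text \<open>A solution has finite moments only for almost every x, whereas a moment kernel must have
  them at every point; hence agreement almost everywhere. Outside [0,T] the kernel is null because
  \<open>spacetime\<close> contains the whole time line.\<close>

definition represents ::
    "real \<Rightarrow> (real \<Rightarrow> real ^ 'd \<Rightarrow> real measure) \<Rightarrow> (real \<times> (real ^ 'd) \<Rightarrow> real measure) \<Rightarrow> bool"
  where "represents T \<mu> \<nu> \<longleftrightarrow> moment_kernel spacetime \<nu> \<and>
    (\<forall>t\<in>{0..T}. \<forall>x. sets (\<mu> t x) = sets masses) \<and>
    (AE z in spacetime. \<nu> z = (if fst z \<in> {0..T} then on_reals (\<mu> (fst z) (snd z)) else null_measure borel))"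

lemma AE_spacetime_iterate:
  assumes "AE z in (spacetime :: (real \<times> (real ^ 'd)) measure). P z"
  shows "AE t in lborel. AE x in lborel. P (t, x)"
  using lborel_pair.AE_pair[OF assms] .

lemma extend1_heat_density: "0 < y \<Longrightarrow> heat_density (extend1 1 a) t x' x y = heat_density a t x' x y"
  by (simp add: heat_density_def extend1_def)

lemma extend1_pos: "(\<And>y. 0 < y \<Longrightarrow> 0 < a y) \<Longrightarrow> 0 < extend1 1 a y"
  by (simp add: extend1_def)

text \<open>Instances: the loss term (\<open>c y y' = y\<close>, \<open>k = K\<close>) and the gain term
  (\<open>c y y' = y + y'\<close>, \<open>k = K / 2\<close>).\<close>

lemma duhamel_eq:
  fixes \<kappa> :: "real \<Rightarrow> real ^ 'd \<Rightarrow> real measure"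
  assumes a [measurable]: "a \<in> borel_measurable masses"
    and \<nu>: "moment_kernel spacetime \<nu>" and t: "t \<le> T"
    and \<kappa>: "AE z in spacetime. fst z \<in> {0..T} \<longrightarrow> (\<forall>h\<in>borel_measurable borel.
      (\<integral>\<^sup>+ u. h u \<partial>\<kappa> (fst z) (snd z)) = (\<integral>\<^sup>+ y. (\<integral>\<^sup>+ y'. h (c y y') * ennreal (k y y') \<partial>\<nu> z) \<partial>\<nu> z))"
    and c [measurable]: "(\<lambda>p. c (fst p) (snd p)) \<in> borel_measurable (borel \<Otimes>\<^sub>M borel)"
    and k [measurable]: "(\<lambda>p. k (fst p) (snd p)) \<in> borel_measurable (borel \<Otimes>\<^sub>M borel)"
    and A: "A \<in> sets masses"
  shows "duhamel a t \<kappa> x A = (\<integral>\<^sup>+ p. indicator A (c (snd (fst p)) (snd p)) *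
      ennreal (resolvent_density (extend1 1 a) 0 (c (snd (fst p)) (snd p)) (fst (fst p)) (t, x)) *
      ennreal (k (snd (fst p)) (snd p)) \<partial>semiprod2 spacetime \<nu>)"
proof -
  have [measurable]: "A \<in> sets borel" and Apos: "A \<subseteq> {0<..}" using A by (auto simp: sets_masses)
  have c' [measurable (raw)]: "(\<lambda>m. c (f m) (g m)) \<in> borel_measurable M"
    if [measurable]: "f \<in> borel_measurable M" "g \<in> borel_measurable M" for f g and M :: "'m measure"
    using measurable_compose[OF measurable_Pair c, OF that] by simp
  have k' [measurable (raw)]: "(\<lambda>m. k (f m) (g m)) \<in> borel_measurable M"
    if [measurable]: "f \<in> borel_measurable M" "g \<in> borel_measurable M" for f g and M :: "'m measure"
    using measurable_compose[OF measurable_Pair k, OF that] by simp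
  let ?F = "\<lambda>p :: ((real \<times> (real ^ 'd)) \<times> real) \<times> real. indicator A (c (snd (fst p)) (snd p)) *
      ennreal (resolvent_density (extend1 1 a) 0 (c (snd (fst p)) (snd p)) (fst (fst p)) (t, x)) *
      ennreal (k (snd (fst p)) (snd p))"
  have F: "?F \<in> borel_measurable phase2"
    by measurable
  define G where "G z = (\<integral>\<^sup>+ y. (\<integral>\<^sup>+ y'. ?F ((z, y), y') \<partial>\<nu> z) \<partial>\<nu> z)" for z
  have \<nu>2: "moment_kernel phase (\<lambda>q. \<nu> (fst q))"
    by (rule moment_kernel_compose[OF \<nu>]) measurable
  have G [measurable]: "G \<in> borel_measurable spacetime"
    unfolding G_def[abs_def]
    using moment_kernel_measurable_pair[OF \<nu> moment_kernel_measurable_pair[OF \<nu>2 F]] by simp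
  \<comment> \<open>At s = t the flow is the identity by convention, while the resolvent density
    vanishes; this single time is a null set.\<close>
  have "AE s in lborel. heat_flow a (t - s) (\<kappa> s) x A * indicator {0..t} s = (\<integral>\<^sup>+ x'. G (s, x') \<partial>lborel)"
    using AE_spacetime_iterate[OF \<kappa>] AE_lborel_singleton[of t]
  proof eventually_elim
    fix s
    assume \<kappa>s: "AE x' in lborel. fst (s, x') \<in> {0..T} \<longrightarrow> (\<forall>h\<in>borel_measurable borel.
      (\<integral>\<^sup>+ u. h u \<partial>\<kappa> (fst (s, x')) (snd (s, x'))) =
      (\<integral>\<^sup>+ y. (\<integral>\<^sup>+ y'. h (c y y') * ennreal (k y y') \<partial>\<nu> (s, x')) \<partial>\<nu> (s, x')))"
      and st: "s \<noteq> t"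
    show "heat_flow a (t - s) (\<kappa> s) x A * indicator {0..t} s = (\<integral>\<^sup>+ x'. G (s, x') \<partial>lborel)"
    proof (cases "0 \<le> s \<and> s < t")
      case True
      have "heat_flow a (t - s) (\<kappa> s) x A * indicator {0..t} s
          = (\<integral>\<^sup>+ x'. (\<integral>\<^sup>+ u. indicator A u * ennreal (heat_density a (t - s) x' x u) \<partial>\<kappa> s x') \<partial>lborel)"
        using True by (simp add: heat_flow_def)
      also have "\<dots> = (\<integral>\<^sup>+ x'. G (s, x') \<partial>lborel)"
      proof (rule nn_integral_cong_AE, use \<kappa>s in eventually_elim)
        fix x'
        assume *: "fst (s, x') \<in> {0..T} \<longrightarrow> (\<forall>h\<in>borel_measurable borel.
          (\<integral>\<^sup>+ u. h u \<partial>\<kappa> (fst (s, x')) (snd (s, x'))) =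
          (\<integral>\<^sup>+ y. (\<integral>\<^sup>+ y'. h (c y y') * ennreal (k y y') \<partial>\<nu> (s, x')) \<partial>\<nu> (s, x')))"
        let ?h = "\<lambda>u. indicator A u * ennreal (heat_density (extend1 1 a) (t - s) x' x u)"
        have "(\<integral>\<^sup>+ u. indicator A u * ennreal (heat_density a (t - s) x' x u) \<partial>\<kappa> s x') = (\<integral>\<^sup>+ u. ?h u \<partial>\<kappa> s x')"
          using Apos by (intro nn_integral_cong) (auto simp: indicator_def extend1_heat_density)
        also have "\<dots> = (\<integral>\<^sup>+ y. (\<integral>\<^sup>+ y'. ?h (c y y') * ennreal (k y y') \<partial>\<nu> (s, x')) \<partial>\<nu> (s, x'))"
          using * True t by auto
        also have "\<dots> = G (s, x')"
          unfolding G_def using True by (simp add: resolvent_density_def)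
        finally show "(\<integral>\<^sup>+ u. indicator A u * ennreal (heat_density a (t - s) x' x u) \<partial>\<kappa> s x') = G (s, x')" .
      qed
      finally show ?thesis .
    next
      case False
      then have "indicator {0..t} s = (0::ennreal)" using st by (auto simp: indicator_def)
      moreover have "G (s, x') = 0" for x'
        using False unfolding G_def by (auto simp: resolvent_density_def)
      ultimately show ?thesis by simp
    qed
  qed
  then have "duhamel a t \<kappa> x A = (\<integral>\<^sup>+ s. (\<integral>\<^sup>+ x'. G (s, x') \<partial>lborel) \<partial>lborel)"
    unfolding duhamel_def by (rule nn_integral_cong_AE)
  also have "\<dots> = (\<integral>\<^sup>+ z. G z \<partial>spacetime)"
    by (rule nn_integral_spacetime[symmetric]) (rule G)
  also have "\<dots> = (\<integral>\<^sup>+ p. ?F p \<partial>semiprod2 spacetime \<nu>)"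
    unfolding G_def by (rule nn_integral_semiprod2[OF \<nu> F, symmetric])
  finally show ?thesis .
qed

lemma represents_kernel: "represents T \<mu> \<nu> \<Longrightarrow> moment_kernel spacetime \<nu>"
  by (simp add: represents_def)

lemma represents_sigma_finite:
  "represents T \<mu> \<nu> \<Longrightarrow> sigma_finite_measure (\<nu> z)"
  using sigma_finite_moment_kernel[of spacetime \<nu> z] by (simp add: represents_def space_pair_measure)

lemma
  fixes \<mu> :: "real \<Rightarrow> real ^ 'd \<Rightarrow> real measure"
  assumes a: "a \<in> borel_measurable masses" and K: "coagulation_kernel K"
    and \<nu>: "represents T \<mu> \<nu>" and t: "t \<le> T" and A: "A \<in> sets masses"
  shows duhamel_loss: "duhamel a t (\<lambda>s x. coag_loss K (\<mu> s x)) x A =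
      (\<integral>\<^sup>+ p. indicator A (snd (fst p)) *
        ennreal (resolvent_density (extend1 1 a) 0 (snd (fst p)) (fst (fst p)) (t, x)) *
        ennreal (extend2 K (snd (fst p)) (snd p)) \<partial>semiprod2 spacetime \<nu>)" (is ?loss)
    and duhamel_gain: "duhamel a t (\<lambda>s x. coag_gain K (\<mu> s x)) x A =
      (\<integral>\<^sup>+ p. indicator A (snd (fst p) + snd p) *
        ennreal (resolvent_density (extend1 1 a) 0 (snd (fst p) + snd p) (fst (fst p)) (t, x)) *
        ennreal (extend2 K (snd (fst p)) (snd p) / 2) \<partial>semiprod2 spacetime \<nu>)" (is ?gain)
proof -
  note [measurable (raw)] = coagulation_kernel_extend2[OF K]
  have \<nu>A: "AE z in spacetime. \<nu> z = (if fst z \<in> {0..T} then on_reals (\<mu> (fst z) (snd z)) else null_measure borel)"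
    and M: "\<And>s x. s \<in> {0..T} \<Longrightarrow> sets (\<mu> s x) = sets masses"
    using \<nu> by (auto simp: represents_def)
  show ?loss
  proof (rule duhamel_eq[OF a represents_kernel[OF \<nu>] t _ _ _ A])
    show "AE z in spacetime. fst z \<in> {0..T} \<longrightarrow> (\<forall>h\<in>borel_measurable borel.
      (\<integral>\<^sup>+ u. h u \<partial>coag_loss K (\<mu> (fst z) (snd z))) =
      (\<integral>\<^sup>+ y. (\<integral>\<^sup>+ y'. h y * ennreal (extend2 K y y') \<partial>\<nu> z) \<partial>\<nu> z))"
      using \<nu>A
    proof eventually_elim
      case (elim z)
      then show ?case
        using nn_integral_coag_loss[of "\<mu> (fst z) (snd z)" K] represents_sigma_finite[OF \<nu>, of z] M[of "fst z" "snd z"] K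
        by auto
    qed
  qed measurable
  show ?gain
  proof (rule duhamel_eq[OF a represents_kernel[OF \<nu>] t _ _ _ A])
    show "AE z in spacetime. fst z \<in> {0..T} \<longrightarrow> (\<forall>h\<in>borel_measurable borel.
      (\<integral>\<^sup>+ u. h u \<partial>coag_gain K (\<mu> (fst z) (snd z))) =
      (\<integral>\<^sup>+ y. (\<integral>\<^sup>+ y'. h (y + y') * ennreal (extend2 K y y' / 2) \<partial>\<nu> z) \<partial>\<nu> z))"
      using \<nu>A
    proof eventually_elim
      case (elim z)
      then show ?case
        using nn_integral_coag_gain[of "\<mu> (fst z) (snd z)" K] represents_sigma_finite[OF \<nu>, of z] M[of "fst z" "snd z"] K
        by auto
    qed
  qed measurable
qed

section \<open>Sums of measures\<close>

definition sum_measure :: "'a measure \<Rightarrow> 'a measure \<Rightarrow> 'a measure"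
  where "sum_measure M N = measure_of (space M) (sets M) (\<lambda>A. emeasure M A + emeasure N A)"

lemma sets_sum_measure [simp, measurable_cong]: "sets (sum_measure M N) = sets M"
  by (simp add: sum_measure_def sets.sigma_sets_eq)

lemma emeasure_sum_measure:
  assumes N: "sets N = sets M" and A: "A \<in> sets M"
  shows "emeasure (sum_measure M N) A = emeasure M A + emeasure N A"
proof -
  have "countably_additive (sets M) (\<lambda>A. emeasure M A + emeasure N A)"
  proof (rule countably_additiveI)
    fix B :: "nat \<Rightarrow> 'a set"
    assume B: "range B \<subseteq> sets M" "disjoint_family B" "(\<Union>i. B i) \<in> sets M"
    have "(\<Sum>i. emeasure M (B i) + emeasure N (B i)) = (\<Sum>i. emeasure M (B i)) + (\<Sum>i. emeasure N (B i))"
      by (rule suminf_add[symmetric]) auto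
    also have "\<dots> = emeasure M (\<Union>i. B i) + emeasure N (\<Union>i. B i)"
      using B N by (simp add: suminf_emeasure)
    finally show "(\<Sum>i. emeasure M (B i) + emeasure N (B i)) = emeasure M (\<Union>i. B i) + emeasure N (\<Union>i. B i)" .
  qed
  then show ?thesis
    unfolding sum_measure_def using A
    by (intro emeasure_measure_of_sigma) (auto simp: sets.sigma_algebra_axioms positive_def)
qed

lemma nn_integral_sum_measure:
  assumes N: "sets N = sets M" and f: "f \<in> borel_measurable M"
  shows "(\<integral>\<^sup>+ x. f x \<partial>sum_measure M N) = (\<integral>\<^sup>+ x. f x \<partial>M) + (\<integral>\<^sup>+ x. f x \<partial>N)"
  using f
proof induct
  case (cong f g)
  have s: "space (sum_measure M N) = space M" "space N = space M"
    using sets_eq_imp_space_eq[OF sets_sum_measure[of M N]] sets_eq_imp_space_eq[OF N] by auto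
  have "(\<integral>\<^sup>+ x. f x \<partial>M) = (\<integral>\<^sup>+ x. g x \<partial>M)" "(\<integral>\<^sup>+ x. f x \<partial>N) = (\<integral>\<^sup>+ x. g x \<partial>N)"
      "(\<integral>\<^sup>+ x. f x \<partial>sum_measure M N) = (\<integral>\<^sup>+ x. g x \<partial>sum_measure M N)"
    using cong(3) s by (auto intro!: nn_integral_cong)
  with cong(4) show ?case by metis
next
  case (set A)
  then show ?case using N by (simp add: emeasure_sum_measure)
next
  case (mult u c)
  then show ?case using N by (simp add: nn_integral_cmult distrib_left cong: measurable_cong_sets)
next
  case (add u v)
  then show ?case using N by (simp add: nn_integral_add ac_simps cong: measurable_cong_sets)
next
  case (seq U)
  have "(\<integral>\<^sup>+ x. (SUP i. U i) x \<partial>S) = (SUP i. \<integral>\<^sup>+ x. U i x \<partial>S)" if "sets S = sets M" for S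
    unfolding SUP_apply using that seq
    by (intro nn_integral_monotone_convergence_SUP) (simp_all cong: measurable_cong_sets)
  then have "(\<integral>\<^sup>+ x. (SUP i. U i) x \<partial>sum_measure M N) = (SUP i. (\<integral>\<^sup>+ x. U i x \<partial>M) + (\<integral>\<^sup>+ x. U i x \<partial>N))"
      "(\<integral>\<^sup>+ x. (SUP i. U i) x \<partial>M) + (\<integral>\<^sup>+ x. (SUP i. U i) x \<partial>N) = (SUP i. \<integral>\<^sup>+ x. U i x \<partial>M) + (SUP i. \<integral>\<^sup>+ x. U i x \<partial>N)"
    using seq N by auto
  moreover have "(SUP i. (\<integral>\<^sup>+ x. U i x \<partial>M) + (\<integral>\<^sup>+ x. U i x \<partial>N)) = (SUP i. \<integral>\<^sup>+ x. U i x \<partial>M) + (SUP i. \<integral>\<^sup>+ x. U i x \<partial>N)"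
    using seq(4) by (intro ennreal_SUP_add) (auto simp: incseq_def le_fun_def intro!: nn_integral_mono)
  ultimately show ?case by simp
qed

text \<open>The terms may be infinite and cannot be moved across the equality sign. Each side is
  therefore made into one measure, and measures that agree on sets have the same integrals.\<close>

lemma nn_integral_eq_sums:
  assumes s: "sets M1 = sets N" "sets M2 = sets N" "sets M3 = sets N" "sets M4 = sets N"
    and eq: "\<And>A. A \<in> sets N \<Longrightarrow> emeasure M1 A + emeasure M2 A = emeasure M3 A + emeasure M4 A"
    and h: "h \<in> borel_measurable N"
  shows "(\<integral>\<^sup>+ x. h x \<partial>M1) + (\<integral>\<^sup>+ x. h x \<partial>M2) = (\<integral>\<^sup>+ x. h x \<partial>M3) + (\<integral>\<^sup>+ x. h x \<partial>M4)"
proof -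
  have "sum_measure M1 M2 = sum_measure M3 M4"
    using s eq by (intro measure_eqI) (auto simp: emeasure_sum_measure)
  moreover have "(\<integral>\<^sup>+ x. h x \<partial>sum_measure M1 M2) = (\<integral>\<^sup>+ x. h x \<partial>M1) + (\<integral>\<^sup>+ x. h x \<partial>M2)"
    using s h by (intro nn_integral_sum_measure) (simp_all cong: measurable_cong_sets)
  moreover have "(\<integral>\<^sup>+ x. h x \<partial>sum_measure M3 M4) = (\<integral>\<^sup>+ x. h x \<partial>M3) + (\<integral>\<^sup>+ x. h x \<partial>M4)"
    using s h by (intro nn_integral_sum_measure) (simp_all cong: measurable_cong_sets)
  ultimately show ?thesis by simp
qed

section \<open>The equation tested against functions\<close>

definition represents_initial :: "(real ^ 'd \<Rightarrow> real measure) \<Rightarrow> (real ^ 'd \<Rightarrow> real measure) \<Rightarrow> bool"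
  where "represents_initial \<mu>0 \<nu>0 \<longleftrightarrow> moment_kernel lborel \<nu>0 \<and> (\<forall>x. sets (\<mu>0 x) = sets masses) \<and>
    (AE x in lborel. \<nu>0 x = on_reals (\<mu>0 x))"

lemma heat_flow_initial:
  assumes a [measurable]: "a \<in> borel_measurable masses" and \<nu>0: "represents_initial \<mu>0 \<nu>0"
    and t: "0 < t" and A: "A \<in> sets masses"
  shows "heat_flow a t \<mu>0 x A = (\<integral>\<^sup>+ p. indicator A (snd p) *
    ennreal (heat_density (extend1 1 a) t (fst p) x (snd p)) \<partial>semiprod lborel \<nu>0)"
proof -
  have [measurable]: "A \<in> sets borel" and Apos: "A \<subseteq> {0<..}" using A by (auto simp: sets_masses)
  have \<nu>0k: "moment_kernel lborel \<nu>0" and M: "sets (\<mu>0 x) = sets masses"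
    and eq: "AE x in lborel. \<nu>0 x = on_reals (\<mu>0 x)" for x
    using \<nu>0 by (auto simp: represents_initial_def)
  have "heat_flow a t \<mu>0 x A = (\<integral>\<^sup>+ x'. (\<integral>\<^sup>+ y. indicator A y * ennreal (heat_density a t x' x y) \<partial>\<mu>0 x') \<partial>lborel)"
    using t by (simp add: heat_flow_def)
  also have "\<dots> = (\<integral>\<^sup>+ x'. (\<integral>\<^sup>+ y. indicator A y * ennreal (heat_density (extend1 1 a) t x' x y) \<partial>\<nu>0 x') \<partial>lborel)"
  proof (rule nn_integral_cong_AE, use eq in eventually_elim)
    fix x' assume x': "\<nu>0 x' = on_reals (\<mu>0 x')"
    have "(\<integral>\<^sup>+ y. indicator A y * ennreal (heat_density a t x' x y) \<partial>\<mu>0 x')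
        = (\<integral>\<^sup>+ y. indicator A y * ennreal (heat_density (extend1 1 a) t x' x y) \<partial>\<mu>0 x')"
      using Apos by (intro nn_integral_cong) (auto simp: indicator_def extend1_heat_density)
    also have "\<dots> = (\<integral>\<^sup>+ y. indicator A y * ennreal (heat_density (extend1 1 a) t x' x y) \<partial>\<nu>0 x')"
      unfolding x' by (rule nn_integral_on_reals[OF M]) measurable
    finally show "(\<integral>\<^sup>+ y. indicator A y * ennreal (heat_density a t x' x y) \<partial>\<mu>0 x')
        = (\<integral>\<^sup>+ y. indicator A y * ennreal (heat_density (extend1 1 a) t x' x y) \<partial>\<nu>0 x')" .
  qed
  also have "\<dots> = (\<integral>\<^sup>+ p. indicator A (snd p) *
    ennreal (heat_density (extend1 1 a) t (fst p) x (snd p)) \<partial>semiprod lborel \<nu>0)"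
    by (subst nn_integral_semiprod[OF \<nu>0k]) auto
  finally show ?thesis .
qed

lemma nn_integral_distr_density:
  assumes [measurable]: "T \<in> M \<rightarrow>\<^sub>M N" "f \<in> borel_measurable M" "h \<in> borel_measurable N"
  shows "(\<integral>\<^sup>+ x. h x \<partial>distr (density M f) N T) = (\<integral>\<^sup>+ x. h (T x) * f x \<partial>M)"
  by (simp add: nn_integral_distr nn_integral_density mult.commute)

lemma emeasure_distr_density:
  assumes [measurable]: "T \<in> M \<rightarrow>\<^sub>M N" "f \<in> borel_measurable M" "A \<in> sets N"
  shows "emeasure (distr (density M f) N T) A = (\<integral>\<^sup>+ x. indicator A (T x) * f x \<partial>M)"
  using nn_integral_distr_density[of T M N f "indicator A"] by simp

lemma AE_semiprod_pos:
  assumes \<nu>: "moment_kernel X \<nu>"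
  shows "AE q in semiprod X \<nu>. 0 < snd q"
  by (subst AE_semiprod[OF \<nu>]) (auto intro!: AE_I2 moment_kernelD(3)[OF \<nu>])

lemma AE_semiprod2_pos:
  assumes \<nu>: "moment_kernel X \<nu>"
  shows "AE p in semiprod2 X \<nu>. 0 < snd (fst p) \<and> 0 < snd p"
proof (subst AE_semiprod[OF moment_kernel_second[OF \<nu>]])
  show "AE q in semiprod X \<nu>. AE y in \<nu> (fst q). 0 < snd (fst (q, y)) \<and> 0 < snd (q, y)"
    using AE_semiprod_pos[OF \<nu>] AE_space
  proof eventually_elim
    case (elim q)
    then have "AE y in \<nu> (fst q). 0 < y" by (auto intro!: moment_kernelD(3)[OF \<nu>])
    then show ?case by (rule AE_mp) (use elim in \<open>auto intro!: AE_I2\<close>)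
  qed
qed measurable

text \<open>At a fixed (t,x) every term is a measure in the mass: the loss, gain and initial terms
  are the images \<open>L\<close>, \<open>G\<close> and \<open>I\<close> of weighted measures.
  Equality on sets, which is the equation, thus passes to functions h. Sets are cut to positive
  masses because the equation speaks of subsets of \<open>masses\<close>.\<close>

lemma pointwise_weak_formulation:
  fixes \<mu> :: "real \<Rightarrow> real ^ 'd \<Rightarrow> real measure"
  assumes a [measurable]: "a \<in> borel_measurable masses" and K: "coagulation_kernel K"
    and \<nu>: "represents T \<mu> \<nu>" and \<nu>0: "represents_initial \<mu>0 \<nu>0"
    and t: "0 < t" "t \<le> T" and eqn: "coag_diff_equation K a \<mu>0 \<mu> t"
    and h [measurable]: "h \<in> borel_measurable borel"
  shows "(\<integral>\<^sup>+ y. h y \<partial>on_reals (\<mu> t x)) +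
      (\<integral>\<^sup>+ p. h (snd (fst p)) *
        (ennreal (resolvent_density (extend1 1 a) 0 (snd (fst p)) (fst (fst p)) (t, x)) *
        ennreal (extend2 K (snd (fst p)) (snd p))) \<partial>semiprod2 spacetime \<nu>)
    = (\<integral>\<^sup>+ p. h (snd p) * ennreal (heat_density (extend1 1 a) t (fst p) x (snd p)) \<partial>semiprod lborel \<nu>0) +
      (\<integral>\<^sup>+ p. h (snd (fst p) + snd p) *
        (ennreal (resolvent_density (extend1 1 a) 0 (snd (fst p) + snd p) (fst (fst p)) (t, x)) *
        ennreal (extend2 K (snd (fst p)) (snd p) / 2)) \<partial>semiprod2 spacetime \<nu>)"
proof -
  note [measurable (raw)] = coagulation_kernel_extend2[OF K]
  have M: "sets (\<mu> t x) = sets masses" using \<nu> t by (simp add: represents_def)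
  have \<nu>0k: "moment_kernel lborel \<nu>0" using \<nu>0 by (simp add: represents_initial_def)
  have \<nu>k: "moment_kernel spacetime \<nu>" using \<nu> by (simp add: represents_def)
  define L where "L = distr (density (semiprod2 spacetime \<nu>)
      (\<lambda>p. ennreal (resolvent_density (extend1 1 a) 0 (snd (fst p)) (fst (fst p)) (t, x)) *
        ennreal (extend2 K (snd (fst p)) (snd p)))) borel (\<lambda>p. snd (fst p))"
  define G where "G = distr (density (semiprod2 spacetime \<nu>)
      (\<lambda>p. ennreal (resolvent_density (extend1 1 a) 0 (snd (fst p) + snd p) (fst (fst p)) (t, x)) *
        ennreal (extend2 K (snd (fst p)) (snd p) / 2))) borel (\<lambda>p. snd (fst p) + snd p)"
  define I where "I = distr (density (semiprod lborel \<nu>0)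
      (\<lambda>p. ennreal (heat_density (extend1 1 a) t (fst p) x (snd p)))) borel snd"
  have "(\<integral>\<^sup>+ y. h y \<partial>on_reals (\<mu> t x)) + (\<integral>\<^sup>+ y. h y \<partial>L) = (\<integral>\<^sup>+ y. h y \<partial>I) + (\<integral>\<^sup>+ y. h y \<partial>G)"
  proof (rule nn_integral_eq_sums)
    fix A :: "real set" assume A [measurable]: "A \<in> sets borel"
    have A': "A \<inter> {0<..} \<in> sets masses" using A by (simp add: sets_masses)
    note pos2 = AE_semiprod2_pos[OF \<nu>k]
    note pos1 = AE_semiprod_pos[OF \<nu>0k]
    have "emeasure L A = duhamel a t (\<lambda>s x. coag_loss K (\<mu> s x)) x (A \<inter> {0<..})"
    proof -
      have "emeasure L A = (\<integral>\<^sup>+ p. indicator A (snd (fst p)) *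
        (ennreal (resolvent_density (extend1 1 a) 0 (snd (fst p)) (fst (fst p)) (t, x)) *
        ennreal (extend2 K (snd (fst p)) (snd p))) \<partial>semiprod2 spacetime \<nu>)"
        unfolding L_def by (rule emeasure_distr_density) measurable
      also have "\<dots> = (\<integral>\<^sup>+ p. indicator (A \<inter> {0<..}) (snd (fst p)) *
        ennreal (resolvent_density (extend1 1 a) 0 (snd (fst p)) (fst (fst p)) (t, x)) *
        ennreal (extend2 K (snd (fst p)) (snd p)) \<partial>semiprod2 spacetime \<nu>)"
        by (rule nn_integral_cong_AE, use pos2 in eventually_elim) (auto simp: indicator_def mult_ac)
      finally show ?thesis unfolding duhamel_loss[OF a K \<nu> t(2) A'] .
    qed
    moreover have "emeasure G A = duhamel a t (\<lambda>s x. coag_gain K (\<mu> s x)) x (A \<inter> {0<..})"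
    proof -
      have "emeasure G A = (\<integral>\<^sup>+ p. indicator A (snd (fst p) + snd p) *
        (ennreal (resolvent_density (extend1 1 a) 0 (snd (fst p) + snd p) (fst (fst p)) (t, x)) *
        ennreal (extend2 K (snd (fst p)) (snd p) / 2)) \<partial>semiprod2 spacetime \<nu>)"
        unfolding G_def by (rule emeasure_distr_density) measurable
      also have "\<dots> = (\<integral>\<^sup>+ p. indicator (A \<inter> {0<..}) (snd (fst p) + snd p) *
        ennreal (resolvent_density (extend1 1 a) 0 (snd (fst p) + snd p) (fst (fst p)) (t, x)) *
        ennreal (extend2 K (snd (fst p)) (snd p) / 2) \<partial>semiprod2 spacetime \<nu>)"
        by (rule nn_integral_cong_AE, use pos2 in eventually_elim) (auto simp: indicator_def mult_ac)
      finally show ?thesis unfolding duhamel_gain[OF a K \<nu> t(2) A'] .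
    qed
    moreover have "emeasure I A = heat_flow a t \<mu>0 x (A \<inter> {0<..})"
    proof -
      have "emeasure I A = (\<integral>\<^sup>+ p. indicator A (snd p) * ennreal (heat_density (extend1 1 a) t (fst p) x (snd p)) \<partial>semiprod lborel \<nu>0)"
        unfolding I_def by (rule emeasure_distr_density) measurable
      also have "\<dots> = (\<integral>\<^sup>+ p. indicator (A \<inter> {0<..}) (snd p) * ennreal (heat_density (extend1 1 a) t (fst p) x (snd p)) \<partial>semiprod lborel \<nu>0)"
        by (rule nn_integral_cong_AE, use pos1 in eventually_elim) (auto simp: indicator_def mult_ac)
      finally show ?thesis unfolding heat_flow_initial[OF a \<nu>0 t(1) A'] .
    qed
    moreover have "emeasure (on_reals (\<mu> t x)) A = emeasure (\<mu> t x) (A \<inter> {0<..})"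
      by (rule emeasure_on_reals[OF M A])
    ultimately show "emeasure (on_reals (\<mu> t x)) A + emeasure L A = emeasure I A + emeasure G A"
      using eqn A' by (auto simp: coag_diff_equation_def)
  qed (auto simp: L_def I_def G_def)
  also have "(\<integral>\<^sup>+ y. h y \<partial>L) = (\<integral>\<^sup>+ p. h (snd (fst p)) *
        (ennreal (resolvent_density (extend1 1 a) 0 (snd (fst p)) (fst (fst p)) (t, x)) *
        ennreal (extend2 K (snd (fst p)) (snd p))) \<partial>semiprod2 spacetime \<nu>)"
    unfolding L_def by (rule nn_integral_distr_density) measurable
  also have "(\<integral>\<^sup>+ y. h y \<partial>G) = (\<integral>\<^sup>+ p. h (snd (fst p) + snd p) *
        (ennreal (resolvent_density (extend1 1 a) 0 (snd (fst p) + snd p) (fst (fst p)) (t, x)) *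
        ennreal (extend2 K (snd (fst p)) (snd p) / 2)) \<partial>semiprod2 spacetime \<nu>)"
    unfolding G_def by (rule nn_integral_distr_density) measurable
  also have "(\<integral>\<^sup>+ y. h y \<partial>I) = (\<integral>\<^sup>+ p. h (snd p) * ennreal (heat_density (extend1 1 a) t (fst p) x (snd p)) \<partial>semiprod lborel \<nu>0)"
    unfolding I_def by (rule nn_integral_distr_density) measurable
  finally show ?thesis .
qed

text \<open>For \<Phi> supported in [0,T] this is the integral of \<Phi> against P_t \<mu>0 over
  time, space and mass.\<close>

definition initial_term ::
    "(real \<Rightarrow> real) \<Rightarrow> (real ^ 'd \<Rightarrow> real measure) \<Rightarrow> ((real \<times> (real ^ 'd)) \<times> real \<Rightarrow> ennreal) \<Rightarrow> ennreal"
  where "initial_term a \<nu>0 \<Phi> = (\<integral>\<^sup>+ z. (\<integral>\<^sup>+ p. \<Phi> (z, snd p) *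
    ennreal (heat_density a (fst z) (fst p) (snd z) (snd p)) \<partial>semiprod lborel \<nu>0) \<partial>spacetime)"

text \<open>The parameter c is the mass at which the heat kernel acts: y for the loss and y + y' for
  the gain. Exchanging the integrals moves the kernel from the solution onto \<Phi>.\<close>

lemma resolvent_Fubini:
  fixes \<Phi> :: "(real \<times> (real ^ 'd)) \<times> real \<Rightarrow> ennreal"
  assumes \<nu>: "moment_kernel spacetime \<nu>" and [measurable]: "a \<in> borel_measurable borel"
    "\<Phi> \<in> borel_measurable phase"
    "c \<in> borel_measurable phase2"
    "k \<in> borel_measurable phase2"
  shows "(\<integral>\<^sup>+ z'. (\<integral>\<^sup>+ p. \<Phi> (z', c p) * (ennreal (resolvent_density a 0 (c p) (fst (fst p)) z') * k p)
      \<partial>semiprod2 spacetime \<nu>) \<partial>spacetime)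
    = (\<integral>\<^sup>+ p. resolvent a 0 \<Phi> (fst (fst p), c p) * k p \<partial>semiprod2 spacetime \<nu>)"
proof -
  interpret S: sigma_finite_measure "spacetime :: (real \<times> (real ^ 'd)) measure"
    by (rule sigma_finite_spacetime)
  interpret S2: sigma_finite_measure "semiprod2 spacetime \<nu>"
    using \<nu> by (intro sigma_finite_semiprod2 sigma_finite_spacetime)
  interpret P: pair_sigma_finite "semiprod2 spacetime \<nu>" "spacetime :: (real \<times> (real ^ 'd)) measure" ..
  have "(\<integral>\<^sup>+ z'. (\<integral>\<^sup>+ p. \<Phi> (z', c p) * (ennreal (resolvent_density a 0 (c p) (fst (fst p)) z') * k p)
      \<partial>semiprod2 spacetime \<nu>) \<partial>spacetime)
    = (\<integral>\<^sup>+ p. (\<integral>\<^sup>+ z'. \<Phi> (z', c p) * (ennreal (resolvent_density a 0 (c p) (fst (fst p)) z') * k p)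
      \<partial>spacetime) \<partial>semiprod2 spacetime \<nu>)"
    by (rule P.Fubini') measurable
  also have "\<dots> = (\<integral>\<^sup>+ p. resolvent a 0 \<Phi> (fst (fst p), c p) * k p \<partial>semiprod2 spacetime \<nu>)"
  proof (rule nn_integral_cong)
    fix p :: "((real \<times> (real ^ 'd)) \<times> real) \<times> real"
    have [simp]: "u \<in> space (borel \<Otimes>\<^sub>M borel)" for u :: "real \<times> (real ^ 'd)"
      by (simp add: space_pair_measure)
    have "(\<integral>\<^sup>+ z'. \<Phi> (z', c p) * (ennreal (resolvent_density a 0 (c p) (fst (fst p)) z') * k p) \<partial>spacetime)
      = (\<integral>\<^sup>+ z'. (ennreal (resolvent_density a 0 (c p) (fst (fst p)) z') * \<Phi> (z', c p)) * k p \<partial>spacetime)"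
      by (simp add: mult_ac)
    also have "\<dots> = (\<integral>\<^sup>+ z'. ennreal (resolvent_density a 0 (c p) (fst (fst p)) z') * \<Phi> (z', c p) \<partial>spacetime) * k p"
      by (rule nn_integral_multc) measurable
    finally show "(\<integral>\<^sup>+ z'. \<Phi> (z', c p) * (ennreal (resolvent_density a 0 (c p) (fst (fst p)) z') * k p) \<partial>spacetime)
      = resolvent a 0 \<Phi> (fst (fst p), c p) * k p"
      by (simp add: resolvent_def)
  qed
  finally show ?thesis .
qed

text \<open>The pointwise identity with h = \<Phi>(t,x,.) is integrated over space-time. All terms
  are nonnegative, so no integrability is required; in return both sides may be infinite until the
  loss is shown to be finite.\<close>

lemma weak_formulation:
  fixes \<mu> :: "real \<Rightarrow> real ^ 'd \<Rightarrow> real measure" and \<Phi> :: "(real \<times> (real ^ 'd)) \<times> real \<Rightarrow> ennreal"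
  assumes a [measurable]: "a \<in> borel_measurable masses" and K: "coagulation_kernel K"
    and \<nu>: "represents T \<mu> \<nu>" and \<nu>0: "represents_initial \<mu>0 \<nu>0"
    and eqn: "\<And>t. t \<in> {0..T} \<Longrightarrow> coag_diff_equation K a \<mu>0 \<mu> t"
    and \<Phi> [measurable]: "\<Phi> \<in> borel_measurable phase"
    and supp: "\<And>t x y. t \<notin> {0..T} \<Longrightarrow> \<Phi> ((t, x), y) = 0"
  shows "(\<integral>\<^sup>+ q. \<Phi> q \<partial>semiprod spacetime \<nu>) +
      (\<integral>\<^sup>+ p. resolvent (extend1 1 a) 0 \<Phi> (fst p) * ennreal (extend2 K (snd (fst p)) (snd p)) \<partial>semiprod2 spacetime \<nu>)
    = initial_term (extend1 1 a) \<nu>0 \<Phi> +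
      (\<integral>\<^sup>+ p. resolvent (extend1 1 a) 0 \<Phi> (fst (fst p), snd (fst p) + snd p) *
        ennreal (extend2 K (snd (fst p)) (snd p) / 2) \<partial>semiprod2 spacetime \<nu>)"
proof -
  note [measurable (raw)] = coagulation_kernel_extend2[OF K]
  have \<nu>k: "moment_kernel spacetime \<nu>" using \<nu> by (simp add: represents_def)
  have \<nu>0k: "moment_kernel lborel \<nu>0" using \<nu>0 by (simp add: represents_initial_def)
  have [simp]: "u \<in> space (borel \<Otimes>\<^sub>M borel)" for u :: "real \<times> (real ^ 'd)"
    by (simp add: space_pair_measure)
  interpret S2: sigma_finite_measure "semiprod2 spacetime \<nu>"
    using \<nu>k by (intro sigma_finite_semiprod2 sigma_finite_spacetime)
  interpret S0: sigma_finite_measure "semiprod lborel \<nu>0"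
    using \<nu>0k by (intro sigma_finite_semiprod lborel.sigma_finite_measure_axioms)
  let ?M = "\<lambda>z. \<integral>\<^sup>+ y. \<Phi> (z, y) \<partial>\<nu> z"
  let ?L = "\<lambda>z. \<integral>\<^sup>+ p. \<Phi> (z, snd (fst p)) *
        (ennreal (resolvent_density (extend1 1 a) 0 (snd (fst p)) (fst (fst p)) z) *
        ennreal (extend2 K (snd (fst p)) (snd p))) \<partial>semiprod2 spacetime \<nu>"
  let ?G = "\<lambda>z. \<integral>\<^sup>+ p. \<Phi> (z, snd (fst p) + snd p) *
        (ennreal (resolvent_density (extend1 1 a) 0 (snd (fst p) + snd p) (fst (fst p)) z) *
        ennreal (extend2 K (snd (fst p)) (snd p) / 2)) \<partial>semiprod2 spacetime \<nu>"
  let ?I = "\<lambda>z. \<integral>\<^sup>+ p. \<Phi> (z, snd p) *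
      ennreal (heat_density (extend1 1 a) (fst z) (fst p) (snd z) (snd p)) \<partial>semiprod lborel \<nu>0"
  have \<nu>A: "AE z in spacetime. \<nu> z = (if fst z \<in> {0..T} then on_reals (\<mu> (fst z) (snd z)) else null_measure borel)"
    using \<nu> by (simp add: represents_def)
  \<comment> \<open>The pointwise identity needs t > 0, where \<open>heat_flow\<close> is a Gaussian
    integral; t = 0 is a null set of times.\<close>
  have t0: "AE z in (spacetime :: (real \<times> (real ^ 'd)) measure). fst z \<noteq> 0"
  proof (rule lborel_pair.AE_pair_measure)
    show "{z \<in> space (spacetime :: (real \<times> (real ^ 'd)) measure). fst z \<noteq> 0} \<in> sets spacetime"
      by measurable
  qed (use AE_lborel_singleton[of "0::real"] in auto)
  have M [measurable]: "?M \<in> borel_measurable spacetime"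
    by (rule moment_kernel_measurable_pair[OF \<nu>k \<Phi>])
  have "(\<integral>\<^sup>+ z. ?M z + ?L z \<partial>spacetime) = (\<integral>\<^sup>+ z. ?I z + ?G z \<partial>spacetime)"
    using \<nu>A t0
  proof (intro nn_integral_cong_AE, eventually_elim)
    fix z :: "real \<times> (real ^ 'd)"
    assume z: "\<nu> z = (if fst z \<in> {0..T} then on_reals (\<mu> (fst z) (snd z)) else null_measure borel)" "fst z \<noteq> 0"
    have \<Phi>z: "(\<lambda>y. \<Phi> (z, y)) \<in> borel_measurable borel"
      using measurable_Pair2[OF \<Phi>, of z] by (simp add: space_pair_measure)
    show "?M z + ?L z = ?I z + ?G z"
    proof (cases "fst z \<in> {0..T}")
      case True
      then show ?thesis
        using pointwise_weak_formulation[OF a K \<nu> \<nu>0 _ _ eqn[OF True] \<Phi>z, of "snd z"] z by auto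
    next
      case False
      then have "\<Phi> (z, y) = 0" for y using supp[of "fst z" "snd z" y] by simp
      then show ?thesis by simp
    qed
  qed
  moreover have "(\<integral>\<^sup>+ z. ?M z + ?L z \<partial>spacetime) = (\<integral>\<^sup>+ z. ?M z \<partial>spacetime) + (\<integral>\<^sup>+ z. ?L z \<partial>spacetime)"
    by (rule nn_integral_add) measurable
  moreover have "(\<integral>\<^sup>+ z. ?I z + ?G z \<partial>spacetime) = (\<integral>\<^sup>+ z. ?I z \<partial>spacetime) + (\<integral>\<^sup>+ z. ?G z \<partial>spacetime)"
    by (rule nn_integral_add) measurable
  moreover have "(\<integral>\<^sup>+ z. ?M z \<partial>spacetime) = (\<integral>\<^sup>+ q. \<Phi> q \<partial>semiprod spacetime \<nu>)"
    by (rule nn_integral_semiprod[OF \<nu>k \<Phi>, symmetric])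
  moreover have "(\<integral>\<^sup>+ z. ?L z \<partial>spacetime) =
      (\<integral>\<^sup>+ p. resolvent (extend1 1 a) 0 \<Phi> (fst (fst p), snd (fst p)) * ennreal (extend2 K (snd (fst p)) (snd p)) \<partial>semiprod2 spacetime \<nu>)"
    by (rule resolvent_Fubini[OF \<nu>k]) measurable
  moreover have "(\<integral>\<^sup>+ z. ?G z \<partial>spacetime) =
      (\<integral>\<^sup>+ p. resolvent (extend1 1 a) 0 \<Phi> (fst (fst p), snd (fst p) + snd p) *
        ennreal (extend2 K (snd (fst p)) (snd p) / 2) \<partial>semiprod2 spacetime \<nu>)"
    by (rule resolvent_Fubini[OF \<nu>k]) measurable
  ultimately show ?thesis
    by (simp add: initial_term_def)
qed

section \<open>Absence of small masses\<close>

locale coagulation_bound =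
  fixes K :: "real \<Rightarrow> real \<Rightarrow> real" and w a :: "real \<Rightarrow> real"
  assumes K: "coagulation_kernel K"
    and w_pos: "0 < y \<Longrightarrow> 0 < w y"
    and w_mono: "mono_on {0<..} w"
    and w_sublinear: "sublinear w"
    and K_le: "0 < y \<Longrightarrow> 0 < z \<Longrightarrow> K y z \<le> w y * w z"
    and a_pos: "0 < y \<Longrightarrow> 0 < a y"
    and a_measurable [measurable]: "a \<in> borel_measurable masses"
begin

text \<open>The constants differ on purpose: with \<open>k\<close> and \<open>W\<close> extended by
  0 the bound \<open>k_le\<close> holds for all real arguments, and with \<open>b\<close> extended
  by 1 the heat kernel has mass one at every real mass.\<close>

abbreviation "k \<equiv> extend2 K"
abbreviation "W \<equiv> extend1 0 w"
abbreviation "b \<equiv> extend1 1 a"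
abbreviation "kp p \<equiv> k (snd (fst p)) (snd p)"

lemmas k_measurable [measurable (raw)] = coagulation_kernel_extend2[OF K]
lemmas k_nonneg [simp] = extend2_nonneg[OF K]
lemmas b_pos [simp] = extend1_pos[of a, OF a_pos]

lemma w_measurable: "w \<in> borel_measurable masses"
  unfolding masses_def by (rule borel_measurable_mono_on_fnc[OF w_mono])

lemma W_measurable [measurable]: "W \<in> borel_measurable borel"
  by (rule extend1_measurable[OF w_measurable])

lemma W_nonneg [simp]: "0 \<le> W y"
  using w_pos[of y] by (auto simp: extend1_def intro: less_imp_le)

lemma W_eq: "0 < y \<Longrightarrow> W y = w y"
  by (simp add: extend1_def)

lemma k_le: "k y z \<le> W y * W z"
  using K_le by (auto simp: extend2_def extend1_def)

text \<open>By sublinearity, y w(y+z) \<le> (y+z) w(y) and z w(y+z) \<le> (y+z) w(z); adding the two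
  and dividing by y + z gives subadditivity.\<close>

lemma W_add_le: "0 < y \<Longrightarrow> 0 < z \<Longrightarrow> W (y + z) \<le> W y + W z"
proof -
  assume y: "0 < y" and z: "0 < z"
  have "w (y + z) \<le> (y + z) / y * w y"
    using w_sublinear[unfolded sublinear_def, rule_format, OF y, of "(y + z) / y"] y z by simp
  moreover have "w (y + z) \<le> (y + z) / z * w z"
    using w_sublinear[unfolded sublinear_def, rule_format, OF z, of "(y + z) / z"] y z by simp
  ultimately have "y * w (y + z) \<le> (y + z) * w y" "z * w (y + z) \<le> (y + z) * w z"
    using y z by (simp_all add: field_simps)
  then have "(y + z) * w (y + z) \<le> (y + z) * (w y + w z)"
    by (simp add: algebra_simps)
  then show ?thesis using y z by (simp add: W_eq)
qed

end

section \<open>Exchange of masses and the logarithmic cutoff\<close>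

lemma nn_integral_semiprod2_swap:
  assumes \<nu>: "moment_kernel X \<nu>" and [measurable]: "F \<in> borel_measurable ((X \<Otimes>\<^sub>M borel) \<Otimes>\<^sub>M borel)"
  shows "(\<integral>\<^sup>+ p. F ((fst (fst p), snd p), snd (fst p)) \<partial>semiprod2 X \<nu>) = (\<integral>\<^sup>+ p. F p \<partial>semiprod2 X \<nu>)"
proof -
  have "(\<integral>\<^sup>+ p. F ((fst (fst p), snd p), snd (fst p)) \<partial>semiprod2 X \<nu>)
      = (\<integral>\<^sup>+ z. (\<integral>\<^sup>+ y. (\<integral>\<^sup>+ y'. F ((z, y'), y) \<partial>\<nu> z) \<partial>\<nu> z) \<partial>X)"
    by (subst nn_integral_semiprod2[OF \<nu>]) auto
  also have "\<dots> = (\<integral>\<^sup>+ z. (\<integral>\<^sup>+ y'. (\<integral>\<^sup>+ y. F ((z, y'), y) \<partial>\<nu> z) \<partial>\<nu> z) \<partial>X)"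
  proof (rule nn_integral_cong)
    fix z assume z: "z \<in> space X"
    interpret N: sigma_finite_measure "\<nu> z" by (rule sigma_finite_moment_kernel[OF \<nu> z])
    interpret NN: pair_sigma_finite "\<nu> z" "\<nu> z" ..
    note [measurable_cong] = moment_kernelD(1)[OF \<nu> z]
    show "(\<integral>\<^sup>+ y. (\<integral>\<^sup>+ y'. F ((z, y'), y) \<partial>\<nu> z) \<partial>\<nu> z) = (\<integral>\<^sup>+ y'. (\<integral>\<^sup>+ y. F ((z, y'), y) \<partial>\<nu> z) \<partial>\<nu> z)"
      by (rule NN.Fubini') (use z in measurable)
  qed
  also have "\<dots> = (\<integral>\<^sup>+ p. F p \<partial>semiprod2 X \<nu>)"
    by (subst nn_integral_semiprod2[OF \<nu>]) auto
  finally show ?thesis .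
qed

text \<open>Because 1 + r \<le> (1 + sqrt r)^2 and ln (1 + s) \<le> s.\<close>

lemma ln_add_one_le_sqrt: "0 \<le> r \<Longrightarrow> ln (1 + r) \<le> 2 * sqrt r" for r :: real
proof -
  assume r: "0 \<le> r"
  have "ln (1 + r) \<le> ln ((1 + sqrt r) ^ 2)"
    using r by (subst ln_le_cancel_iff) (auto simp: power2_eq_square algebra_simps add_pos_nonneg)
  also have "\<dots> = 2 * ln (1 + sqrt r)"
    using r by (subst ln_realpow) (auto simp: add_pos_nonneg)
  also have "\<dots> \<le> 2 * sqrt r"
    using r by (simp add: ln_add_one_self_le_self)
  finally show ?thesis .
qed

text \<open>The weight y is additive under merging, so any excess comes from the cutoff, whose slope
  in ln y is at most 1/(n+1). The cutoff vanishes below exp (- (n+1)), where the loss need not be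
  finite, and the whole function vanishes from \<delta> on, where the initial mass sits.
  \<open>Suc\<close> keeps the denominator positive.\<close>

definition log_cutoff :: "real \<Rightarrow> nat \<Rightarrow> real \<Rightarrow> real"
  where "log_cutoff \<delta> n y =
    (if 0 < y \<and> y < \<delta> then y * max 0 (min 1 (1 + ln y / real (Suc n))) else 0)"

lemma log_cutoff_measurable [measurable]: "log_cutoff \<delta> n \<in> borel_measurable borel"
  unfolding log_cutoff_def[abs_def] by measurable

lemma log_cutoff_nonneg [simp]: "0 \<le> log_cutoff \<delta> n y"
  by (simp add: log_cutoff_def)

text \<open>Confines the support to a compact set of positive masses, the sets for which
  \<open>loss_term_integrable\<close> provides finiteness.\<close>

lemma log_cutoff_support:
  assumes "0 < \<delta>"
  shows "log_cutoff \<delta> n y \<le> \<delta> * indicator {exp (- real (Suc n))..\<delta>} y"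
proof (cases "0 < y \<and> y < \<delta> \<and> exp (- real (Suc n)) < y")
  case True
  then have "log_cutoff \<delta> n y \<le> y * 1"
    unfolding log_cutoff_def by (auto intro!: mult_left_mono)
  then show ?thesis using True by simp
next
  case False
  have "log_cutoff \<delta> n y = 0"
  proof (cases "0 < y \<and> y < \<delta>")
    case y: True
    then have "y \<le> exp (- real (Suc n))" using False by simp
    then have "ln y \<le> - real (Suc n)"
      using y by (metis ln_exp ln_le_cancel_iff exp_gt_zero)
    then have "1 + ln y / real (Suc n) \<le> 0"
      by (simp add: field_simps del: of_nat_Suc)
    then show ?thesis by (simp add: log_cutoff_def)
  qed (auto simp: log_cutoff_def)
  then show ?thesis using assms by simp
qed

lemma log_cutoff_mono: "m \<le> n \<Longrightarrow> log_cutoff \<delta> m y \<le> log_cutoff \<delta> n y"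
proof (cases "0 < y \<and> y < \<delta>")
  case True
  assume mn: "m \<le> n"
  have "max 0 (min 1 (1 + ln y / real (Suc m))) \<le> max 0 (min 1 (1 + ln y / real (Suc n)))"
  proof (cases "ln y \<le> 0")
    case True
    have "ln y / real (Suc m) \<le> ln y / real (Suc n)"
      using True mn by (intro divide_left_mono_neg) auto
    then show ?thesis by linarith
  next
    case False
    then have "min 1 (1 + ln y / real (Suc n)) = 1" by (intro min_absorb1) (simp add: divide_nonneg_pos)
    then show ?thesis by simp
  qed
  then show ?thesis using True unfolding log_cutoff_def by (auto intro!: mult_left_mono)
qed (auto simp: log_cutoff_def)

lemma log_cutoff_pos:
  assumes "0 < y" "y < \<delta>"
  shows "\<exists>n. 0 < log_cutoff \<delta> n y"
proof -
  obtain n :: nat where "- ln y < real n" using reals_Archimedean2 by blast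
  then have "0 < 1 + ln y / real (Suc n)"
    by (simp add: field_simps)
  then have "0 < log_cutoff \<delta> n y" using assms by (simp add: log_cutoff_def)
  then show ?thesis ..
qed

text \<open>The logarithm makes the excess over additivity integrable without any lower mass cutoff:
  \<open>y * ln (1 + y' / y) \<le> 2 * sqrt (y * y')\<close>.\<close>

lemma log_cutoff_add:
  assumes y: "0 < y" and y': "0 < y'"
  shows "log_cutoff \<delta> n (y + y') \<le> log_cutoff \<delta> n y + log_cutoff \<delta> n y' + 4 / real (Suc n) * sqrt (y * y')"
proof (cases "y + y' < \<delta>")
  case True
  define c where "c u = max 0 (min 1 (1 + ln u / real (Suc n)))" for u
  \<comment> \<open>Each part u of the merged mass u + v sees the cutoff rise by at most ln (1 + v /
    u) / (n+1); clamping to [0,1] can only reduce the rise.\<close>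
  have part: "u * c (u + v) \<le> u * c u + 2 / real (Suc n) * sqrt (u * v)" if "0 < u" "0 < v" for u v
  proof -
    have "c (u + v) - c u \<le> (ln (u + v) - ln u) / real (Suc n)"
    proof -
      have "ln u / real (Suc n) \<le> ln (u + v) / real (Suc n)"
        using that by (intro divide_right_mono) auto
      then show ?thesis unfolding c_def diff_divide_distrib by linarith
    qed
    also have "ln (u + v) - ln u = ln (1 + v / u)"
      using that ln_div[of "u + v" u] by (simp add: add_divide_distrib)
    also have "\<dots> \<le> 2 * sqrt (v / u)"
      using that by (intro ln_add_one_le_sqrt) auto
    finally have "c (u + v) \<le> c u + 2 * sqrt (v / u) / real (Suc n)"
      by (simp add: divide_right_mono)
    then have "u * c (u + v) \<le> u * (c u + 2 * sqrt (v / u) / real (Suc n))"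
      using that by (intro mult_left_mono) auto
    also have "u * sqrt (v / u) = sqrt (u * v)"
      using that by (simp add: real_sqrt_divide real_sqrt_mult field_simps)
    then have "u * (c u + 2 * sqrt (v / u) / real (Suc n)) = u * c u + 2 / real (Suc n) * sqrt (u * v)"
      by (simp add: algebra_simps)
    finally show ?thesis .
  qed
  have "log_cutoff \<delta> n (y + y') = y * c (y + y') + y' * c (y' + y)"
    using True y y' by (simp add: log_cutoff_def c_def algebra_simps)
  also have "\<dots> \<le> (y * c y + 2 / real (Suc n) * sqrt (y * y')) + (y' * c y' + 2 / real (Suc n) * sqrt (y' * y))"
    by (intro add_mono part y y')
  also have "\<dots> = log_cutoff \<delta> n y + log_cutoff \<delta> n y' + 4 / real (Suc n) * sqrt (y * y')"
    using True y y' by (simp add: log_cutoff_def c_def mult.commute)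
  finally show ?thesis .
next
  case False
  then have "log_cutoff \<delta> n (y + y') = 0" by (simp add: log_cutoff_def)
  then show ?thesis using y y' by simp
qed


section \<open>Balance of the cut-off first moment\<close>

context coagulation_bound
begin

text \<open>Integrating the Duhamel loss term over x removes the heat kernel, which has mass one.
  Taken at the final time T, this leaves the total loss in A over all earlier times.\<close>

lemma loss_finite_on_compact:
  fixes \<mu> :: "real \<Rightarrow> real ^ 'd \<Rightarrow> real measure"
  assumes \<nu>: "represents T \<mu> \<nu>" and loss: "loss_term_integrable K a \<mu> T"
    and A: "compact A" "A \<subseteq> {0<..}"
  shows "(\<integral>\<^sup>+ p. indicator A (snd (fst p)) * indicator {0..<T} (fst (fst (fst p))) *
    ennreal (kp p) \<partial>semiprod2 spacetime \<nu>) < \<infinity>"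
proof -
  have \<nu>k: "moment_kernel spacetime \<nu>" using \<nu> by (rule represents_kernel)
  have A' [measurable]: "A \<in> sets borel" using A by (simp add: borel_compact)
  have Am: "A \<in> sets masses" using A A' by (simp add: sets_masses)
  interpret S2: sigma_finite_measure "semiprod2 spacetime \<nu>"
    using \<nu>k by (intro sigma_finite_semiprod2 sigma_finite_spacetime)
  interpret P: pair_sigma_finite "semiprod2 spacetime \<nu>" "lborel :: (real ^ 'd) measure" ..
  have [simp]: "u \<in> space (borel \<Otimes>\<^sub>M borel)" for u :: "real \<times> (real ^ 'd)"
    by (simp add: space_pair_measure)
  let ?F = "\<lambda>p x. indicator A (snd (fst p)) *
        ennreal (resolvent_density b 0 (snd (fst p)) (fst (fst p)) (T, x)) *
        ennreal (kp p)"
  have "(\<integral>\<^sup>+ x. duhamel a T (\<lambda>s x. coag_loss K (\<mu> s x)) x A \<partial>lborel)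
      = (\<integral>\<^sup>+ x. (\<integral>\<^sup>+ p. ?F p x \<partial>semiprod2 spacetime \<nu>) \<partial>lborel)"
    by (simp add: duhamel_loss[OF a_measurable K \<nu> order_refl Am])
  also have "\<dots> = (\<integral>\<^sup>+ p. (\<integral>\<^sup>+ x. ?F p x \<partial>lborel) \<partial>semiprod2 spacetime \<nu>)"
    by (rule P.Fubini') measurable
  also have "\<dots> = (\<integral>\<^sup>+ p. indicator A (snd (fst p)) * indicator {0..<T} (fst (fst (fst p))) *
    ennreal (kp p) \<partial>semiprod2 spacetime \<nu>)"
  proof (rule nn_integral_cong)
    fix p :: "((real \<times> (real ^ 'd)) \<times> real) \<times> real"
    obtain s x' y y' where p: "p = (((s, x'), y), y')" by (metis surj_pair)
    have "(\<integral>\<^sup>+ x. ?F p x \<partial>lborel) = (\<integral>\<^sup>+ x. (indicator A y * indicator {0..<T} s * ennreal (k y y')) *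
        ennreal (heat_density b (T - s) x' x y) \<partial>lborel)"
      by (intro nn_integral_cong) (auto simp: p resolvent_density_def indicator_def mult_ac)
    also have "\<dots> = (indicator A y * indicator {0..<T} s * ennreal (k y y')) *
        (\<integral>\<^sup>+ x. ennreal (heat_density b (T - s) x' x y) \<partial>lborel)"
      by (rule nn_integral_cmult) measurable
    also have "\<dots> = indicator A y * indicator {0..<T} s * ennreal (k y y')"
      using nn_integral_heat_density[of b y "T - s" x'] by (auto simp: indicator_def)
    finally show "(\<integral>\<^sup>+ x. ?F p x \<partial>lborel) = indicator A (snd (fst p)) * indicator {0..<T} (fst (fst (fst p))) *
        ennreal (kp p)"
      by (simp add: p)
  qed
  finally have "(\<integral>\<^sup>+ x. duhamel a T (\<lambda>s x. coag_loss K (\<mu> s x)) x A \<partial>lborel)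
    = (\<integral>\<^sup>+ p. indicator A (snd (fst p)) * indicator {0..<T} (fst (fst (fst p))) *
    ennreal (kp p) \<partial>semiprod2 spacetime \<nu>)" .
  moreover have "(\<integral>\<^sup>+ x. duhamel a T (\<lambda>s x. coag_loss K (\<mu> s x)) x A \<partial>lborel) < \<infinity>"
    using loss A unfolding loss_term_integrable_def by blast
  ultimately show ?thesis by metis
qed

lemma initial_no_small_masses:
  fixes \<mu>0 :: "real ^ 'd \<Rightarrow> real measure"
  assumes \<nu>0: "represents_initial \<mu>0 \<nu>0" and small: "\<And>x. emeasure (\<mu>0 x) {0<..<\<delta>} = 0"
  shows "AE p in semiprod lborel \<nu>0. \<delta> \<le> snd p"
proof -
  have \<nu>0k: "moment_kernel lborel \<nu>0" and eq: "AE x in lborel. \<nu>0 x = on_reals (\<mu>0 x)"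
    and M: "\<And>x. sets (\<mu>0 x) = sets masses"
    using \<nu>0 by (auto simp: represents_initial_def)
  show ?thesis
  proof (subst AE_semiprod[OF \<nu>0k])
    show "AE x in lborel. AE y in \<nu>0 x. \<delta> \<le> snd (x, y)"
      using eq
    proof eventually_elim
      case (elim x)
      have "{..<\<delta>} \<inter> {0<..} = {0<..<\<delta>}" by auto
      then have "emeasure (\<nu>0 x) {..<\<delta>} = 0"
        using small[of x] emeasure_on_reals[OF M[of x], of "{..<\<delta>}"] by (simp add: elim)
      then show ?case
        by (intro AE_I[of _ _ "{..<\<delta>}"]) (auto simp: elim)
    qed
  qed measurable
qed

lemma initial_term_eq_0:
  fixes \<Phi> :: "(real \<times> (real ^ 'd)) \<times> real \<Rightarrow> ennreal"
  assumes \<nu>0: "represents_initial \<mu>0 \<nu>0" and small: "\<And>x. emeasure (\<mu>0 x) {0<..<\<delta>} = 0"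
    and \<Phi>: "\<And>z y. \<delta> \<le> y \<Longrightarrow> \<Phi> (z, y) = 0"
  shows "initial_term b \<nu>0 \<Phi> = 0"
proof -
  have "AE p in semiprod lborel \<nu>0. \<delta> \<le> snd p"
    by (rule initial_no_small_masses[OF \<nu>0 small])
  then have "(\<integral>\<^sup>+ p. \<Phi> (z, snd p) * ennreal (heat_density b (fst z) (fst p) (snd z) (snd p)) \<partial>semiprod lborel \<nu>0)
      = (\<integral>\<^sup>+ p. 0 \<partial>semiprod lborel \<nu>0)" for z
    by (intro nn_integral_cong_AE, elim eventually_mono) (simp add: \<Phi>)
  then show ?thesis by (simp add: initial_term_def)
qed

lemma moment_product_bound:
  fixes \<nu> :: "real \<times> (real ^ 'd) \<Rightarrow> real measure"
  assumes \<nu>: "moment_kernel spacetime \<nu>"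
    and C: "\<And>z. (\<integral>\<^sup>+ y. ennreal ((W y)\<^sup>2) \<partial>\<nu> z) \<le> C"
  shows "(\<integral>\<^sup>+ p. ennreal (snd (fst p)) * ennreal ((W (snd p))\<^sup>2) \<partial>semiprod2 spacetime \<nu>)
    \<le> C * (\<integral>\<^sup>+ q. ennreal (snd q) \<partial>semiprod spacetime \<nu>)"
proof -
  have s: "sets (\<nu> z) = sets borel" for z
    using moment_kernelD(1)[OF \<nu>, of z] by (simp add: space_pair_measure)
  have "(\<integral>\<^sup>+ p. ennreal (snd (fst p)) * ennreal ((W (snd p))\<^sup>2) \<partial>semiprod2 spacetime \<nu>)
      = (\<integral>\<^sup>+ z. (\<integral>\<^sup>+ y. (\<integral>\<^sup>+ y'. ennreal y * ennreal ((W y')\<^sup>2) \<partial>\<nu> z) \<partial>\<nu> z) \<partial>spacetime)"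
    by (subst nn_integral_semiprod2[OF \<nu>]) auto
  also have "\<dots> \<le> (\<integral>\<^sup>+ z. (\<integral>\<^sup>+ y. C * ennreal y \<partial>\<nu> z) \<partial>spacetime)"
  proof (intro nn_integral_mono)
    fix z y
    note [measurable_cong] = s[of z]
    have "(\<integral>\<^sup>+ y'. ennreal y * ennreal ((W y')\<^sup>2) \<partial>\<nu> z) = ennreal y * (\<integral>\<^sup>+ y'. ennreal ((W y')\<^sup>2) \<partial>\<nu> z)"
      by (rule nn_integral_cmult) measurable
    also have "\<dots> \<le> ennreal y * C" using C by (intro mult_left_mono) auto
    finally show "(\<integral>\<^sup>+ y'. ennreal y * ennreal ((W y')\<^sup>2) \<partial>\<nu> z) \<le> C * ennreal y"
      by (simp add: mult.commute)
  qed
  also have "\<dots> = (\<integral>\<^sup>+ q. C * ennreal (snd q) \<partial>semiprod spacetime \<nu>)"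
    by (subst nn_integral_semiprod[OF \<nu>]) auto
  also have "\<dots> = C * (\<integral>\<^sup>+ q. ennreal (snd q) \<partial>semiprod spacetime \<nu>)"
    by (rule nn_integral_cmult) measurable
  finally show ?thesis .
qed

text \<open>The root sqrt (y * y') is distributed crosswise over the two factors of K \<le> w w',
  and the arithmetic-geometric mean inequality separates the product. The results y w(y')^2 and y'
  w(y)^2 pair the first moment with the bounded moment of w^2.\<close>

lemma log_cutoff_gain:
  fixes y y' :: real
  assumes y: "0 < y" "0 < y'"
  shows "log_cutoff \<delta> n (y + y') * (k y y' / 2) \<le>
    log_cutoff \<delta> n y * (k y y' / 2) + log_cutoff \<delta> n y' * (k y y' / 2) +
    (y * (W y')\<^sup>2 + y' * (W y)\<^sup>2) / real (Suc n)"
proof -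
  have "sqrt (y * y') * k y y' \<le> sqrt (y * y') * (W y * W y')"
    using k_le y by (intro mult_left_mono) auto
  also have "\<dots> = (sqrt y * W y') * (sqrt y' * W y)"
    by (simp add: real_sqrt_mult)
  also have "\<dots> \<le> ((sqrt y * W y')\<^sup>2 + (sqrt y' * W y)\<^sup>2) / 2"
    using sum_squares_bound[of "sqrt y * W y'" "sqrt y' * W y"] by simp
  also have "\<dots> = (y * (W y')\<^sup>2 + y' * (W y)\<^sup>2) / 2"
    using y by (simp add: power_mult_distrib)
  finally have *: "2 / real (Suc n) * (sqrt (y * y') * k y y') \<le> 2 / real (Suc n) * ((y * (W y')\<^sup>2 + y' * (W y)\<^sup>2) / 2)"
    by (intro mult_left_mono) auto
  have "log_cutoff \<delta> n (y + y') * (k y y' / 2) \<le>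
      (log_cutoff \<delta> n y + log_cutoff \<delta> n y' + 4 / real (Suc n) * sqrt (y * y')) * (k y y' / 2)"
    using log_cutoff_add[OF y] by (intro mult_right_mono) auto
  also have "\<dots> = log_cutoff \<delta> n y * (k y y' / 2) + log_cutoff \<delta> n y' * (k y y' / 2) +
      2 / real (Suc n) * (sqrt (y * y') * k y y')"
    by (simp add: algebra_simps)
  finally have "log_cutoff \<delta> n (y + y') * (k y y' / 2) \<le> log_cutoff \<delta> n y * (k y y' / 2) + log_cutoff \<delta> n y' * (k y y' / 2) +
      2 / real (Suc n) * (sqrt (y * y') * k y y')" .
  also note *
  also have "2 / real (Suc n) * ((y * (W y')\<^sup>2 + y' * (W y)\<^sup>2) / 2) = (y * (W y')\<^sup>2 + y' * (W y)\<^sup>2) / real (Suc n)"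
  proof -
    have "2 / u * (v / 2) = v / u" for u v :: real by simp
    then show ?thesis .
  qed
  finally show ?thesis by simp
qed

text \<open>In the balance for the cut-off weight the initial term is 0 and the gain exceeds the
  loss by at most the defect of additivity. Since the loss is finite it can be cancelled, and what
  is left bounds the cut-off first moment by a multiple of 1/(n+1).\<close>

lemma no_small_masses:
  fixes \<mu> :: "real \<Rightarrow> real ^ 'd \<Rightarrow> real measure"
  assumes \<nu>: "represents T \<mu> \<nu>" and \<nu>0: "represents_initial \<mu>0 \<nu>0"
    and eqn: "\<And>t. t \<in> {0..T} \<Longrightarrow> coag_diff_equation K a \<mu>0 \<mu> t"
    and loss: "loss_term_integrable K a \<mu> T"
    and T: "0 \<le> T" and \<delta>: "0 < \<delta>" and small: "\<And>x. emeasure (\<mu>0 x) {0<..<\<delta>} = 0"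
    and C: "\<And>z. (\<integral>\<^sup>+ y. ennreal ((W y)\<^sup>2) \<partial>\<nu> z) \<le> C" "C < \<infinity>"
    and Y: "(\<integral>\<^sup>+ q. ennreal (snd q) \<partial>semiprod spacetime \<nu>) < \<infinity>"
  shows "AE q in semiprod spacetime \<nu>. \<delta> \<le> snd q"
proof -
  have \<nu>k: "moment_kernel spacetime \<nu>" using \<nu> by (rule represents_kernel)
  define Y' where "Y' = (\<integral>\<^sup>+ q. ennreal (snd q) \<partial>semiprod spacetime \<nu>)"
  define \<Phi> :: "nat \<Rightarrow> (real \<times> (real ^ 'd)) \<times> real \<Rightarrow> ennreal"
    where "\<Phi> n q = indicator {0..T} (fst (fst q)) * ennreal (log_cutoff \<delta> n (snd q))" for n q
  have \<Phi>m [measurable]: "\<Phi> n \<in> borel_measurable phase" for n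
    unfolding \<Phi>_def[abs_def] by measurable
  \<comment> \<open>The resolvent of the time indicator of [0,T]: the time remaining until
    T.\<close>
  define \<tau> where "\<tau> s = (if 0 \<le> s \<and> s < T then T - s else 0)" for s
  have [measurable]: "\<tau> \<in> borel_measurable borel" unfolding \<tau>_def[abs_def] by measurable
  have \<tau>: "0 \<le> \<tau> s" "\<tau> s \<le> T" "\<tau> s \<le> T * indicator {0..<T} s" for s
    using T by (auto simp: \<tau>_def indicator_def)
  have res: "resolvent b 0 (\<Phi> n) (z, y) = ennreal (\<tau> (fst z)) * ennreal (log_cutoff \<delta> n y)" for n z y
    using resolvent_interval[of b y T "\<lambda>y. ennreal (log_cutoff \<delta> n y)" "fst z" "snd z"]
    by (auto simp: \<Phi>_def[abs_def] \<tau>_def indicator_def ennreal_neg)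
  let ?S = "semiprod2 spacetime \<nu>"
  have bound: "(\<integral>\<^sup>+ q. \<Phi> n q \<partial>semiprod spacetime \<nu>) \<le> ennreal (2 * T / real (Suc n)) * (C * Y')" for n
  proof -
    \<comment> \<open>\<open>A1\<close> is half of the loss. The additive part of the gain consists
      of \<open>A1\<close> and its mirror image under exchange of the masses, so it has the same
      integral as the loss. \<open>A2\<close> and its mirror image carry the defect of
      additivity.\<close>
    define A1 where "A1 p = ennreal (\<tau> (fst (fst (fst p))) * (log_cutoff \<delta> n (snd (fst p)) * (kp p / 2)))"
      for p :: "((real \<times> (real ^ 'd)) \<times> real) \<times> real"
    define A2 where "A2 p = ennreal (T / real (Suc n)) * (ennreal (snd (fst p)) * ennreal ((W (snd p))\<^sup>2))"
      for p :: "((real \<times> (real ^ 'd)) \<times> real) \<times> real"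
    let ?sw = "\<lambda>p :: ((real \<times> (real ^ 'd)) \<times> real) \<times> real. ((fst (fst p), snd p), snd (fst p))"
    have [measurable]: "A1 \<in> borel_measurable phase2"
        "A2 \<in> borel_measurable phase2"
      unfolding A1_def[abs_def] A2_def[abs_def] by measurable
    have lossE: "(\<integral>\<^sup>+ p. resolvent b 0 (\<Phi> n) (fst p) * ennreal (kp p) \<partial>?S) = (\<integral>\<^sup>+ p. A1 p \<partial>?S) + (\<integral>\<^sup>+ p. A1 p \<partial>?S)"
    proof -
      have "(\<integral>\<^sup>+ p. resolvent b 0 (\<Phi> n) (fst p) * ennreal (kp p) \<partial>?S) = (\<integral>\<^sup>+ p. A1 p + A1 p \<partial>?S)"
      proof (rule nn_integral_cong)
        fix p :: "((real \<times> (real ^ 'd)) \<times> real) \<times> real"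
        have "resolvent b 0 (\<Phi> n) (fst p) = ennreal (\<tau> (fst (fst (fst p)))) * ennreal (log_cutoff \<delta> n (snd (fst p)))"
          using res[of n "fst (fst p)" "snd (fst p)"] by simp
        then show "resolvent b 0 (\<Phi> n) (fst p) * ennreal (kp p) = A1 p + A1 p"
          unfolding A1_def using \<tau>(1) by (simp add: ennreal_mult[symmetric] ennreal_plus[symmetric] del: ennreal_plus)
      qed
      then show ?thesis by (simp add: nn_integral_add)
    qed
    \<comment> \<open>In [0,\<infinity>] the loss can be cancelled against the gain only if it is
      finite. This is where the integrability of the loss term on compact sets of masses
      enters.\<close>
    have fin: "(\<integral>\<^sup>+ p. A1 p \<partial>?S) < \<infinity>"
    proof -
      let ?A = "{exp (- real (Suc n))..\<delta>}"
      let ?B = "\<lambda>p. indicator ?A (snd (fst p)) * indicator {0..<T} (fst (fst (fst p))) * ennreal (kp p)"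
      have "(\<integral>\<^sup>+ p. A1 p \<partial>?S) \<le> (\<integral>\<^sup>+ p. ennreal (T * \<delta>) * ?B p \<partial>?S)"
      proof (rule nn_integral_mono)
        fix p :: "((real \<times> (real ^ 'd)) \<times> real) \<times> real"
        have "\<tau> (fst (fst (fst p))) * (log_cutoff \<delta> n (snd (fst p)) * (kp p / 2))
          \<le> (T * indicator {0..<T} (fst (fst (fst p)))) * ((\<delta> * indicator ?A (snd (fst p))) * kp p)"
          using \<tau> T \<delta> log_cutoff_support[OF \<delta>] k_nonneg[of "snd (fst p)" "snd p"]
          by (intro mult_mono) auto
        then have "A1 p \<le> ennreal ((T * indicator {0..<T} (fst (fst (fst p)))) * ((\<delta> * indicator ?A (snd (fst p))) * kp p))"
          unfolding A1_def by (rule ennreal_leI)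
        also have "\<dots> = ennreal (T * \<delta>) * ?B p"
          using T \<delta> by (auto simp: indicator_def ennreal_mult[symmetric] mult_ac)
        finally show "A1 p \<le> ennreal (T * \<delta>) * ?B p" .
      qed
      also have "\<dots> = ennreal (T * \<delta>) * (\<integral>\<^sup>+ p. ?B p \<partial>?S)"
        by (rule nn_integral_cmult) measurable
      also have "\<dots> < \<infinity>"
      proof -
        have "?A \<subseteq> {0<..}" by (auto intro: less_le_trans[OF exp_gt_zero])
        then show ?thesis
          using loss_finite_on_compact[OF \<nu> loss, of ?A] by (auto simp: ennreal_mult_less_top)
      qed
      finally show ?thesis .
    qed
    have gain: "(\<integral>\<^sup>+ p. resolvent b 0 (\<Phi> n) (fst (fst p), snd (fst p) + snd p) * ennreal (kp p / 2) \<partial>?S)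
        \<le> ((\<integral>\<^sup>+ p. A1 p \<partial>?S) + (\<integral>\<^sup>+ p. A1 p \<partial>?S)) + ((\<integral>\<^sup>+ p. A2 p \<partial>?S) + (\<integral>\<^sup>+ p. A2 p \<partial>?S))"
    proof -
      have "(\<integral>\<^sup>+ p. resolvent b 0 (\<Phi> n) (fst (fst p), snd (fst p) + snd p) * ennreal (kp p / 2) \<partial>?S)
        \<le> (\<integral>\<^sup>+ p. (A1 p + A1 (?sw p)) + (A2 p + A2 (?sw p)) \<partial>?S)"
      proof (rule nn_integral_mono_AE, use AE_semiprod2_pos[OF \<nu>k] in eventually_elim)
        case (elim p)
        obtain s x y y' where p: "p = (((s, x), y), y')" by (metis surj_pair)
        have y: "0 < y" "0 < y'" using elim by (auto simp: p)
        have "\<tau> s * (log_cutoff \<delta> n (y + y') * (k y y' / 2)) \<le> \<tau> s * (log_cutoff \<delta> n y * (k y y' / 2) + log_cutoff \<delta> n y' * (k y y' / 2) +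
            (y * (W y')\<^sup>2 + y' * (W y)\<^sup>2) / real (Suc n))"
          by (intro mult_left_mono log_cutoff_gain y \<tau>(1))
        also have "\<dots> = \<tau> s * (log_cutoff \<delta> n y * (k y y' / 2)) + \<tau> s * (log_cutoff \<delta> n y' * (k y' y / 2)) +
            \<tau> s * ((y * (W y')\<^sup>2 + y' * (W y)\<^sup>2) / real (Suc n))"
          by (simp add: distrib_left extend2_commute[OF K, of y y'])
        also have "\<tau> s * ((y * (W y')\<^sup>2 + y' * (W y)\<^sup>2) / real (Suc n)) \<le> T * ((y * (W y')\<^sup>2 + y' * (W y)\<^sup>2) / real (Suc n))"
          using y \<tau> by (intro mult_right_mono) auto
        also have "T * ((y * (W y')\<^sup>2 + y' * (W y)\<^sup>2) / real (Suc n)) = T / real (Suc n) * (y * (W y')\<^sup>2) + T / real (Suc n) * (y' * (W y)\<^sup>2)"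
          by (simp add: algebra_simps add_divide_distrib)
        finally have "ennreal (\<tau> s * (log_cutoff \<delta> n (y + y') * (k y y' / 2))) \<le>
          ennreal (\<tau> s * (log_cutoff \<delta> n y * (k y y' / 2)) + \<tau> s * (log_cutoff \<delta> n y' * (k y' y / 2)) +
            (T / real (Suc n) * (y * (W y')\<^sup>2) + T / real (Suc n) * (y' * (W y)\<^sup>2)))"
          by (intro ennreal_leI) simp
        also have "\<dots> = (ennreal (\<tau> s * (log_cutoff \<delta> n y * (k y y' / 2))) + ennreal (\<tau> s * (log_cutoff \<delta> n y' * (k y' y / 2)))) +
            (ennreal (T / real (Suc n) * (y * (W y')\<^sup>2)) + ennreal (T / real (Suc n) * (y' * (W y)\<^sup>2)))"
          using \<tau>(1)[of s] y T by (subst ennreal_plus | simp)+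
        also have "ennreal (T / real (Suc n) * (y * (W y')\<^sup>2)) = ennreal (T / real (Suc n)) * (ennreal y * ennreal ((W y')\<^sup>2))"
          using y T by (subst ennreal_mult | simp)+
        also have "ennreal (T / real (Suc n) * (y' * (W y)\<^sup>2)) = ennreal (T / real (Suc n)) * (ennreal y' * ennreal ((W y)\<^sup>2))"
          using y T by (subst ennreal_mult | simp)+
        also have "ennreal (\<tau> s * (log_cutoff \<delta> n (y + y') * (k y y' / 2)))
            = ennreal (\<tau> s) * ennreal (log_cutoff \<delta> n (y + y')) * ennreal (k y y' / 2)"
        proof -
          have e: "ennreal (u * (v * r)) = ennreal u * ennreal v * ennreal r" if "0 \<le> u" "0 \<le> v" "0 \<le> r" for u v r
            using that by (simp add: ennreal_mult mult.assoc)
          show ?thesis by (rule e) (use \<tau>(1)[of s] in auto)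
        qed
        finally show ?case
          by (simp only: p A1_def A2_def fst_conv snd_conv res)
      qed
      also have "\<dots> = ((\<integral>\<^sup>+ p. A1 p \<partial>?S) + (\<integral>\<^sup>+ p. A1 (?sw p) \<partial>?S)) + ((\<integral>\<^sup>+ p. A2 p \<partial>?S) + (\<integral>\<^sup>+ p. A2 (?sw p) \<partial>?S))"
        by (subst nn_integral_add, measurable)+
      finally show ?thesis
        by (simp add: nn_integral_semiprod2_swap[OF \<nu>k])
    qed
    have "(\<integral>\<^sup>+ q. \<Phi> n q \<partial>semiprod spacetime \<nu>) + ((\<integral>\<^sup>+ p. A1 p \<partial>?S) + (\<integral>\<^sup>+ p. A1 p \<partial>?S))
        = initial_term b \<nu>0 (\<Phi> n) + (\<integral>\<^sup>+ p. resolvent b 0 (\<Phi> n) (fst (fst p), snd (fst p) + snd p) * ennreal (kp p / 2) \<partial>?S)"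
      unfolding lossE[symmetric]
      by (rule weak_formulation[OF a_measurable K \<nu> \<nu>0 eqn \<Phi>m]) (auto simp: \<Phi>_def)
    moreover have "initial_term b \<nu>0 (\<Phi> n) = 0"
      by (rule initial_term_eq_0[OF \<nu>0 small]) (auto simp: \<Phi>_def log_cutoff_def)
    ultimately have "(\<integral>\<^sup>+ q. \<Phi> n q \<partial>semiprod spacetime \<nu>) + ((\<integral>\<^sup>+ p. A1 p \<partial>?S) + (\<integral>\<^sup>+ p. A1 p \<partial>?S))
        \<le> ((\<integral>\<^sup>+ p. A2 p \<partial>?S) + (\<integral>\<^sup>+ p. A2 p \<partial>?S)) + ((\<integral>\<^sup>+ p. A1 p \<partial>?S) + (\<integral>\<^sup>+ p. A1 p \<partial>?S))"
      using gain by (simp add: add.commute)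
    then have "(\<integral>\<^sup>+ q. \<Phi> n q \<partial>semiprod spacetime \<nu>) \<le> (\<integral>\<^sup>+ p. A2 p \<partial>?S) + (\<integral>\<^sup>+ p. A2 p \<partial>?S)"
      using fin by (subst (asm) (1 2) add.commute) (auto simp: ennreal_add_left_cancel_le top.not_eq_extremum)
    also have "(\<integral>\<^sup>+ p. A2 p \<partial>?S) = ennreal (T / real (Suc n)) * (\<integral>\<^sup>+ p. ennreal (snd (fst p)) * ennreal ((W (snd p))\<^sup>2) \<partial>?S)"
      unfolding A2_def by (rule nn_integral_cmult) measurable
    also have "\<dots> \<le> ennreal (T / real (Suc n)) * (C * Y')"
      unfolding Y'_def by (intro mult_left_mono moment_product_bound \<nu>k C) auto
    finally have "(\<integral>\<^sup>+ q. \<Phi> n q \<partial>semiprod spacetime \<nu>)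
        \<le> ennreal (T / real (Suc n)) * (C * Y') + ennreal (T / real (Suc n)) * (C * Y')"
      by (simp add: add_mono)
    also have "\<dots> = ennreal (2 * T / real (Suc n)) * (C * Y')"
      using T by (simp add: distrib_right[symmetric] ennreal_plus[symmetric] del: ennreal_plus of_nat_Suc)
    finally show ?thesis .
  qed
  have zero: "(\<integral>\<^sup>+ q. \<Phi> m q \<partial>semiprod spacetime \<nu>) = 0" for m
  proof -
    have "(\<lambda>n. 2 * T / real (Suc n)) \<longlonglongrightarrow> 0"
      using LIMSEQ_Suc[OF lim_const_over_n[of "2 * T"]] .
    then have "(\<lambda>n. ennreal (2 * T / real (Suc n))) \<longlonglongrightarrow> 0"
      using tendsto_ennrealI by fastforce
    moreover have "C * Y' < top"
      using C Y by (simp add: Y'_def ennreal_mult_less_top)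
    ultimately have "(\<lambda>n. (C * Y') * ennreal (2 * T / real (Suc n))) \<longlonglongrightarrow> (C * Y') * 0"
      by (intro ennreal_tendsto_cmult)
    then have "(\<lambda>n. ennreal (2 * T / real (Suc n)) * (C * Y')) \<longlonglongrightarrow> 0"
      by (simp only: mult.commute[of _ "C * Y'"] mult_zero_right)
    \<comment> \<open>The cutoffs increase with n, so the integral at a fixed m inherits the bounds
      for all n \<ge> m, which tend to 0.\<close>
    moreover have "\<forall>\<^sub>F n in sequentially. (\<integral>\<^sup>+ q. \<Phi> m q \<partial>semiprod spacetime \<nu>) \<le> ennreal (2 * T / real (Suc n)) * (C * Y')"
      using eventually_ge_at_top[of m]
    proof eventually_elim
      case (elim n)
      have "(\<integral>\<^sup>+ q. \<Phi> m q \<partial>semiprod spacetime \<nu>) \<le> (\<integral>\<^sup>+ q. \<Phi> n q \<partial>semiprod spacetime \<nu>)"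
        unfolding \<Phi>_def using log_cutoff_mono[OF elim] by (intro nn_integral_mono mult_left_mono ennreal_leI) auto
      also note bound
      finally show ?case .
    qed
    ultimately have "(\<integral>\<^sup>+ q. \<Phi> m q \<partial>semiprod spacetime \<nu>) \<le> 0"
      by (intro tendsto_lowerbound) auto
    then show ?thesis by simp
  qed
  have "AE q in semiprod spacetime \<nu>. \<forall>m. \<Phi> m q = 0"
    unfolding AE_all_countable
    using zero by (auto simp: nn_integral_0_iff_AE)
  moreover have "AE q in semiprod spacetime \<nu>. fst (fst q) \<in> {0..T}"
  proof (subst AE_semiprod[OF \<nu>k])
    have "AE z in spacetime. \<nu> z = (if fst z \<in> {0..T} then on_reals (\<mu> (fst z) (snd z)) else null_measure borel)"
      using \<nu> by (simp add: represents_def)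
    then show "AE z in spacetime. AE y in \<nu> z. fst (fst (z, y)) \<in> {0..T}"
    proof eventually_elim
      case (elim z)
      then show ?case by (cases "fst z \<in> {0..T}") (auto simp: AE_iff_null)
    qed
  qed measurable
  ultimately show ?thesis
    using AE_semiprod_pos[OF \<nu>k]
  proof eventually_elim
    case (elim q)
    show ?case
    proof (rule ccontr)
      assume "\<not> \<delta> \<le> snd q"
      then obtain n where "0 < log_cutoff \<delta> n (snd q)" using log_cutoff_pos[of "snd q" \<delta>] elim by auto
      then have "\<Phi> n q \<noteq> 0" using elim by (simp add: \<Phi>_def)
      then show False using elim by simp
    qed
  qed
qed

end

section \<open>The uniqueness estimate\<close>

text \<open>The two solutions enter only as f \<rho> and (1 - f) \<rho> with a common dominating
  kernel \<rho>. \<open>J\<close> is the initial term; both solutions share it, so it cancels, and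
  only its finiteness and monotonicity are recorded. The constant \<beta> bounds the moment of w^2
  under \<rho> at every point.\<close>

locale density_pair = coagulation_bound K w a
  for K :: "real \<Rightarrow> real \<Rightarrow> real" and w a :: "real \<Rightarrow> real" +
  fixes \<rho> :: "real \<times> (real ^ 'd) \<Rightarrow> real measure"
    and f :: "(real \<times> (real ^ 'd)) \<times> real \<Rightarrow> real"
    and J :: "((real \<times> (real ^ 'd)) \<times> real \<Rightarrow> ennreal) \<Rightarrow> ennreal"
    and T \<beta> :: real
  assumes \<rho>: "moment_kernel spacetime \<rho>"
    and f_measurable [measurable]: "f \<in> borel_measurable phase"
    and f_bounds: "0 \<le> f q" "f q \<le> 1"
    and T: "0 \<le> T" and \<beta>: "0 \<le> \<beta>"
    and time_support: "AE q in semiprod spacetime \<rho>. fst (fst q) \<in> {0..T}"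
    and W_square: "(\<integral>\<^sup>+ y. ennreal ((W y)\<^sup>2) \<partial>\<rho> z) \<le> ennreal \<beta>"
    and W_finite: "(\<integral>\<^sup>+ q. ennreal (W (snd q)) \<partial>semiprod spacetime \<rho>) < \<infinity>"
    and J_finite: "J (\<lambda>q. ennreal (W (snd q)) * indicator {0..T} (fst (fst q))) < \<infinity>"
    and J_mono: "(\<And>q. \<Phi> q \<le> \<Psi> q) \<Longrightarrow> J \<Phi> \<le> J \<Psi>"
    and weak1: "\<Phi> \<in> borel_measurable phase \<Longrightarrow> (\<And>t x y. t \<notin> {0..T} \<Longrightarrow> \<Phi> ((t, x), y) = 0) \<Longrightarrow>
      (\<integral>\<^sup>+ q. \<Phi> q * ennreal (f q) \<partial>semiprod spacetime \<rho>) +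
      (\<integral>\<^sup>+ p. resolvent b 0 \<Phi> (fst p) * ennreal (kp p) *
        (ennreal (f (fst p)) * ennreal (f (fst (fst p), snd p))) \<partial>semiprod2 spacetime \<rho>)
      = J \<Phi> + (\<integral>\<^sup>+ p. resolvent b 0 \<Phi> (fst (fst p), snd (fst p) + snd p) * ennreal (kp p / 2) *
        (ennreal (f (fst p)) * ennreal (f (fst (fst p), snd p))) \<partial>semiprod2 spacetime \<rho>)"
    and weak2: "\<Phi> \<in> borel_measurable phase \<Longrightarrow> (\<And>t x y. t \<notin> {0..T} \<Longrightarrow> \<Phi> ((t, x), y) = 0) \<Longrightarrow>
      (\<integral>\<^sup>+ q. \<Phi> q * ennreal (1 - f q) \<partial>semiprod spacetime \<rho>) +
      (\<integral>\<^sup>+ p. resolvent b 0 \<Phi> (fst p) * ennreal (kp p) *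
        (ennreal (1 - f (fst p)) * ennreal (1 - f (fst (fst p), snd p))) \<partial>semiprod2 spacetime \<rho>)
      = J \<Phi> + (\<integral>\<^sup>+ p. resolvent b 0 \<Phi> (fst (fst p), snd (fst p) + snd p) * ennreal (kp p / 2) *
        (ennreal (1 - f (fst p)) * ennreal (1 - f (fst (fst p), snd p))) \<partial>semiprod2 spacetime \<rho>)"
begin

abbreviation "R \<equiv> semiprod spacetime \<rho>"
abbreviation "R2 \<equiv> semiprod2 spacetime \<rho>"
abbreviation "swap \<equiv> \<lambda>p :: ((real \<times> (real ^ 'd)) \<times> real) \<times> real. ((fst (fst p), snd p), snd (fst p))"

definition g :: "(real \<times> (real ^ 'd)) \<times> real \<Rightarrow> real"
  where "g q = 2 * f q - 1"

lemma g_measurable [measurable]: "g \<in> borel_measurable phase"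
  unfolding g_def[abs_def] by measurable

lemma g_le: "\<bar>g q\<bar> \<le> 1"
  using f_bounds[of q] by (simp add: g_def)

lemma sets_\<rho>: "sets (\<rho> z) = sets borel"
  using moment_kernelD(1)[OF \<rho>, of z] by (simp add: space_pair_measure)

section \<open>Symmetry and domination of integrals over pairs\<close>

lemma distr_swap: "distr R2 R2 swap = R2"
proof (rule measure_eqI)
  fix A assume "A \<in> sets (distr R2 R2 swap)"
  then have A [measurable]: "A \<in> sets phase2"
    by (simp cong: sets_pair_measure_cong)
  have "emeasure (distr R2 R2 swap) A = (\<integral>\<^sup>+ p. indicator A p \<partial>distr R2 R2 swap)"
    using A by (simp cong: sets_pair_measure_cong)
  also have "\<dots> = (\<integral>\<^sup>+ p. indicator A (swap p) \<partial>R2)"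
    by (rule nn_integral_distr) measurable
  also have "\<dots> = (\<integral>\<^sup>+ p. indicator A p \<partial>R2)"
    by (rule nn_integral_semiprod2_swap[OF \<rho>, of "indicator A"]) measurable
  also have "\<dots> = emeasure R2 A"
    using A by (simp cong: sets_pair_measure_cong)
  finally show "emeasure (distr R2 R2 swap) A = emeasure R2 A" .
qed simp

lemma integral_swap:
  assumes [measurable]: "(F :: _ \<Rightarrow> real) \<in> borel_measurable phase2"
  shows "(LINT p|R2. F (swap p)) = (LINT p|R2. F p)"
proof -
  have "(LINT p|R2. F p) = (LINT p|distr R2 R2 swap. F p)" by (simp add: distr_swap)
  also have "\<dots> = (LINT p|R2. F (swap p))" by (rule integral_distr) measurable
  finally show ?thesis by simp
qed

lemma integrable_swap:
  assumes [measurable]: "(F :: _ \<Rightarrow> real) \<in> borel_measurable phase2"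
  shows "integrable R2 (\<lambda>p. F (swap p)) \<longleftrightarrow> integrable R2 F"
proof -
  have "integrable R2 F \<longleftrightarrow> integrable (distr R2 R2 swap) F" by (simp add: distr_swap)
  also have "\<dots> \<longleftrightarrow> integrable R2 (\<lambda>p. F (swap p))" by (rule integrable_distr_eq) measurable
  finally show ?thesis by simp
qed

lemma W_integrable: "integrable R (\<lambda>q. W (snd q))"
  using W_finite by (intro integrableI_nonneg) auto

text \<open>The moment of w^2 enters here: one factor w(y') is the weight of the partner, the other
  comes from K \<le> w w'. Averaging over the partner thus returns the weight w(y) at the cost
  \<beta>.\<close>

lemma Wk_inner: "(\<integral>\<^sup>+ y'. ennreal (W y' * k y y') \<partial>\<rho> z) \<le> ennreal \<beta> * ennreal (W y)"
proof -
  note [measurable_cong] = sets_\<rho>[of z]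
  have "(\<integral>\<^sup>+ y'. ennreal (W y' * k y y') \<partial>\<rho> z) \<le> (\<integral>\<^sup>+ y'. ennreal (W y) * ennreal ((W y')\<^sup>2) \<partial>\<rho> z)"
  proof (rule nn_integral_mono)
    fix y'
    have "W y' * k y y' \<le> W y' * (W y * W y')" by (intro mult_left_mono k_le) auto
    also have "\<dots> = W y * (W y')\<^sup>2" by (simp add: power2_eq_square)
    finally have "ennreal (W y' * k y y') \<le> ennreal (W y * (W y')\<^sup>2)" by (rule ennreal_leI)
    then show "ennreal (W y' * k y y') \<le> ennreal (W y) * ennreal ((W y')\<^sup>2)" by (simp add: ennreal_mult)
  qed
  also have "\<dots> = ennreal (W y) * (\<integral>\<^sup>+ y'. ennreal ((W y')\<^sup>2) \<partial>\<rho> z)"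
    by (rule nn_integral_cmult) measurable
  also have "\<dots> \<le> ennreal (W y) * ennreal \<beta>"
    by (intro mult_left_mono W_square) auto
  finally show ?thesis by (simp add: mult.commute)
qed

lemma Wk_weighted_le:
  assumes h [measurable]: "(h :: _ \<Rightarrow> ennreal) \<in> borel_measurable phase"
  shows "(\<integral>\<^sup>+ p. h (fst p) * ennreal (W (snd p) * kp p) \<partial>R2)
    \<le> ennreal \<beta> * (\<integral>\<^sup>+ q. h q * ennreal (W (snd q)) \<partial>R)"
proof -
  have "(\<integral>\<^sup>+ p. h (fst p) * ennreal (W (snd p) * kp p) \<partial>R2)
      = (\<integral>\<^sup>+ z. (\<integral>\<^sup>+ y. (\<integral>\<^sup>+ y'. h (z, y) * ennreal (W y' * k y y') \<partial>\<rho> z) \<partial>\<rho> z) \<partial>spacetime)"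
    by (subst nn_integral_semiprod2[OF \<rho>]) auto
  also have "\<dots> \<le> (\<integral>\<^sup>+ z. (\<integral>\<^sup>+ y. ennreal \<beta> * (h (z, y) * ennreal (W y)) \<partial>\<rho> z) \<partial>spacetime)"
  proof (intro nn_integral_mono)
    fix z y
    note [measurable_cong] = sets_\<rho>[of z]
    have "(\<integral>\<^sup>+ y'. h (z, y) * ennreal (W y' * k y y') \<partial>\<rho> z) = h (z, y) * (\<integral>\<^sup>+ y'. ennreal (W y' * k y y') \<partial>\<rho> z)"
      by (rule nn_integral_cmult) measurable
    also have "\<dots> \<le> h (z, y) * (ennreal \<beta> * ennreal (W y))"
      by (intro mult_left_mono Wk_inner) auto
    finally show "(\<integral>\<^sup>+ y'. h (z, y) * ennreal (W y' * k y y') \<partial>\<rho> z) \<le> ennreal \<beta> * (h (z, y) * ennreal (W y))"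
      by (simp add: mult_ac)
  qed
  also have "\<dots> = (\<integral>\<^sup>+ q. ennreal \<beta> * (h q * ennreal (W (snd q))) \<partial>R)"
    by (subst nn_integral_semiprod[OF \<rho>]) auto
  also have "\<dots> = ennreal \<beta> * (\<integral>\<^sup>+ q. h q * ennreal (W (snd q)) \<partial>R)"
    by (rule nn_integral_cmult) measurable
  finally show ?thesis .
qed

lemma Wk_integrable2: "integrable R2 (\<lambda>p. W (snd p) * kp p)"
proof (rule integrableI_nonneg)
  have "(\<integral>\<^sup>+ p. ennreal (W (snd p) * kp p) \<partial>R2) \<le> ennreal \<beta> * (\<integral>\<^sup>+ q. ennreal (W (snd q)) \<partial>R)"
    using Wk_weighted_le[of "\<lambda>_. 1"] by simp
  also have "\<dots> < \<infinity>" using W_finite by (simp add: ennreal_mult_less_top)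
  finally show "(\<integral>\<^sup>+ p. ennreal (W (snd p) * kp p) \<partial>R2) < \<infinity>" .
qed auto

lemma Wk_integrable1: "integrable R2 (\<lambda>p. W (snd (fst p)) * kp p)"
  using integrable_swap[of "\<lambda>p. W (snd p) * kp p"] Wk_integrable2
  by (simp add: extend2_commute[OF K])

lemma integrable_R_dominated:
  assumes [measurable]: "(F :: _ \<Rightarrow> real) \<in> borel_measurable phase"
    and "\<And>q. \<bar>F q\<bar> \<le> c * W (snd q)"
  shows "integrable R F"
  by (rule Bochner_Integration.integrable_bound[OF integrable_mult_right[OF W_integrable, of c]])
     (use assms(2) in \<open>auto intro!: AE_I2 order.trans[OF _ abs_ge_self]\<close>)

text \<open>The bound is asked for positive masses only, because subadditivity of \<open>W\<close>,
  used at the merged mass y + y', is available only there.\<close>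

lemma integrable_R2_dominated:
  assumes [measurable]: "(F :: _ \<Rightarrow> real) \<in> borel_measurable phase2"
    and F: "\<And>z y y'. 0 < y \<Longrightarrow> 0 < y' \<Longrightarrow> \<bar>F ((z, y), y')\<bar> \<le> c * ((W y + W y') * k y y')"
  shows "integrable R2 F"
proof (rule Bochner_Integration.integrable_bound)
  show "integrable R2 (\<lambda>p. c * (W (snd (fst p)) * kp p + W (snd p) * kp p))"
    by (intro integrable_mult_right Bochner_Integration.integrable_add Wk_integrable1 Wk_integrable2)
  show "AE p in R2. norm (F p) \<le> norm (c * (W (snd (fst p)) * kp p + W (snd p) * kp p))"
    using AE_semiprod2_pos[OF \<rho>]
  proof eventually_elim
    case (elim p)
    have "\<bar>F p\<bar> \<le> c * ((W (snd (fst p)) + W (snd p)) * kp p)"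
      using F[of "snd (fst p)" "snd p" "fst (fst p)"] elim by simp
    then show ?case by (simp add: distrib_right)
  qed
qed measurable

section \<open>Test functions and their resolvents\<close>

definition test_function :: "((real \<times> (real ^ 'd)) \<times> real \<Rightarrow> real) \<Rightarrow> bool"
  where "test_function \<Phi> \<longleftrightarrow> \<Phi> \<in> borel_measurable phase \<and>
    (\<forall>q. 0 \<le> \<Phi> q \<and> \<Phi> q \<le> W (snd q) * indicator {0..T} (fst (fst q)))"

text \<open>For a test function and \<Lambda> \<ge> 0 the resolvent is finite everywhere, so
  \<open>enn2real\<close> loses nothing; see \<open>ennreal_U\<close>.\<close>

definition U :: "real \<Rightarrow> ((real \<times> (real ^ 'd)) \<times> real \<Rightarrow> real) \<Rightarrow> (real \<times> (real ^ 'd)) \<times> real \<Rightarrow> real"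
  where "U \<Lambda> \<Phi> q = enn2real (resolvent b \<Lambda> (\<lambda>q. ennreal (\<Phi> q)) q)"

lemma test_functionD:
  assumes "test_function \<Phi>"
  shows "\<Phi> \<in> borel_measurable phase" "0 \<le> \<Phi> q"
    "\<Phi> q \<le> W (snd q) * indicator {0..T} (fst (fst q))" "\<Phi> q \<le> W (snd q)"
proof -
  show "\<Phi> \<in> borel_measurable phase" "0 \<le> \<Phi> q"
    "\<Phi> q \<le> W (snd q) * indicator {0..T} (fst (fst q))"
    using assms unfolding test_function_def by blast+
  note this(3)
  also have "\<dots> \<le> W (snd q)" by (auto simp: indicator_def)
  finally show "\<Phi> q \<le> W (snd q)" .
qed

lemma test_function_ennreal_le:
  assumes "test_function \<Phi>"
  shows "ennreal (\<Phi> q) \<le> ennreal (W (snd q)) * indicator {0..T} (fst (fst q))"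
proof -
  have "ennreal (\<Phi> q) \<le> ennreal (W (snd q) * indicator {0..T} (fst (fst q)))"
    by (rule ennreal_leI[OF test_functionD(3)[OF assms]])
  then show ?thesis by (auto simp: indicator_def ennreal_neg split: if_splits)
qed

lemma resolvent_test_le:
  assumes \<Phi>: "test_function \<Phi>"
  shows "resolvent b 0 (\<lambda>q. ennreal (\<Phi> q)) q \<le> ennreal (T * W (snd q))"
    and "0 < \<Lambda> \<Longrightarrow> resolvent b \<Lambda> (\<lambda>q. ennreal (\<Phi> q)) q \<le> ennreal (W (snd q) / \<Lambda>)"
proof -
  obtain s x y where q: "q = ((s, x), y)" by (metis surj_pair)
  have le: "ennreal (\<Phi> q) \<le> indicator {0..T} (fst (fst q)) * ennreal (W (snd q))" for q
    using test_function_ennreal_le[OF \<Phi>] by (simp add: mult.commute)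
  have "resolvent b 0 (\<lambda>q. ennreal (\<Phi> q)) q \<le> resolvent b 0 (\<lambda>q. indicator {0..T} (fst (fst q)) * ennreal (W (snd q))) q"
    by (intro resolvent_mono le)
  also have "\<dots> = ennreal (T - s) * indicator {0..} s * ennreal (W y)"
    unfolding q by (rule resolvent_interval) auto
  also have "\<dots> \<le> ennreal (T * W y)"
    using T by (auto simp: indicator_def ennreal_mult intro!: mult_right_mono ennreal_leI)
  finally show "resolvent b 0 (\<lambda>q. ennreal (\<Phi> q)) q \<le> ennreal (T * W (snd q))" by (simp add: q)
  assume \<Lambda>: "0 < \<Lambda>"
  have "resolvent b \<Lambda> (\<lambda>q. ennreal (\<Phi> q)) q \<le>
      resolvent b \<Lambda> (\<lambda>q. (ennreal (exp (- 0 * fst (fst q))) * indicator {0..T} (fst (fst q))) * ennreal (W (snd q))) q"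
    by (intro resolvent_mono order.trans[OF le]) simp
  also have "\<dots> \<le> ennreal (exp (- 0 * s) / (\<Lambda> + 0)) * ennreal (W y)"
    unfolding q using \<Lambda> by (intro resolvent_exp_weight) auto
  also have "\<dots> = ennreal (W y / \<Lambda>)"
    using \<Lambda> by (simp add: ennreal_mult[symmetric])
  finally show "resolvent b \<Lambda> (\<lambda>q. ennreal (\<Phi> q)) q \<le> ennreal (W (snd q) / \<Lambda>)" by (simp add: q)
qed

lemma U_measurable [measurable]:
  "test_function \<Phi> \<Longrightarrow> U \<Lambda> \<Phi> \<in> borel_measurable phase"
  unfolding U_def[abs_def] using test_functionD(1)[of \<Phi>] by measurable

lemma U_nonneg [simp]: "0 \<le> U \<Lambda> \<Phi> q"
  by (simp add: U_def)

lemma ennreal_U: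
  assumes \<Phi>: "test_function \<Phi>" and \<Lambda>: "0 \<le> \<Lambda>"
  shows "ennreal (U \<Lambda> \<Phi> q) = resolvent b \<Lambda> (\<lambda>q. ennreal (\<Phi> q)) q"
proof -
  have "resolvent b \<Lambda> (\<lambda>q. ennreal (\<Phi> q)) q < top"
    using resolvent_test_le(1)[OF \<Phi>, of q] resolvent_test_le(2)[OF \<Phi>, of \<Lambda> q] \<Lambda> by (cases "\<Lambda> = 0") (auto intro: le_less_trans)
  then show ?thesis by (simp add: U_def)
qed

lemma U_le:
  assumes \<Phi>: "test_function \<Phi>"
  shows "U 0 \<Phi> q \<le> T * W (snd q)" and "0 < \<Lambda> \<Longrightarrow> \<Lambda> * U \<Lambda> \<Phi> q \<le> W (snd q)"
proof -
  have "ennreal (U 0 \<Phi> q) \<le> ennreal (T * W (snd q))"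
    using resolvent_test_le(1)[OF \<Phi>] by (simp add: ennreal_U[OF \<Phi>])
  then show "U 0 \<Phi> q \<le> T * W (snd q)"
    using T by (subst (asm) ennreal_le_iff) auto
  assume \<Lambda>: "0 < \<Lambda>"
  then have "ennreal (U \<Lambda> \<Phi> q) \<le> ennreal (W (snd q) / \<Lambda>)"
    using resolvent_test_le(2)[OF \<Phi>] by (simp add: ennreal_U[OF \<Phi>])
  then have "U \<Lambda> \<Phi> q \<le> W (snd q) / \<Lambda>"
    using \<Lambda> by (subst (asm) ennreal_le_iff) auto
  then show "\<Lambda> * U \<Lambda> \<Phi> q \<le> W (snd q)" using \<Lambda> by (simp add: field_simps)
qed

text \<open>At negative times the resolvent kernel is cut off. At times beyond T it looks only
  forward, where \<Phi> is zero.\<close>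

lemma U_support:
  assumes \<Phi>: "test_function \<Phi>" and "fst (fst q) \<notin> {0..T}"
  shows "U \<Lambda> \<Phi> q = 0"
proof -
  have *: "ennreal (resolvent_density b \<Lambda> (snd q) (fst q) z') * ennreal (\<Phi> (z', snd q)) = 0" for z'
  proof (cases "0 \<le> fst (fst q) \<and> fst (fst q) < fst z'")
    case True
    then have "fst z' \<notin> {0..T}" using assms(2) by auto
    then have "\<Phi> (z', snd q) = 0"
      using test_functionD(2,3)[OF \<Phi>, of "(z', snd q)"] by simp
    then show ?thesis by simp
  qed (auto simp: resolvent_density_def)
  have "resolvent b \<Lambda> (\<lambda>q. ennreal (\<Phi> q)) q = (\<integral>\<^sup>+ (z' :: real \<times> (real ^ 'd)). 0 \<partial>spacetime)"
    unfolding resolvent_def by (intro nn_integral_cong *)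
  then show ?thesis by (simp add: U_def)
qed

text \<open>The bound by w with constant exactly 1 is preserved, since \<Lambda> U_\<Lambda> has
  total mass at most one. Hence the weak equation may be tested both with \<Phi> and with \<Lambda>
  U_\<Lambda> \<Phi>.\<close>

lemma test_function_U:
  assumes \<Phi>: "test_function \<Phi>" and \<Lambda>: "0 < \<Lambda>"
  shows "test_function (\<lambda>q. \<Lambda> * U \<Lambda> \<Phi> q)"
  unfolding test_function_def
proof (intro conjI allI)
  show "(\<lambda>q. \<Lambda> * U \<Lambda> \<Phi> q) \<in> borel_measurable phase"
    using U_measurable[OF \<Phi>] by measurable
  fix q
  show "0 \<le> \<Lambda> * U \<Lambda> \<Phi> q" using \<Lambda> by simp
  show "\<Lambda> * U \<Lambda> \<Phi> q \<le> W (snd q) * indicator {0..T} (fst (fst q))"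
    using U_le(2)[OF \<Phi> \<Lambda>, of q] U_support[OF \<Phi>, of q] by (cases "fst (fst q) \<in> {0..T}") auto
qed

lemma U_identity:
  assumes \<Phi>: "test_function \<Phi>" and \<Lambda>: "0 < \<Lambda>"
  shows "U 0 \<Phi> q = U \<Lambda> \<Phi> q + U 0 (\<lambda>q. \<Lambda> * U \<Lambda> \<Phi> q) q"
proof -
  have [measurable]: "\<Phi> \<in> borel_measurable phase" by (rule test_functionD[OF \<Phi>])
  have "ennreal (U 0 \<Phi> q) = resolvent b \<Lambda> (\<lambda>q. ennreal (\<Phi> q)) q +
      resolvent b 0 (\<lambda>q. ennreal \<Lambda> * resolvent b \<Lambda> (\<lambda>q. ennreal (\<Phi> q)) q) q"
    unfolding ennreal_U[OF \<Phi> order_refl] using \<Lambda> by (intro resolvent_identity) auto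
  also have "(\<lambda>q. ennreal \<Lambda> * resolvent b \<Lambda> (\<lambda>q. ennreal (\<Phi> q)) q) = (\<lambda>q. ennreal (\<Lambda> * U \<Lambda> \<Phi> q))"
    using \<Lambda> by (simp add: ennreal_mult ennreal_U[OF \<Phi>])
  also have "resolvent b \<Lambda> (\<lambda>q. ennreal (\<Phi> q)) q + resolvent b 0 (\<lambda>q. ennreal (\<Lambda> * U \<Lambda> \<Phi> q)) q
      = ennreal (U \<Lambda> \<Phi> q + U 0 (\<lambda>q. \<Lambda> * U \<Lambda> \<Phi> q) q)"
    using \<Lambda> by (simp add: ennreal_U[OF \<Phi>] ennreal_U[OF test_function_U[OF \<Phi> \<Lambda>]])
  finally show ?thesis
    by (subst (asm) ennreal_inj) (auto intro: add_nonneg_nonneg)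
qed

text \<open>Here h stands for f or 1 - f. Every term is dominated by a multiple of an integrable
  weight: \<Phi> by w, and the collision terms by T (w(y) + w(y')) K(y,y'), with subadditivity for
  the gain. The identity therefore passes from [0,\<infinity>] to real integrals, where solutions
  can be subtracted.\<close>

lemma weak_real:
  assumes \<Phi>: "test_function \<Phi>" and [measurable]: "h \<in> borel_measurable phase"
    and h: "\<And>q. 0 \<le> h q" "\<And>q. h q \<le> 1"
    and weak: "(\<integral>\<^sup>+ q. ennreal (\<Phi> q) * ennreal (h q) \<partial>R) +
      (\<integral>\<^sup>+ p. resolvent b 0 (\<lambda>q. ennreal (\<Phi> q)) (fst p) * ennreal (kp p) *
        (ennreal (h (fst p)) * ennreal (h (fst (fst p), snd p))) \<partial>R2)
      = J (\<lambda>q. ennreal (\<Phi> q)) + (\<integral>\<^sup>+ p. resolvent b 0 (\<lambda>q. ennreal (\<Phi> q)) (fst (fst p), snd (fst p) + snd p) *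
        ennreal (kp p / 2) * (ennreal (h (fst p)) * ennreal (h (fst (fst p), snd p))) \<partial>R2)"
  shows "(LINT q|R. \<Phi> q * h q) + (LINT p|R2. U 0 \<Phi> (fst p) * kp p * (h (fst p) * h (fst (fst p), snd p)))
    = enn2real (J (\<lambda>q. ennreal (\<Phi> q))) +
      (LINT p|R2. U 0 \<Phi> (fst (fst p), snd (fst p) + snd p) * (kp p / 2) * (h (fst p) * h (fst (fst p), snd p)))"
proof -
  have [measurable]: "\<Phi> \<in> borel_measurable phase" by (rule test_functionD[OF \<Phi>])
  note [measurable] = U_measurable[OF \<Phi>]
  have hh: "h q * h q' \<le> 1" for q q' using h by (intro mult_le_one) auto
  have i1: "integrable R (\<lambda>q. \<Phi> q * h q)"
  proof (rule integrable_R_dominated[where c = 1])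
    fix q
    have "\<Phi> q * h q \<le> W (snd q) * 1"
      using test_functionD(2,4)[OF \<Phi>] h by (intro mult_mono) auto
    then show "\<bar>\<Phi> q * h q\<bar> \<le> 1 * W (snd q)" using test_functionD(2)[OF \<Phi>] h by simp
  qed measurable
  have i2: "integrable R2 (\<lambda>p. U 0 \<Phi> (fst p) * kp p * (h (fst p) * h (fst (fst p), snd p)))"
  proof (rule integrable_R2_dominated[where c = T])
    fix z y y'
    have "U 0 \<Phi> (z, y) * k y y' * (h (z, y) * h (z, y')) \<le> (T * (W y + W y')) * k y y' * 1"
      using U_le(1)[OF \<Phi>, of "(z, y)"] h hh T
      by (intro mult_mono) (auto simp: distrib_left intro: order.trans)
    then show "\<bar>U 0 \<Phi> (fst ((z, y), y')) * k (snd (fst ((z, y), y'))) (snd ((z, y), y')) *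
        (h (fst ((z, y), y')) * h (fst (fst ((z, y), y')), snd ((z, y), y')))\<bar> \<le> T * ((W y + W y') * k y y')"
      using h by (simp add: mult.assoc)
  qed measurable
  have i3: "integrable R2 (\<lambda>p. U 0 \<Phi> (fst (fst p), snd (fst p) + snd p) * (kp p / 2) * (h (fst p) * h (fst (fst p), snd p)))"
  proof (rule integrable_R2_dominated[where c = T])
    fix z and y y' :: real assume y: "0 < y" "0 < y'"
    have "U 0 \<Phi> (z, y + y') \<le> T * (W y + W y')"
      using U_le(1)[OF \<Phi>, of "(z, y + y')"] mult_left_mono[OF W_add_le[OF y] T] by simp
    then have "U 0 \<Phi> (z, y + y') * (k y y' / 2) * (h (z, y) * h (z, y')) \<le> (T * (W y + W y')) * k y y' * 1"
      using h hh T by (intro mult_mono) auto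
    then show "\<bar>U 0 \<Phi> (fst (fst ((z, y), y')), snd (fst ((z, y), y')) + snd ((z, y), y')) *
        (k (snd (fst ((z, y), y'))) (snd ((z, y), y')) / 2) *
        (h (fst ((z, y), y')) * h (fst (fst ((z, y), y')), snd ((z, y), y')))\<bar> \<le> T * ((W y + W y') * k y y')"
      using h by (simp add: mult.assoc)
  qed measurable
  have "J (\<lambda>q. ennreal (\<Phi> q)) \<le> J (\<lambda>q. ennreal (W (snd q)) * indicator {0..T} (fst (fst q)))"
    by (intro J_mono test_function_ennreal_le \<Phi>)
  then have "J (\<lambda>q. ennreal (\<Phi> q)) < \<infinity>"
    using J_finite by (rule order.strict_trans1)
  then have Jf: "J (\<lambda>q. ennreal (\<Phi> q)) = ennreal (enn2real (J (\<lambda>q. ennreal (\<Phi> q))))"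
    by simp
  have "ennreal ((LINT q|R. \<Phi> q * h q) + (LINT p|R2. U 0 \<Phi> (fst p) * kp p * (h (fst p) * h (fst (fst p), snd p))))
      = (\<integral>\<^sup>+ q. ennreal (\<Phi> q * h q) \<partial>R) + (\<integral>\<^sup>+ p. ennreal (U 0 \<Phi> (fst p) * kp p * (h (fst p) * h (fst (fst p), snd p))) \<partial>R2)"
  proof -
    have n1: "0 \<le> \<Phi> q * h q" and n2: "0 \<le> U 0 \<Phi> (fst p) * kp p * (h (fst p) * h (fst (fst p), snd p))" for q p
      using h test_functionD(2)[OF \<Phi>] by auto
    show ?thesis
      unfolding nn_integral_eq_integral[OF i1 AE_I2[OF n1]] nn_integral_eq_integral[OF i2 AE_I2[OF n2]]
      by (rule ennreal_plus) (intro Bochner_Integration.integral_nonneg n1 n2)+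
  qed
  also have "\<dots> = J (\<lambda>q. ennreal (\<Phi> q)) + (\<integral>\<^sup>+ p. ennreal (U 0 \<Phi> (fst (fst p), snd (fst p) + snd p) * (kp p / 2) * (h (fst p) * h (fst (fst p), snd p))) \<partial>R2)"
  proof -
    have e1: "ennreal (\<Phi> q * h q) = ennreal (\<Phi> q) * ennreal (h q)" for q
      using h test_functionD(2)[OF \<Phi>] by (simp add: ennreal_mult)
    have e2: "ennreal (U 0 \<Phi> q * l * (h r * h r')) = resolvent b 0 (\<lambda>q. ennreal (\<Phi> q)) q * ennreal l * (ennreal (h r) * ennreal (h r'))"
      if "0 \<le> l" for l q r r'
      unfolding ennreal_U[OF \<Phi> order_refl, symmetric] using h that by (simp add: ennreal_mult)
    show ?thesis
      using weak by (simp only: e1 e2 k_nonneg divide_nonneg_pos zero_less_numeral)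
  qed
  also have "\<dots> = ennreal (enn2real (J (\<lambda>q. ennreal (\<Phi> q))) +
      (LINT p|R2. U 0 \<Phi> (fst (fst p), snd (fst p) + snd p) * (kp p / 2) * (h (fst p) * h (fst (fst p), snd p))))"
  proof -
    have "(\<integral>\<^sup>+ p. ennreal (U 0 \<Phi> (fst (fst p), snd (fst p) + snd p) * (kp p / 2) * (h (fst p) * h (fst (fst p), snd p))) \<partial>R2)
        = ennreal (LINT p|R2. U 0 \<Phi> (fst (fst p), snd (fst p) + snd p) * (kp p / 2) * (h (fst p) * h (fst (fst p), snd p)))"
      by (rule nn_integral_eq_integral[OF i3]) (use h in auto)
    moreover have "0 \<le> (LINT p|R2. U 0 \<Phi> (fst (fst p), snd (fst p) + snd p) * (kp p / 2) * (h (fst p) * h (fst (fst p), snd p)))"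
      by (rule Bochner_Integration.integral_nonneg) (use h in auto)
    ultimately show ?thesis
      by (subst Jf) (simp only: ennreal_plus enn2real_nonneg)
  qed
  finally show ?thesis
  proof (rule ennreal_inj[THEN iffD1, rotated 2])
    show "0 \<le> (LINT q|R. \<Phi> q * h q) + (LINT p|R2. U 0 \<Phi> (fst p) * kp p * (h (fst p) * h (fst (fst p), snd p)))"
      by (intro add_nonneg_nonneg Bochner_Integration.integral_nonneg) (use h test_functionD(2)[OF \<Phi>] in auto)
    show "0 \<le> enn2real (J (\<lambda>q. ennreal (\<Phi> q))) +
      (LINT p|R2. U 0 \<Phi> (fst (fst p), snd (fst p) + snd p) * (kp p / 2) * (h (fst p) * h (fst (fst p), snd p)))"
      by (intro add_nonneg_nonneg Bochner_Integration.integral_nonneg) (use h in auto)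
  qed
qed

section \<open>The linearised collision functional\<close>

lemma
  assumes [measurable]: "V \<in> borel_measurable phase"
      "h \<in> borel_measurable phase2"
    and V: "\<And>q. \<bar>V q\<bar> \<le> c * W (snd q)" and c: "0 \<le> c" and h: "\<And>p. \<bar>h p\<bar> \<le> 1"
  shows integrable_first: "integrable R2 (\<lambda>p. V (fst p) * kp p * h p)" (is ?first)
    and integrable_second: "integrable R2 (\<lambda>p. V (fst (fst p), snd p) * kp p * h p)" (is ?second)
    and integrable_total: "integrable R2 (\<lambda>p. V (fst (fst p), snd (fst p) + snd p) * kp p * h p)" (is ?total)
proof -
  have bound: "\<bar>v * l * h p\<bar> \<le> c * (X * l)" if "\<bar>v\<bar> \<le> c * X" "0 \<le> l" for v X l p
  proof -
    have "\<bar>v\<bar> * l * \<bar>h p\<bar> \<le> (c * X) * l * 1"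
      using that h[of p] by (intro mult_mono) (auto intro: order.trans[OF abs_ge_zero])
    then show ?thesis using that by (simp add: abs_mult)
  qed
  have W1: "\<bar>V (z, y)\<bar> \<le> c * (W y + W y')" "\<bar>V (z, y')\<bar> \<le> c * (W y + W y')" for z y y'
    using V[of "(z, y)"] V[of "(z, y')"] mult_left_mono[OF _ c, of "W y" "W y + W y'"]
      mult_left_mono[OF _ c, of "W y'" "W y + W y'"] by auto
  have W2: "\<bar>V (z, y + y')\<bar> \<le> c * (W y + W y')" if "0 < y" "0 < y'" for z y y'
    using V[of "(z, y + y')"] mult_left_mono[OF W_add_le[OF that] c] by simp
  show ?first
    by (rule integrable_R2_dominated[where c = c], measurable) (use bound[OF W1(1)] in auto)
  show ?second
    by (rule integrable_R2_dominated[where c = c], measurable) (use bound[OF W1(2)] in auto)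
  show ?total
    by (rule integrable_R2_dominated[where c = c], measurable) (use bound[OF W2] in auto)
qed

text \<open>V(y+y') - V(y) - V(y') is the change of the total of V in one merger. One factor 1/2
  counts unordered pairs; the symmetrised density (g(y) + g(y')) / 2 is replaced by g(y), which is
  the same after exchange of the masses.\<close>

definition collision :: "((real \<times> (real ^ 'd)) \<times> real \<Rightarrow> real) \<Rightarrow> real"
  where "collision V = (LINT p|R2. (V (fst (fst p), snd (fst p) + snd p) - V (fst p) - V (fst (fst p), snd p)) / 2 *
    kp p * g (fst p))"

lemma collision_split:
  assumes [measurable]: "V \<in> borel_measurable phase"
    and V: "\<And>q. \<bar>V q\<bar> \<le> c * W (snd q)" and c: "0 \<le> c"
  shows "collision V = ((LINT p|R2. V (fst (fst p), snd (fst p) + snd p) * kp p * g (fst p)) -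
      (LINT p|R2. V (fst p) * kp p * g (fst p)) -
      (LINT p|R2. V (fst (fst p), snd p) * kp p * g (fst p))) / 2"
proof -
  have gm [measurable]: "(\<lambda>p. g (fst p)) \<in> borel_measurable phase2" by measurable
  note int = integrable_first[OF assms(1) gm V c g_le] integrable_second[OF assms(1) gm V c g_le]
    integrable_total[OF assms(1) gm V c g_le]
  have "collision V = (LINT p|R2. (V (fst (fst p), snd (fst p) + snd p) * kp p * g (fst p) -
      V (fst p) * kp p * g (fst p) - V (fst (fst p), snd p) * kp p * g (fst p)) / 2)"
    unfolding collision_def by (intro Bochner_Integration.integral_cong) (auto simp: field_simps)
  also have "\<dots> = (LINT p|R2. V (fst (fst p), snd (fst p) + snd p) * kp p * g (fst p) -
      V (fst p) * kp p * g (fst p) - V (fst (fst p), snd p) * kp p * g (fst p)) / 2"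
    by (rule integral_divide_zero)
  finally show ?thesis
    using int by (simp add: Bochner_Integration.integral_diff Bochner_Integration.integrable_diff)
qed

lemma collision_diff:
  assumes [measurable]: "V \<in> borel_measurable phase" "V' \<in> borel_measurable phase"
    and V: "\<And>q. \<bar>V q\<bar> \<le> c * W (snd q)" "\<And>q. \<bar>V' q\<bar> \<le> c' * W (snd q)" and c: "0 \<le> c" "0 \<le> c'"
  shows "collision (\<lambda>q. V q - V' q) = collision V - collision V'"
proof -
  have gm: "(\<lambda>p. g (fst p)) \<in> borel_measurable phase2" by measurable
  note int = integrable_first[OF assms(1) gm V(1) c(1) g_le] integrable_second[OF assms(1) gm V(1) c(1) g_le]
    integrable_total[OF assms(1) gm V(1) c(1) g_le]
    integrable_first[OF assms(2) gm V(2) c(2) g_le] integrable_second[OF assms(2) gm V(2) c(2) g_le]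
    integrable_total[OF assms(2) gm V(2) c(2) g_le]
  have d: "\<bar>V q - V' q\<bar> \<le> (c + c') * W (snd q)" for q
    using V(1)[of q] V(2)[of q] by (simp add: distrib_right)
  show ?thesis
    using int
    by (subst collision_split[OF _ d], measurable)
       (use c in \<open>simp_all add: collision_split[OF assms(1) V(1) c(1)] collision_split[OF assms(2) V(2) c(2)]
          left_diff_distrib Bochner_Integration.integral_diff field_simps\<close>)
qed

text \<open>Subtracting the two weak equations cancels the initial terms. The quadratic terms differ
  by something linear in g, and exchanging the two masses brings gain and loss into the form of
  \<open>collision\<close>.\<close>

lemma weak_difference:
  assumes \<Phi>: "test_function \<Phi>"
  shows "(LINT q|R. \<Phi> q * g q) = collision (U 0 \<Phi>)"
proof -
  define V where "V = U 0 \<Phi>"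
  have \<Phi>m [measurable]: "\<Phi> \<in> borel_measurable phase" by (rule test_functionD[OF \<Phi>])
  have Vm [measurable]: "V \<in> borel_measurable phase" unfolding V_def by (rule U_measurable[OF \<Phi>])
  have V: "\<bar>V q\<bar> \<le> T * W (snd q)" for q using U_le(1)[OF \<Phi>, of q] by (simp add: V_def)
  have e\<Phi>: "(\<lambda>q. ennreal (\<Phi> q)) \<in> borel_measurable phase" by measurable
  have supp: "ennreal (\<Phi> ((t, x), y)) = 0" if "t \<notin> {0..T}" for t x y
    using test_function_ennreal_le[OF \<Phi>, of "((t, x), y)"] that by simp
  let ?ff = "\<lambda>p. f (fst p) * f (fst (fst p), snd p)"
  let ?ee = "\<lambda>p. (1 - f (fst p)) * (1 - f (fst (fst p), snd p))"
  let ?G = "\<lambda>p. V (fst (fst p), snd (fst p) + snd p) * kp p"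
  let ?L = "\<lambda>p. V (fst p) * kp p"
  let ?L' = "\<lambda>p. V (fst (fst p), snd p) * kp p"
  have m [measurable]: "?ff \<in> borel_measurable phase2"
      "?ee \<in> borel_measurable phase2"
      "(\<lambda>p. g (fst p)) \<in> borel_measurable phase2"
      "(\<lambda>p. g (fst (fst p), snd p)) \<in> borel_measurable phase2"
    by measurable
  have b1: "\<bar>?ff p\<bar> \<le> 1" "\<bar>?ee p\<bar> \<le> 1" for p
  proof -
    have *: "\<bar>u * v\<bar> \<le> 1" if "0 \<le> u" "u \<le> 1" "0 \<le> v" "v \<le> 1" for u v :: real
      using that by (simp add: mult_le_one)
    show "\<bar>?ff p\<bar> \<le> 1" by (rule *) (rule f_bounds)+
    show "\<bar>?ee p\<bar> \<le> 1" by (rule *) (simp_all add: f_bounds)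
  qed
  have w1: "(LINT q|R. \<Phi> q * f q) + (LINT p|R2. ?L p * ?ff p) = enn2real (J (\<lambda>q. ennreal (\<Phi> q))) + (LINT p|R2. ?G p * ?ff p) / 2"
    using weak_real[OF \<Phi> f_measurable f_bounds weak1[OF e\<Phi> supp]] by (simp add: V_def mult_ac)
  have w2: "(LINT q|R. \<Phi> q * (1 - f q)) + (LINT p|R2. ?L p * ?ee p) = enn2real (J (\<lambda>q. ennreal (\<Phi> q))) + (LINT p|R2. ?G p * ?ee p) / 2"
    using weak_real[OF \<Phi> _ _ _ weak2[OF e\<Phi> supp]] f_bounds by (simp add: V_def mult_ac)
  \<comment> \<open>Writing f' and g' for the values at the second mass, f f' - (1 - f) (1 - f') = f
    + f' - 1 = (g + g') / 2.\<close>
  have diff: "(LINT p|R2. F p * ?ff p) - (LINT p|R2. F p * ?ee p) = ((LINT p|R2. F p * g (fst p)) + (LINT p|R2. F p * g (fst (fst p), snd p))) / 2"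
    if "integrable R2 (\<lambda>p. F p * ?ff p)" "integrable R2 (\<lambda>p. F p * ?ee p)"
      "integrable R2 (\<lambda>p. F p * g (fst p))" "integrable R2 (\<lambda>p. F p * g (fst (fst p), snd p))" for F
  proof -
    have "(LINT p|R2. F p * ?ff p) - (LINT p|R2. F p * ?ee p) = (LINT p|R2. F p * ?ff p - F p * ?ee p)"
      using that by (simp add: Bochner_Integration.integral_diff)
    also have "\<dots> = (LINT p|R2. (F p * g (fst p) + F p * g (fst (fst p), snd p)) / 2)"
      by (intro Bochner_Integration.integral_cong) (auto simp: g_def algebra_simps)
    also have "\<dots> = (LINT p|R2. F p * g (fst p) + F p * g (fst (fst p), snd p)) / 2"
      by (rule integral_divide_zero)
    finally show ?thesis using that by (simp add: Bochner_Integration.integral_add)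
  qed
  have dG: "(LINT p|R2. ?G p * ?ff p) - (LINT p|R2. ?G p * ?ee p) = ((LINT p|R2. ?G p * g (fst p)) + (LINT p|R2. ?G p * g (fst (fst p), snd p))) / 2"
    by (intro diff integrable_total[OF Vm _ V T] m b1 g_le)
  have dL: "(LINT p|R2. ?L p * ?ff p) - (LINT p|R2. ?L p * ?ee p) = ((LINT p|R2. ?L p * g (fst p)) + (LINT p|R2. ?L p * g (fst (fst p), snd p))) / 2"
    by (intro diff integrable_first[OF Vm _ V T] m b1 g_le)
  have sG: "(LINT p|R2. ?G p * g (fst (fst p), snd p)) = (LINT p|R2. ?G p * g (fst p))"
    using integral_swap[of "\<lambda>p. ?G p * g (fst p)"] by (simp add: extend2_commute[OF K] add.commute)
  \<comment> \<open>The loss weight depends on one mass only, so the exchange moves V to the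
    partner; the gain weight is symmetric and stays as it is.\<close>
  have sL: "(LINT p|R2. ?L p * g (fst (fst p), snd p)) = (LINT p|R2. ?L' p * g (fst p))"
    using integral_swap[of "\<lambda>p. ?L' p * g (fst p)"] by (simp add: extend2_commute[OF K])
  have "(LINT q|R. \<Phi> q * g q) = (LINT q|R. \<Phi> q * f q - \<Phi> q * (1 - f q))"
    by (intro Bochner_Integration.integral_cong) (auto simp: g_def algebra_simps)
  also have "\<dots> = (LINT q|R. \<Phi> q * f q) - (LINT q|R. \<Phi> q * (1 - f q))"
  proof (rule Bochner_Integration.integral_diff)
    have "\<bar>\<Phi> q * r\<bar> \<le> 1 * W (snd q)" if "0 \<le> r" "r \<le> 1" for q r
    proof -
      have "\<Phi> q * r \<le> W (snd q) * 1"
        using test_functionD(2,4)[OF \<Phi>] that by (intro mult_mono) auto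
      then show ?thesis using test_functionD(2)[OF \<Phi>, of q] that by simp
    qed
    then show "integrable R (\<lambda>q. \<Phi> q * f q)" "integrable R (\<lambda>q. \<Phi> q * (1 - f q))"
      using f_bounds by (intro integrable_R_dominated[where c = 1]; force)+
  qed
  also have "\<dots> = ((LINT p|R2. ?G p * ?ff p) - (LINT p|R2. ?G p * ?ee p)) / 2 - ((LINT p|R2. ?L p * ?ff p) - (LINT p|R2. ?L p * ?ee p))"
    using w1 w2 by argo
  also have "\<dots> = collision V"
    unfolding dG dL sG sL collision_split[OF Vm V T] by (simp add: field_simps)
  finally show ?thesis by (simp add: V_def)
qed

text \<open>Testing with \<Phi> and with \<Psi> = \<Lambda> U_\<Lambda> \<Phi> and subtracting, the
  functional \<open>collision\<close> is left with U_0 \<Phi> - U_0 \<Psi> = U_\<Lambda> \<Phi>. The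
  price is the term with the factor \<Lambda>, which later balances the loss rate.\<close>

lemma resolvent_difference:
  assumes \<Phi>: "test_function \<Phi>" and \<Lambda>: "0 < \<Lambda>"
  shows "(LINT q|R. \<Phi> q * g q) = \<Lambda> * (LINT q|R. U \<Lambda> \<Phi> q * g q) + collision (U \<Lambda> \<Phi>)"
proof -
  define \<Psi> where "\<Psi> q = \<Lambda> * U \<Lambda> \<Phi> q" for q
  have \<Psi>: "test_function \<Psi>" unfolding \<Psi>_def[abs_def] by (rule test_function_U[OF \<Phi> \<Lambda>])
  have "U \<Lambda> \<Phi> = (\<lambda>q. U 0 \<Phi> q - U 0 \<Psi> q)"
    using U_identity[OF \<Phi> \<Lambda>] by (simp add: \<Psi>_def[abs_def])
  then have "collision (U \<Lambda> \<Phi>) = collision (U 0 \<Phi>) - collision (U 0 \<Psi>)"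
    using collision_diff[OF U_measurable[OF \<Phi>] U_measurable[OF \<Psi>], of 0 T 0 T] U_le(1)[OF \<Phi>] U_le(1)[OF \<Psi>] T by simp
  also have "\<dots> = (LINT q|R. \<Phi> q * g q) - (LINT q|R. \<Psi> q * g q)"
    by (simp add: weak_difference \<Phi> \<Psi>)
  also have "(LINT q|R. \<Psi> q * g q) = \<Lambda> * (LINT q|R. U \<Lambda> \<Phi> q * g q)"
    by (simp add: \<Psi>_def mult.assoc)
  finally show ?thesis by simp
qed

text \<open>\<^const>\<open>enn2real\<close> returns \<open>0\<close> where the integral is infinite, which is a null set (\<open>ennreal_rate\<close>).\<close>

definition rate :: "(real \<times> (real ^ 'd)) \<times> real \<Rightarrow> real"
  where "rate q = enn2real (\<integral>\<^sup>+ y'. ennreal (k (snd q) y' / 2) \<partial>\<rho> (fst q))"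

lemma moment_kernel_second_pair: "moment_kernel phase (\<lambda>q. \<rho> (fst q))"
  by (rule moment_kernel_compose[OF \<rho>]) measurable

lemma rate_nn_measurable: "(\<lambda>q. \<integral>\<^sup>+ y'. ennreal (k (snd q) y' / 2) \<partial>\<rho> (fst q)) \<in> borel_measurable phase"
  using moment_kernel_measurable_pair[OF moment_kernel_second_pair, of "\<lambda>p. ennreal (kp p / 2)"]
  by simp

lemma rate_measurable [measurable]: "rate \<in> borel_measurable phase"
  unfolding rate_def[abs_def] using rate_nn_measurable by measurable

lemma rate_nonneg [simp]: "0 \<le> rate q"
  by (simp add: rate_def)

lemma W_finite_AE: "AE q in R. (\<integral>\<^sup>+ y. ennreal (W y) \<partial>\<rho> (fst q)) < \<infinity>"
proof -
  have m [measurable]: "(\<lambda>z. \<integral>\<^sup>+ y. ennreal (W y) \<partial>\<rho> z) \<in> borel_measurable spacetime"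
    by (rule moment_kernel_measurable[OF \<rho>]) measurable
  have "(\<integral>\<^sup>+ z. (\<integral>\<^sup>+ y. ennreal (W y) \<partial>\<rho> z) \<partial>spacetime) \<noteq> \<infinity>"
    using W_finite by (subst (asm) nn_integral_semiprod[OF \<rho>]) auto
  then have "AE z in spacetime. (\<integral>\<^sup>+ y. ennreal (W y) \<partial>\<rho> z) \<noteq> \<infinity>"
    by (intro nn_integral_PInf_AE m)
  then have "AE z in spacetime. AE y in \<rho> z. (\<integral>\<^sup>+ y. ennreal (W y) \<partial>\<rho> (fst (z, y))) < \<infinity>"
    by (elim eventually_mono) (simp add: top.not_eq_extremum)
  then show ?thesis by (subst AE_semiprod[OF \<rho>]) measurable
qed

lemma ennreal_rate: "AE q in R. ennreal (rate q) = (\<integral>\<^sup>+ y'. ennreal (k (snd q) y' / 2) \<partial>\<rho> (fst q))"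
  using W_finite_AE
proof eventually_elim
  case (elim q)
  note [measurable_cong] = sets_\<rho>[of "fst q"]
  have "(\<integral>\<^sup>+ y'. ennreal (k (snd q) y' / 2) \<partial>\<rho> (fst q)) \<le> (\<integral>\<^sup>+ y'. ennreal (W (snd q)) * ennreal (W y') \<partial>\<rho> (fst q))"
  proof (rule nn_integral_mono)
    fix y'
    have "k (snd q) y' / 2 \<le> W (snd q) * W y'" using k_le[of "snd q" y'] k_nonneg[of "snd q" y'] by linarith
    then show "ennreal (k (snd q) y' / 2) \<le> ennreal (W (snd q)) * ennreal (W y')"
      by (simp add: ennreal_mult[symmetric] ennreal_leI)
  qed
  also have "\<dots> = ennreal (W (snd q)) * (\<integral>\<^sup>+ y'. ennreal (W y') \<partial>\<rho> (fst q))"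
    by (rule nn_integral_cmult) measurable
  also have "\<dots> < \<infinity>" using elim by (simp add: ennreal_mult_less_top)
  finally show ?case by (simp add: rate_def)
qed

text \<open>Proved as an equality of measures: the pair measure weighted with K/2 projects onto
  \<open>rate\<close> times the one-particle measure. Signed integrals and integrability both follow
  from it.\<close>

lemma integral_collision_rate:
  assumes [measurable]: "(F :: _ \<Rightarrow> real) \<in> borel_measurable phase"
  shows "(LINT p|R2. kp p / 2 * F (fst p)) = (LINT q|R. rate q * F q)"
    and "integrable R2 (\<lambda>p. kp p / 2 * F (fst p)) \<longleftrightarrow> integrable R (\<lambda>q. rate q * F q)"
proof -
  have eq: "distr (density R2 (\<lambda>p. ennreal (kp p / 2))) R fst = density R (\<lambda>q. ennreal (rate q))"
  proof (rule measure_eqI)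
    fix A assume "A \<in> sets (distr (density R2 (\<lambda>p. ennreal (kp p / 2))) R fst)"
    then have A [measurable]: "A \<in> sets phase" by simp
    have "emeasure (distr (density R2 (\<lambda>p. ennreal (kp p / 2))) R fst) A
        = (\<integral>\<^sup>+ p. indicator A (fst p) * ennreal (kp p / 2) \<partial>R2)"
      by (rule emeasure_distr_density) measurable
    also have "\<dots> = (\<integral>\<^sup>+ q. (\<integral>\<^sup>+ y'. indicator A q * ennreal (k (snd q) y' / 2) \<partial>\<rho> (fst q)) \<partial>R)"
      by (subst nn_integral_semiprod[OF moment_kernel_second[OF \<rho>]]) auto
    also have "\<dots> = (\<integral>\<^sup>+ q. ennreal (rate q) * indicator A q \<partial>R)"
    proof (rule nn_integral_cong_AE, use ennreal_rate in eventually_elim)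
      case (elim q)
      note [measurable_cong] = sets_\<rho>[of "fst q"]
      have "(\<integral>\<^sup>+ y'. indicator A q * ennreal (k (snd q) y' / 2) \<partial>\<rho> (fst q)) = indicator A q * (\<integral>\<^sup>+ y'. ennreal (k (snd q) y' / 2) \<partial>\<rho> (fst q))"
        by (rule nn_integral_cmult) measurable
      then show ?case by (simp add: elim mult.commute)
    qed
    also have "\<dots> = emeasure (density R (\<lambda>q. ennreal (rate q))) A"
      by (rule emeasure_density[symmetric]) (use A in measurable)
    finally show "emeasure (distr (density R2 (\<lambda>p. ennreal (kp p / 2))) R fst) A = emeasure (density R (\<lambda>q. ennreal (rate q))) A" .
  qed simp
  have "(LINT q|R. rate q * F q) = (LINT q|density R (\<lambda>q. ennreal (rate q)). F q)"
    by (subst integral_density) auto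
  also have "\<dots> = (LINT p|density R2 (\<lambda>p. ennreal (kp p / 2)). F (fst p))"
    unfolding eq[symmetric] by (rule integral_distr) measurable
  also have "\<dots> = (LINT p|R2. kp p / 2 * F (fst p))"
    by (subst integral_density) auto
  finally show "(LINT p|R2. kp p / 2 * F (fst p)) = (LINT q|R. rate q * F q)" by simp
  have "integrable R (\<lambda>q. rate q * F q) \<longleftrightarrow> integrable (density R (\<lambda>q. ennreal (rate q))) F"
    by (subst integrable_density) auto
  also have "\<dots> \<longleftrightarrow> integrable (density R2 (\<lambda>p. ennreal (kp p / 2))) (\<lambda>p. F (fst p))"
    unfolding eq[symmetric] by (rule integrable_distr_eq) measurable
  also have "\<dots> \<longleftrightarrow> integrable R2 (\<lambda>p. kp p / 2 * F (fst p))"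
    by (subst integrable_density) auto
  finally show "integrable R2 (\<lambda>p. kp p / 2 * F (fst p)) \<longleftrightarrow> integrable R (\<lambda>q. rate q * F q)" by simp
qed

lemma rateW_integrable: "integrable R (\<lambda>q. rate q * W (snd q))"
  using integral_collision_rate(2)[of "\<lambda>q. W (snd q)"] integrable_divide_zero[OF Wk_integrable1, of 2]
  by (simp add: mult.commute)

lemma integrable_R_dominated_rate:
  assumes [measurable]: "(F :: _ \<Rightarrow> real) \<in> borel_measurable phase"
    and "\<And>q. \<bar>F q\<bar> \<le> r * ((1 + rate q) * W (snd q))"
  shows "integrable R F"
proof (rule Bochner_Integration.integrable_bound)
  show "integrable R (\<lambda>q. r * (W (snd q) + rate q * W (snd q)))"
    by (intro integrable_mult_right Bochner_Integration.integrable_add W_integrable rateW_integrable)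
  show "AE q in R. norm (F q) \<le> norm (r * (W (snd q) + rate q * W (snd q)))"
    using assms(2) by (intro AE_I2) (auto simp: distrib_right intro: order.trans[OF _ abs_ge_self])
qed measurable

text \<open>The loss term \<open>- rate * g\<close> only helps: \<open>\<bar>\<Lambda> - rate\<bar> + rate\<close> exceeds \<open>\<Lambda>\<close> only where \<open>rate > \<Lambda>\<close>.\<close>

lemma collision_bound:
  assumes [measurable]: "\<psi> \<in> borel_measurable phase" "\<eta> \<in> borel_measurable spacetime"
    and \<psi>: "\<And>z y. \<bar>\<psi> (z, y)\<bar> \<le> \<eta> z * W y" and \<eta>: "\<And>z. 0 \<le> \<eta> z" "\<And>z. \<eta> z \<le> B" and \<Lambda>: "0 < \<Lambda>"
  defines "X \<equiv> \<lambda>q. \<eta> (fst q) * W (snd q) * \<bar>g q\<bar>"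
  shows "\<Lambda> * (LINT q|R. \<psi> q * g q) + collision \<psi> \<le>
    (\<Lambda> + \<beta>) * (LINT q|R. X q) + 2 * (LINT q|R. X q * max 0 (rate q - \<Lambda>))"
proof -
  have Xm [measurable]: "X \<in> borel_measurable phase" unfolding X_def by measurable
  have B: "0 \<le> B" using \<eta>[of undefined] by simp
  have \<psi>B: "\<bar>\<psi> q\<bar> \<le> B * W (snd q)" for q
    using \<psi>[of "fst q" "snd q"] mult_right_mono[OF \<eta>(2)[of "fst q"] W_nonneg[of "snd q"]] by simp
  have X0: "0 \<le> X q" for q using \<eta>(1) by (simp add: X_def)
  have XB: "X q \<le> B * W (snd q)" for q
  proof -
    have "\<eta> (fst q) * W (snd q) * \<bar>g q\<bar> \<le> B * W (snd q) * 1"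
      using \<eta> B g_le by (intro mult_mono) auto
    then show ?thesis by (simp add: X_def)
  qed
  have \<psi>X: "\<bar>\<psi> q * g q\<bar> \<le> X q" for q
    using mult_right_mono[OF \<psi>[of "fst q" "snd q"], of "\<bar>g q\<bar>"] by (simp add: X_def abs_mult)
  have gm: "(\<lambda>p. g (fst p)) \<in> borel_measurable phase2" by measurable
  have int\<psi>: "integrable R (\<lambda>q. \<psi> q * g q)"
    by (rule integrable_R_dominated[where c = B]) (use order.trans[OF \<psi>X XB] in auto)
  have intX: "integrable R X"
    by (rule integrable_R_dominated[where c = B]) (use X0 XB in auto)
  have cX: "\<bar>rate q * u\<bar> \<le> B * ((1 + rate q) * W (snd q))" if "\<bar>u\<bar> \<le> X q" for q u
  proof -
    have "\<bar>rate q * u\<bar> \<le> (1 + rate q) * (B * W (snd q))"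
      using order.trans[OF that XB] by (auto simp: abs_mult intro!: mult_mono)
    then show ?thesis by (simp add: mult_ac)
  qed
  have int\<psi>c: "integrable R (\<lambda>q. rate q * (\<psi> q * g q))"
    by (rule integrable_R_dominated_rate[where r = B]) (use cX[OF \<psi>X] in auto)
  have intXc: "integrable R (\<lambda>q. rate q * X q)"
    by (rule integrable_R_dominated_rate[where r = B]) (use cX[of "X _"] X0 in auto)
  have intXm: "integrable R (\<lambda>q. X q * max 0 (rate q - \<Lambda>))"
  proof (rule Bochner_Integration.integrable_bound[OF intXc])
    show "AE q in R. norm (X q * max 0 (rate q - \<Lambda>)) \<le> norm (rate q * X q)"
    proof (rule AE_I2)
      fix q
      have "X q * max 0 (rate q - \<Lambda>) \<le> X q * rate q"
        using X0 \<Lambda> by (intro mult_left_mono) auto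
      then show "norm (X q * max 0 (rate q - \<Lambda>)) \<le> norm (rate q * X q)"
        using X0[of q] by (simp add: mult.commute)
    qed
  qed measurable
  let ?G = "LINT p|R2. \<psi> (fst (fst p), snd (fst p) + snd p) * kp p * g (fst p)"
  let ?L = "LINT p|R2. \<psi> (fst p) * kp p * g (fst p)"
  let ?L' = "LINT p|R2. \<psi> (fst (fst p), snd p) * kp p * g (fst p)"
  \<comment> \<open>The part of a collision in which the weight w sits on the partner y'. It occurs
    in the gain, through w(y+y') \<le> w(y) + w(y'), and in the loss of the partner.\<close>
  define Q where "Q p = \<eta> (fst (fst p)) * \<bar>g (fst p)\<bar> * (W (snd p) * kp p)" for p
  have Qm [measurable]: "Q \<in> borel_measurable phase2"
    unfolding Q_def[abs_def] by measurable
  have Q0: "0 \<le> Q p" for p using \<eta>(1) by (simp add: Q_def)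
  have intQ: "integrable R2 Q"
  proof (rule integrable_R2_dominated[where c = B, OF Qm])
    fix z y y'
    have "\<eta> z * \<bar>g (z, y)\<bar> * (W y' * k y y') \<le> B * 1 * ((W y + W y') * k y y')"
      using \<eta> B g_le by (intro mult_mono) (auto intro: mult_right_mono)
    then show "\<bar>Q ((z, y), y')\<bar> \<le> B * ((W y + W y') * k y y')"
      using Q0[of "((z, y), y')"] by (simp add: Q_def)
  qed
  have intXk: "integrable R2 (\<lambda>p. kp p / 2 * X (fst p))"
    using integral_collision_rate(2)[OF Xm] intXc by simp
  have L: "?L / 2 = (LINT q|R. rate q * (\<psi> q * g q))"
    using integral_collision_rate(1)[of "\<lambda>q. \<psi> q * g q"]
    by (simp add: mult_ac integral_divide_zero[symmetric] del: integral_divide_zero)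
  \<comment> \<open>Of the two summands w(y) + w(y'), the one at y gives \<open>rate\<close> times X
    after the partner is integrated out, and the one at y' gives \<open>Q\<close>.\<close>
  have G: "?G \<le> 2 * (LINT p|R2. kp p / 2 * X (fst p)) + (LINT p|R2. Q p)"
  proof -
    have i2: "integrable R2 (\<lambda>p. 2 * (kp p / 2 * X (fst p)))"
      by (intro integrable_mult_right intXk)
    have "?G \<le> (LINT p|R2. 2 * (kp p / 2 * X (fst p)) + Q p)"
    proof (rule integral_mono_AE)
      show "integrable R2 (\<lambda>p. \<psi> (fst (fst p), snd (fst p) + snd p) * kp p * g (fst p))"
        by (rule integrable_total[OF assms(1) gm \<psi>B B g_le])
      show "integrable R2 (\<lambda>p. 2 * (kp p / 2 * X (fst p)) + Q p)"
        using i2 intQ by (rule Bochner_Integration.integrable_add)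
      show "AE p in R2. \<psi> (fst (fst p), snd (fst p) + snd p) * kp p * g (fst p) \<le> 2 * (kp p / 2 * X (fst p)) + Q p"
        using AE_semiprod2_pos[OF \<rho>]
      proof eventually_elim
        case (elim p)
        have "\<bar>\<psi> (fst (fst p), snd (fst p) + snd p)\<bar> \<le> \<eta> (fst (fst p)) * (W (snd (fst p)) + W (snd p))"
          using \<psi>[of "fst (fst p)" "snd (fst p) + snd p"] mult_left_mono[OF W_add_le \<eta>(1)] elim
          by (blast intro: order.trans)
        then have "\<bar>\<psi> (fst (fst p), snd (fst p) + snd p)\<bar> * (kp p * \<bar>g (fst p)\<bar>) \<le>
            \<eta> (fst (fst p)) * (W (snd (fst p)) + W (snd p)) * (kp p * \<bar>g (fst p)\<bar>)"
          by (intro mult_right_mono) auto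
        also have "\<dots> = 2 * (kp p / 2 * X (fst p)) + Q p"
          by (simp add: X_def Q_def algebra_simps)
        finally have "\<bar>\<psi> (fst (fst p), snd (fst p) + snd p) * kp p * g (fst p)\<bar> \<le> 2 * (kp p / 2 * X (fst p)) + Q p"
          by (simp add: abs_mult mult.assoc)
        then show ?case by linarith
      qed
    qed
    also have "\<dots> = (LINT p|R2. 2 * (kp p / 2 * X (fst p))) + (LINT p|R2. Q p)"
      using i2 intQ by (rule Bochner_Integration.integral_add)
    also have "(LINT p|R2. 2 * (kp p / 2 * X (fst p))) = 2 * (LINT p|R2. kp p / 2 * X (fst p))"
      using integral_mult_right_zero[of R2 2 "\<lambda>p. kp p / 2 * X (fst p)"] by simp
    finally show ?thesis .
  qed
  have L': "- ?L' \<le> (LINT p|R2. Q p)"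
  proof -
    have i: "integrable R2 (\<lambda>p. \<psi> (fst (fst p), snd p) * kp p * g (fst p))"
      by (rule integrable_second[OF assms(1) gm \<psi>B B g_le])
    have "(LINT p|R2. - (\<psi> (fst (fst p), snd p) * kp p * g (fst p))) \<le> (LINT p|R2. Q p)"
    proof (rule integral_mono)
      fix p
      have "\<bar>\<psi> (fst (fst p), snd p)\<bar> * (kp p * \<bar>g (fst p)\<bar>) \<le> \<eta> (fst (fst p)) * W (snd p) * (kp p * \<bar>g (fst p)\<bar>)"
        by (intro mult_right_mono \<psi>) auto
      also have "\<dots> = Q p" by (simp add: Q_def mult_ac)
      finally have "\<bar>\<psi> (fst (fst p), snd p) * kp p * g (fst p)\<bar> \<le> Q p" by (simp add: abs_mult mult.assoc)
      then show "- (\<psi> (fst (fst p), snd p) * kp p * g (fst p)) \<le> Q p" by linarith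
    qed (use i intQ in auto)
    then show ?thesis by simp
  qed
  have Q: "(LINT p|R2. Q p) \<le> \<beta> * (LINT q|R. X q)"
  proof -
    have "ennreal (LINT p|R2. Q p) = (\<integral>\<^sup>+ p. ennreal (Q p) \<partial>R2)"
      using Q0 by (intro nn_integral_eq_integral[symmetric] intQ AE_I2)
    also have "\<dots> = (\<integral>\<^sup>+ p. ennreal (\<eta> (fst (fst p)) * \<bar>g (fst p)\<bar>) * ennreal (W (snd p) * kp p) \<partial>R2)"
      using \<eta>(1) by (simp add: Q_def ennreal_mult)
    also have "\<dots> \<le> ennreal \<beta> * (\<integral>\<^sup>+ q. ennreal (\<eta> (fst q) * \<bar>g q\<bar>) * ennreal (W (snd q)) \<partial>R)"
      by (rule Wk_weighted_le) measurable
    also have "(\<integral>\<^sup>+ q. ennreal (\<eta> (fst q) * \<bar>g q\<bar>) * ennreal (W (snd q)) \<partial>R) = (\<integral>\<^sup>+ q. ennreal (X q) \<partial>R)"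
      using \<eta>(1) by (simp add: X_def ennreal_mult[symmetric] mult_ac)
    also have "\<dots> = ennreal (LINT q|R. X q)"
      using X0 by (intro nn_integral_eq_integral intX AE_I2)
    also have "ennreal \<beta> * ennreal (LINT q|R. X q) = ennreal (\<beta> * (LINT q|R. X q))"
      using \<beta> X0 by (simp add: ennreal_mult Bochner_Integration.integral_nonneg)
    finally show ?thesis
      using \<beta> X0 by (subst (asm) ennreal_le_iff) (auto intro!: mult_nonneg_nonneg Bochner_Integration.integral_nonneg)
  qed
  have "collision \<psi> = (?G - ?L - ?L') / 2"
    by (rule collision_split[OF assms(1) \<psi>B B])
  \<comment> \<open>Half of \<open>Q\<close> comes from the gain and half from the loss of the
    partner; together they cost \<beta>. The loss at y itself is kept with its sign, since
    \<open>rate\<close> is unbounded and has to be balanced by \<Lambda>.\<close>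
  also have "\<dots> \<le> (LINT q|R. rate q * X q) - (LINT q|R. rate q * (\<psi> q * g q)) + \<beta> * (LINT q|R. X q)"
    using G L L' Q integral_collision_rate(1)[OF Xm] by argo
  finally have "\<Lambda> * (LINT q|R. \<psi> q * g q) + collision \<psi> \<le>
      \<Lambda> * (LINT q|R. \<psi> q * g q) - (LINT q|R. rate q * (\<psi> q * g q)) + (LINT q|R. rate q * X q) + \<beta> * (LINT q|R. X q)"
    by simp
  also have "\<Lambda> * (LINT q|R. \<psi> q * g q) - (LINT q|R. rate q * (\<psi> q * g q)) + (LINT q|R. rate q * X q)
      = (LINT q|R. \<Lambda> * (\<psi> q * g q) - rate q * (\<psi> q * g q) + rate q * X q)"
    using int\<psi> int\<psi>c intXc by simp
  also have "\<dots> \<le> (LINT q|R. \<Lambda> * X q + 2 * (X q * max 0 (rate q - \<Lambda>)))"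
  proof (rule integral_mono)
    fix q
    have "\<Lambda> * (\<psi> q * g q) - rate q * (\<psi> q * g q) = (\<Lambda> - rate q) * (\<psi> q * g q)"
      by (simp add: algebra_simps)
    also have "\<dots> \<le> \<bar>\<Lambda> - rate q\<bar> * \<bar>\<psi> q * g q\<bar>"
      unfolding abs_mult[of "\<Lambda> - rate q", symmetric] by (rule abs_ge_self)
    also have "\<dots> \<le> \<bar>\<Lambda> - rate q\<bar> * X q"
      by (intro mult_left_mono \<psi>X abs_ge_zero)
    finally have "\<Lambda> * (\<psi> q * g q) - rate q * (\<psi> q * g q) + rate q * X q \<le> (\<bar>\<Lambda> - rate q\<bar> + rate q) * X q"
      by (simp add: algebra_simps)
    also have "\<bar>\<Lambda> - rate q\<bar> + rate q = \<Lambda> + 2 * max 0 (rate q - \<Lambda>)" by (simp add: max_def abs_if)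
    finally show "\<Lambda> * (\<psi> q * g q) - rate q * (\<psi> q * g q) + rate q * X q \<le> \<Lambda> * X q + 2 * (X q * max 0 (rate q - \<Lambda>))"
      by (simp add: algebra_simps)
  qed (use int\<psi> int\<psi>c intXc intX intXm in auto)
  also have "\<dots> = \<Lambda> * (LINT q|R. X q) + 2 * (LINT q|R. X q * max 0 (rate q - \<Lambda>))"
    using intX intXm by simp
  finally show ?thesis by (simp add: algebra_simps)
qed

section \<open>Vanishing of the weighted difference\<close>

lemma g_eq_0: "AE q in R. g q = 0"
proof -
  \<comment> \<open>With \<gamma> = \<beta> + 1 the factors \<Lambda> + \<gamma> and \<Lambda> +
    \<beta> differ by 1, so the estimate leaves exactly S on the left.\<close>
  define \<gamma> where "\<gamma> = \<beta> + 1"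
  have \<gamma>: "0 < \<gamma>" using \<beta> by (simp add: \<gamma>_def)
  define e :: "real \<times> (real ^ 'd) \<Rightarrow> real" where "e z = exp (- \<gamma> * fst z) * indicator {0..T} (fst z)" for z
  have e: "0 \<le> e z" "e z \<le> 1" for z
    using \<gamma> by (auto simp: e_def indicator_def)
  have em [measurable]: "e \<in> borel_measurable spacetime" unfolding e_def[abs_def] by measurable
  \<comment> \<open>Test functions are nonnegative, so exp (- \<gamma> t) w sgn g is tested through
    its positive and negative parts.\<close>
  define \<Phi>1 where "\<Phi>1 q = e (fst q) * W (snd q) * indicator {q. 0 < g q} q" for q
  define \<Phi>2 where "\<Phi>2 q = e (fst q) * W (snd q) * indicator {q. g q < 0} q" for q
  define X where "X q = e (fst q) * W (snd q) * \<bar>g q\<bar>" for q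
  define S where "S = (LINT q|R. X q)"
  have sets: "{q. 0 < g q} \<in> sets phase" "{q. g q < 0} \<in> sets phase"
  proof -
    have "{q \<in> space phase. 0 < g q} \<in> sets phase"
      "{q \<in> space phase. g q < 0} \<in> sets phase" by measurable
    then show "{q. 0 < g q} \<in> sets phase" "{q. g q < 0} \<in> sets phase"
      by (simp_all add: space_pair_measure)
  qed
  note [measurable] = sets
  have [measurable]: "\<Phi>1 \<in> borel_measurable phase" "\<Phi>2 \<in> borel_measurable phase"
      "X \<in> borel_measurable phase"
    unfolding \<Phi>1_def[abs_def] \<Phi>2_def[abs_def] X_def[abs_def] by measurable
  have eW: "e (fst q) * W (snd q) \<le> W (snd q) * indicator {0..T} (fst (fst q))" for q
    using e(2)[of "fst q"] by (cases "fst (fst q) \<in> {0..T}") (auto simp: e_def intro!: mult_left_le_one_le)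
  have e\<Phi>: "0 \<le> \<Phi>1 q" "\<Phi>1 q \<le> e (fst q) * W (snd q)" "0 \<le> \<Phi>2 q" "\<Phi>2 q \<le> e (fst q) * W (snd q)" for q
    using e(1)[of "fst q"] by (auto simp: \<Phi>1_def \<Phi>2_def indicator_def)
  have test: "test_function \<Phi>1" "test_function \<Phi>2"
    unfolding test_function_def using e\<Phi> order.trans[OF e\<Phi>(2) eW] order.trans[OF e\<Phi>(4) eW] by auto
  have XW: "0 \<le> X q" "X q \<le> 1 * W (snd q)" for q
  proof -
    show "0 \<le> X q" using e by (simp add: X_def)
    have "e (fst q) * W (snd q) * \<bar>g q\<bar> \<le> 1 * W (snd q) * 1"
      using e g_le by (intro mult_mono) auto
    then show "X q \<le> 1 * W (snd q)" by (simp add: X_def)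
  qed
  have intX: "integrable R X"
    by (rule integrable_R_dominated[where c = 1]) (use XW in auto)
  have int\<Phi>: "integrable R (\<lambda>q. \<Phi> q * g q)" if "test_function \<Phi>" for \<Phi>
  proof (rule integrable_R_dominated[where c = 1])
    show "(\<lambda>q. \<Phi> q * g q) \<in> borel_measurable phase"
      using test_functionD(1)[OF that] by measurable
    show "\<bar>\<Phi> q * g q\<bar> \<le> 1 * W (snd q)" for q
      using mult_mono[OF test_functionD(4)[OF that, of q] g_le[of q]] test_functionD(2)[OF that, of q]
      by (simp add: abs_mult)
  qed
  have S_le: "S \<le> 2 * (LINT q|R. W (snd q) * max 0 (rate q - \<Lambda>))" if \<Lambda>: "0 < \<Lambda>" for \<Lambda>
  proof -
    define \<eta> where "\<eta> z = e z / (\<Lambda> + \<gamma>)" for z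
    have [measurable]: "\<eta> \<in> borel_measurable spacetime" unfolding \<eta>_def[abs_def] by measurable
    have \<eta>: "0 \<le> \<eta> z" "\<eta> z \<le> 1 / (\<Lambda> + \<gamma>)" for z
      using e \<Lambda> \<gamma> by (auto simp: \<eta>_def divide_right_mono)
    have U\<eta>: "U \<Lambda> \<Phi> (z, y) \<le> \<eta> z * W y" if \<Phi>: "test_function \<Phi>" and le: "\<And>q. \<Phi> q \<le> e (fst q) * W (snd q)" for \<Phi> z y
    proof (cases "fst z \<in> {0..T}")
      case True
      have "ennreal (U \<Lambda> \<Phi> (z, y)) \<le>
          resolvent b \<Lambda> (\<lambda>q. (ennreal (exp (- \<gamma> * fst (fst q))) * indicator {0..T} (fst (fst q))) * ennreal (W (snd q))) ((fst z, snd z), y)"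
        unfolding ennreal_U[OF \<Phi> less_imp_le[OF \<Lambda>]] prod.collapse
      proof (rule resolvent_mono)
        fix z' :: "real \<times> (real ^ 'd)"
        have "ennreal (\<Phi> (z', snd (z, y))) \<le> ennreal (e z' * W y)" using le[of "(z', y)"] by (auto intro: ennreal_leI)
        also have "\<dots> = (ennreal (exp (- \<gamma> * fst z')) * indicator {0..T} (fst z')) * ennreal (W y)"
          by (auto simp: e_def indicator_def ennreal_mult)
        finally show "ennreal (\<Phi> (z', snd (z, y))) \<le> (ennreal (exp (- \<gamma> * fst (fst (z', snd (z, y))))) *
            indicator {0..T} (fst (fst (z', snd (z, y))))) * ennreal (W (snd (z', snd (z, y))))" by simp
      qed
      also have "\<dots> \<le> ennreal (exp (- \<gamma> * fst z) / (\<Lambda> + \<gamma>)) * ennreal (W y)"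
        using \<Lambda> \<gamma> by (intro resolvent_exp_weight) auto
      also have "\<dots> = ennreal (\<eta> z * W y)"
        using True \<Lambda> \<gamma> by (subst ennreal_mult[symmetric]) (auto simp: \<eta>_def e_def)
      finally show ?thesis
        using \<eta>(1) by (subst (asm) ennreal_le_iff) auto
    next
      case False
      then show ?thesis using U_support[OF \<Phi>, of "(z, y)"] \<eta>(1) by simp
    qed
    define \<psi> where "\<psi> q = U \<Lambda> \<Phi>1 q - U \<Lambda> \<Phi>2 q" for q
    note [measurable] = U_measurable[OF test(1)] U_measurable[OF test(2)]
    have \<psi>m [measurable]: "\<psi> \<in> borel_measurable phase"
      unfolding \<psi>_def[abs_def] by measurable
    \<comment> \<open>Both resolvents lie between 0 and \<eta> w, so their difference obeys the same
      bound with no factor 2.\<close>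
    have \<psi>: "\<bar>\<psi> (z, y)\<bar> \<le> \<eta> z * W y" for z y
      using U\<eta>[OF test(1) e\<Phi>(2), of z y] U\<eta>[OF test(2) e\<Phi>(4), of z y] U_nonneg[of \<Lambda> \<Phi>1 "(z, y)"] U_nonneg[of \<Lambda> \<Phi>2 "(z, y)"]
      unfolding \<psi>_def by linarith
    have UW: "\<bar>U \<Lambda> \<Phi> q\<bar> \<le> (1 / \<Lambda>) * W (snd q)" if "test_function \<Phi>" for \<Phi> q
      using U_le(2)[OF that \<Lambda>, of q] \<Lambda> by (simp add: field_simps)
    have intU: "integrable R (\<lambda>q. U \<Lambda> \<Phi> q * g q)" if "test_function \<Phi>" for \<Phi>
      using integrable_divide_zero[OF int\<Phi>[OF test_function_U[OF that \<Lambda>]], of \<Lambda>] \<Lambda> by simp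
    have "S = (LINT q|R. \<Phi>1 q * g q - \<Phi>2 q * g q)"
      unfolding S_def by (intro Bochner_Integration.integral_cong) (auto simp: X_def \<Phi>1_def \<Phi>2_def indicator_def abs_if)
    also have "\<dots> = (LINT q|R. \<Phi>1 q * g q) - (LINT q|R. \<Phi>2 q * g q)"
      using int\<Phi>[OF test(1)] int\<Phi>[OF test(2)] by simp
    also have "\<dots> = \<Lambda> * ((LINT q|R. U \<Lambda> \<Phi>1 q * g q) - (LINT q|R. U \<Lambda> \<Phi>2 q * g q)) + (collision (U \<Lambda> \<Phi>1) - collision (U \<Lambda> \<Phi>2))"
      unfolding resolvent_difference[OF test(1) \<Lambda>] resolvent_difference[OF test(2) \<Lambda>] by (simp add: algebra_simps)
    also have "collision (U \<Lambda> \<Phi>1) - collision (U \<Lambda> \<Phi>2) = collision \<psi>"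
      unfolding \<psi>_def[abs_def] using \<Lambda>
      by (intro collision_diff[symmetric, where c = "1 / \<Lambda>" and c' = "1 / \<Lambda>"] U_measurable test UW) auto
    also have "(LINT q|R. U \<Lambda> \<Phi>1 q * g q) - (LINT q|R. U \<Lambda> \<Phi>2 q * g q) = (LINT q|R. \<psi> q * g q)"
      using intU[OF test(1)] intU[OF test(2)] by (simp add: \<psi>_def left_diff_distrib)
    also have "\<Lambda> * (LINT q|R. \<psi> q * g q) + collision \<psi> \<le>
      (\<Lambda> + \<beta>) * (LINT q|R. \<eta> (fst q) * W (snd q) * \<bar>g q\<bar>) + 2 * (LINT q|R. \<eta> (fst q) * W (snd q) * \<bar>g q\<bar> * max 0 (rate q - \<Lambda>))"
      by (rule collision_bound[OF \<psi>m _ \<psi> \<eta> \<Lambda>]) measurable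
    also have "(LINT q|R. \<eta> (fst q) * W (snd q) * \<bar>g q\<bar>) = S / (\<Lambda> + \<gamma>)"
      unfolding S_def integral_divide_zero[symmetric] by (intro Bochner_Integration.integral_cong) (auto simp: X_def \<eta>_def)
    also have "(LINT q|R. \<eta> (fst q) * W (snd q) * \<bar>g q\<bar> * max 0 (rate q - \<Lambda>)) = (LINT q|R. X q * max 0 (rate q - \<Lambda>)) / (\<Lambda> + \<gamma>)"
      unfolding integral_divide_zero[symmetric] by (intro Bochner_Integration.integral_cong) (auto simp: X_def \<eta>_def)
    also have "(\<Lambda> + \<beta>) * (S / (\<Lambda> + \<gamma>)) + 2 * ((LINT q|R. X q * max 0 (rate q - \<Lambda>)) / (\<Lambda> + \<gamma>))
        = ((\<Lambda> + \<beta>) * S + 2 * (LINT q|R. X q * max 0 (rate q - \<Lambda>))) / (\<Lambda> + \<gamma>)"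
      by (simp only: add_divide_distrib times_divide_eq_right)
    finally have "S * (\<Lambda> + \<gamma>) \<le> (\<Lambda> + \<beta>) * S + 2 * (LINT q|R. X q * max 0 (rate q - \<Lambda>))"
      by (simp only: pos_le_divide_eq[OF add_pos_pos[OF \<Lambda> \<gamma>]])
    then have "S \<le> 2 * (LINT q|R. X q * max 0 (rate q - \<Lambda>))"
      unfolding \<gamma>_def distrib_left distrib_right by (simp add: mult.commute)
    also have "(LINT q|R. X q * max 0 (rate q - \<Lambda>)) \<le> (LINT q|R. W (snd q) * max 0 (rate q - \<Lambda>))"
    proof (rule integral_mono)
      have le: "\<bar>u * max 0 (rate q - \<Lambda>)\<bar> \<le> 1 * ((1 + rate q) * W (snd q))" if "0 \<le> u" "u \<le> W (snd q)" for u q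
      proof -
        have "u * max 0 (rate q - \<Lambda>) \<le> W (snd q) * (1 + rate q)"
          using that \<Lambda> by (intro mult_mono) auto
        then show ?thesis using that by (simp add: mult.commute)
      qed
      show "integrable R (\<lambda>q. X q * max 0 (rate q - \<Lambda>))"
        by (rule integrable_R_dominated_rate[where r = 1], measurable, rule le) (use XW in auto)
      show "integrable R (\<lambda>q. W (snd q) * max 0 (rate q - \<Lambda>))"
        by (rule integrable_R_dominated_rate[where r = 1], measurable, rule le) auto
      show "X q * max 0 (rate q - \<Lambda>) \<le> W (snd q) * max 0 (rate q - \<Lambda>)" for q
        using XW[of q] by (intro mult_right_mono) auto
    qed
    finally show ?thesis by simp
  qed
  \<comment> \<open>\<open>rate\<close> is finite at every point, so the excess over \<Lambda> = n+1
    is eventually 0; it is dominated by the integrable function \<open>rate\<close> times w.\<close>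
  have "(\<lambda>n. LINT q|R. W (snd q) * max 0 (rate q - real (Suc n))) \<longlonglongrightarrow> (LINT q|R. 0)"
  proof (rule integral_dominated_convergence)
    show "integrable R (\<lambda>q. rate q * W (snd q))" by (rule rateW_integrable)
    show "AE q in R. (\<lambda>n. W (snd q) * max 0 (rate q - real (Suc n))) \<longlonglongrightarrow> 0"
    proof (rule AE_I2)
      fix q
      obtain N :: nat where N: "rate q < real N" using reals_Archimedean2 by blast
      have "\<forall>\<^sub>F n in sequentially. W (snd q) * max 0 (rate q - real (Suc n)) = 0"
        using eventually_ge_at_top[of N] by eventually_elim (use N in auto)
      then show "(\<lambda>n. W (snd q) * max 0 (rate q - real (Suc n))) \<longlonglongrightarrow> 0"
        by (rule tendsto_eventually)
    qed
    show "AE q in R. norm (W (snd q) * max 0 (rate q - real (Suc n))) \<le> rate q * W (snd q)" for n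
    proof (rule AE_I2)
      fix q
      have "W (snd q) * max 0 (rate q - real (Suc n)) \<le> W (snd q) * rate q"
        by (intro mult_left_mono) auto
      then show "norm (W (snd q) * max 0 (rate q - real (Suc n))) \<le> rate q * W (snd q)" by (simp add: mult.commute)
    qed
  qed measurable
  then have "(\<lambda>n. 2 * (LINT q|R. W (snd q) * max 0 (rate q - real (Suc n)))) \<longlonglongrightarrow> 2 * 0"
    by (intro tendsto_mult tendsto_const) simp
  then have "S \<le> 2 * 0"
    by (rule LIMSEQ_le_const) (use S_le in auto)
  moreover have "0 \<le> S" unfolding S_def using XW by (intro Bochner_Integration.integral_nonneg) auto
  ultimately have "(LINT q|R. X q) = 0" by (simp add: S_def)
  then have "AE q in R. X q = 0"
    using XW by (subst (asm) integral_nonneg_eq_0_iff_AE[OF intX]) auto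
  then show ?thesis
    using time_support AE_semiprod_pos[OF \<rho>]
  proof eventually_elim
    case (elim q)
    then show ?case using w_pos[of "snd q"] by (auto simp: X_def e_def W_eq)
  qed
qed

end

section \<open>Disintegration of densities\<close>

text \<open>An open half-line is the increasing union of half-lines with larger end points, and a
  rational fits in between. Countably many conditions therefore suffice, as is needed under an
  almost-everywhere quantifier.\<close>

lemma emeasure_greaterThan_le_rational:
  fixes M N :: "real measure"
  assumes M: "sets M = sets borel" and N: "sets N = sets borel"
    and eq: "\<And>q. q \<in> \<rat> \<Longrightarrow> emeasure M {q<..} = emeasure N {q<..}"
  shows "emeasure M {x<..} \<le> emeasure N {x<..}"
proof -
  let ?A = "\<lambda>n. {x + 1 / real (Suc n)<..}"
  have inc: "incseq ?A"
  proof (rule incseq_SucI)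
    fix n
    have "1 / real (Suc (Suc n)) \<le> 1 / real (Suc n)" by (rule divide_left_mono) auto
    then show "?A n \<le> ?A (Suc n)" by (auto simp del: of_nat_Suc)
  qed
  have un: "(\<Union>n. ?A n) = {x<..}"
  proof (intro antisym subsetI)
    fix u assume "u \<in> {x<..}"
    then obtain n where "1 / real (Suc n) < u - x"
      using reals_Archimedean[of "u - x"] by (auto simp: inverse_eq_divide)
    then have "u \<in> ?A n" by simp
    then show "u \<in> (\<Union>n. ?A n)" by blast
  next
    fix u assume "u \<in> (\<Union>n. ?A n)"
    then obtain n where "x + 1 / real (Suc n) < u" by blast
    moreover have "0 < 1 / real (Suc n)" by simp
    ultimately show "u \<in> {x<..}" unfolding greaterThan_iff by linarith
  qed
  have "emeasure M {x<..} = (SUP n. emeasure M (?A n))"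
  proof -
    have "?A n \<in> sets M" for n unfolding M by (rule borel_open[OF open_greaterThan])
    then have "range ?A \<subseteq> sets M" by blast
    from SUP_emeasure_incseq[OF this inc] show ?thesis unfolding un by (rule sym)
  qed
  also have "\<dots> \<le> emeasure N {x<..}"
  proof (rule SUP_least)
    fix n
    obtain q where q: "q \<in> \<rat>" "x < q" "q < x + 1 / real (Suc n)"
      using Rats_dense_in_real[of x "x + 1 / real (Suc n)"] by auto
    have "emeasure M (?A n) \<le> emeasure M {q<..}"
      using q M by (intro emeasure_mono) auto
    also have "\<dots> = emeasure N {q<..}" by (rule eq[OF q(1)])
    also have "\<dots> \<le> emeasure N {x<..}"
      using q N by (intro emeasure_mono) auto
    finally show "emeasure M (?A n) \<le> emeasure N {x<..}" .
  qed
  finally show ?thesis .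
qed

text \<open>Uniqueness of disintegration. The fibres may be infinite, so they are weighted by y,
  which makes them finite and determined by their values on half-lines. For each rational end point,
  uniqueness of densities over X gives equality off a null set of z; the union of these sets is
  null. Dividing by y > 0 removes the weight.\<close>

lemma semiprod_density_disintegrate:
  assumes "sigma_finite_measure X" and \<kappa>: "moment_kernel X \<kappa>" and \<kappa>': "moment_kernel X \<kappa>'"
    and g [measurable]: "g \<in> borel_measurable (X \<Otimes>\<^sub>M borel)" and g1: "\<And>q. g q \<le> (1::ennreal)"
    and eq: "semiprod X \<kappa>' = density (semiprod X \<kappa>) g"
  shows "AE z in X. \<kappa>' z = density (\<kappa> z) (\<lambda>y. g (z, y))"
proof -
  interpret X: sigma_finite_measure X by fact
  let ?h1 = "\<lambda>q z. \<integral>\<^sup>+ y. ennreal y * indicator {q<..} y \<partial>\<kappa>' z"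
  let ?h2 = "\<lambda>q z. \<integral>\<^sup>+ y. g (z, y) * (ennreal y * indicator {q<..} y) \<partial>\<kappa> z"
  have "AE z in X. ?h1 q z = ?h2 q z" for q
  proof (rule X.density_unique)
    show m1: "?h1 q \<in> borel_measurable X"
      by (rule moment_kernel_measurable[OF \<kappa>']) measurable
    show m2: "?h2 q \<in> borel_measurable X"
      using moment_kernel_measurable_pair[OF \<kappa>, of "\<lambda>p. g p * (ennreal (snd p) * indicator {q<..} (snd p))"] by simp
    show "density X (?h1 q) = density X (?h2 q)"
    proof (rule measure_eqI)
      fix B assume "B \<in> sets (density X (?h1 q))"
      then have B [measurable]: "B \<in> sets X" by simp
      let ?F = "\<lambda>p. ennreal (snd p) * indicator {q<..} (snd p) * indicator B (fst p)"
      have "emeasure (density X (?h1 q)) B = (\<integral>\<^sup>+ z. ?h1 q z * indicator B z \<partial>X)"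
        by (rule emeasure_density[OF m1 B])
      also have "\<dots> = (\<integral>\<^sup>+ z. (\<integral>\<^sup>+ y. ?F (z, y) \<partial>\<kappa>' z) \<partial>X)"
      proof (rule nn_integral_cong)
        fix z assume z: "z \<in> space X"
        note [measurable_cong] = moment_kernelD(1)[OF \<kappa>' z]
        show "?h1 q z * indicator B z = (\<integral>\<^sup>+ y. ?F (z, y) \<partial>\<kappa>' z)"
          unfolding fst_conv snd_conv by (rule nn_integral_multc[symmetric]) measurable
      qed
      also have "\<dots> = (\<integral>\<^sup>+ p. ?F p \<partial>semiprod X \<kappa>')"
        by (rule nn_integral_semiprod[OF \<kappa>', symmetric]) measurable
      also have "\<dots> = (\<integral>\<^sup>+ p. g p * ?F p \<partial>semiprod X \<kappa>)"
        unfolding eq by (rule nn_integral_density) measurable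
      also have "\<dots> = (\<integral>\<^sup>+ z. (\<integral>\<^sup>+ y. g (z, y) * ?F (z, y) \<partial>\<kappa> z) \<partial>X)"
        by (rule nn_integral_semiprod[OF \<kappa>]) measurable
      also have "\<dots> = (\<integral>\<^sup>+ z. ?h2 q z * indicator B z \<partial>X)"
      proof (rule nn_integral_cong)
        fix z assume z: "z \<in> space X"
        note [measurable_cong] = moment_kernelD(1)[OF \<kappa> z]
        have [measurable]: "(\<lambda>y. g (z, y)) \<in> borel_measurable borel" using measurable_Pair2[OF g z] .
        show "(\<integral>\<^sup>+ y. g (z, y) * ?F (z, y) \<partial>\<kappa> z) = ?h2 q z * indicator B z"
          unfolding fst_conv snd_conv mult.assoc[symmetric] by (rule nn_integral_multc) measurable
      qed
      also have "\<dots> = emeasure (density X (?h2 q)) B"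
        by (rule emeasure_density[OF m2 B, symmetric])
      finally show "emeasure (density X (?h1 q)) B = emeasure (density X (?h2 q)) B" .
    qed simp
  qed
  then have "AE z in X. \<forall>q\<in>\<rat>. ?h1 q z = ?h2 q z"
    by (intro AE_ball_countable[THEN iffD2] countable_rat) auto
  then show ?thesis
    using AE_space
  proof eventually_elim
    case (elim z)
    have s: "sets (\<kappa> z) = sets borel" "sets (\<kappa>' z) = sets borel"
      using moment_kernelD(1)[OF \<kappa> elim(2)] moment_kernelD(1)[OF \<kappa>' elim(2)] .
    note [measurable_cong] = s
    have [measurable]: "(\<lambda>y. g (z, y)) \<in> borel_measurable borel" using measurable_Pair2[OF g elim(2)] .
    define M1 where "M1 = density (\<kappa>' z) ennreal"
    define M2 where "M2 = density (\<kappa> z) (\<lambda>y. g (z, y) * ennreal y)"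
    have sM: "sets M1 = sets borel" "sets M2 = sets borel" using s by (auto simp: M1_def M2_def)
    have e1: "emeasure M1 {q<..} = ?h1 q z" for q
      unfolding M1_def by (rule emeasure_density) measurable
    have e2: "emeasure M2 {q<..} = ?h2 q z" for q
    proof -
      have "emeasure M2 {q<..} = (\<integral>\<^sup>+ y. g (z, y) * ennreal y * indicator {q<..} y \<partial>\<kappa> z)"
        unfolding M2_def by (rule emeasure_density) measurable
      then show ?thesis by (simp only: mult.assoc)
    qed
    have eqQ: "emeasure M1 {q<..} = emeasure M2 {q<..}" if "q \<in> \<rat>" for q
      using elim(1) that by (simp add: e1 e2)
    have M12: "M1 = M2"
    proof (rule measure_eqI_lessThan)
      show "emeasure M1 {x<..} < \<infinity>" for x
      proof -
        have "emeasure M1 {x<..} \<le> (\<integral>\<^sup>+ y. ennreal y \<partial>\<kappa>' z)"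
          unfolding e1 by (intro nn_integral_mono) (auto simp: indicator_def)
        then show ?thesis using moment_kernelD(4)[OF \<kappa>' elim(2)] by (rule le_less_trans)
      qed
      show "emeasure M1 {x<..} = emeasure M2 {x<..}" for x
        using emeasure_greaterThan_le_rational[OF sM eqQ] emeasure_greaterThan_le_rational[OF sM(2,1) eqQ[symmetric]]
        by (intro antisym) auto
    qed (use sM in auto)
    have inv: "ennreal y * ennreal (1 / y) = 1" if "0 < y" for y
      using that by (simp add: ennreal_mult[symmetric])
    have "\<kappa>' z = density (\<kappa>' z) (\<lambda>_. 1)" by (simp add: density_1)
    also have "\<dots> = density (\<kappa>' z) (\<lambda>y. ennreal y * ennreal (1 / y))"
    proof (rule density_cong)
      show "AE y in \<kappa>' z. 1 = ennreal y * ennreal (1 / y)"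
        using moment_kernelD(3)[OF \<kappa>' elim(2)] by eventually_elim (simp only: inv)
    qed measurable
    also have "\<dots> = density M1 (\<lambda>y. ennreal (1 / y))"
      unfolding M1_def by (subst density_density_eq) auto
    also have "\<dots> = density (\<kappa> z) (\<lambda>y. g (z, y) * ennreal y * ennreal (1 / y))"
      unfolding M12 M2_def by (subst density_density_eq) auto
    also have "\<dots> = density (\<kappa> z) (\<lambda>y. g (z, y))"
    proof (rule density_cong)
      show "AE y in \<kappa> z. g (z, y) * ennreal y * ennreal (1 / y) = g (z, y)"
        using moment_kernelD(3)[OF \<kappa> elim(2)] by eventually_elim (simp only: inv mult.assoc mult_1_right)
    qed measurable
    finally show ?case .
  qed
qed

section \<open>Densities with respect to the sum of two kernels\<close>

lemma moment_kernel_sum_measure: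
  assumes \<nu>1: "moment_kernel X \<nu>1" and \<nu>2: "moment_kernel X \<nu>2"
  shows "moment_kernel X (\<lambda>z. sum_measure (\<nu>1 z) (\<nu>2 z))"
proof -
  have e: "emeasure (sum_measure (\<nu>1 z) (\<nu>2 z)) A = emeasure (\<nu>1 z) A + emeasure (\<nu>2 z) A"
    if "z \<in> space X" "A \<in> sets borel" for z A
    using moment_kernelD(1)[OF \<nu>1 that(1)] moment_kernelD(1)[OF \<nu>2 that(1)] that(2)
    by (intro emeasure_sum_measure) auto
  show ?thesis
    unfolding moment_kernel_def
  proof (intro conjI ballI)
    fix z assume z: "z \<in> space X"
    show "sets (sum_measure (\<nu>1 z) (\<nu>2 z)) = sets borel"
      using moment_kernelD(1)[OF \<nu>1 z] by simp
    show "emeasure (sum_measure (\<nu>1 z) (\<nu>2 z)) {..0} = 0"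
      using \<nu>1 \<nu>2 z by (simp add: e moment_kernel_def)
    have "pairing (\<lambda>y. y) (sum_measure (\<nu>1 z) (\<nu>2 z)) = (\<integral>\<^sup>+ y. ennreal y \<partial>\<nu>1 z) + (\<integral>\<^sup>+ y. ennreal y \<partial>\<nu>2 z)"
      unfolding pairing_def using moment_kernelD(1)[OF \<nu>1 z] moment_kernelD(1)[OF \<nu>2 z]
      by (intro nn_integral_sum_measure) (simp_all cong: measurable_cong_sets)
    also have "\<dots> < \<infinity>"
      using moment_kernelD(4)[OF \<nu>1 z] moment_kernelD(4)[OF \<nu>2 z] by simp
    finally show "pairing (\<lambda>y. y) (sum_measure (\<nu>1 z) (\<nu>2 z)) < \<infinity>" .
  next
    fix A :: "real set" assume A: "A \<in> sets borel"
    have "(\<lambda>z. emeasure (\<nu>1 z) A + emeasure (\<nu>2 z) A) \<in> borel_measurable X"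
      using \<nu>1 \<nu>2 A unfolding moment_kernel_def by (intro borel_measurable_add) blast+
    then show "(\<lambda>z. emeasure (sum_measure (\<nu>1 z) (\<nu>2 z)) A) \<in> borel_measurable X"
      by (rule measurable_cong[THEN iffD1, rotated]) (simp add: e A)
  qed
qed

lemma nn_integral_semiprod_sum_measure:
  assumes \<nu>1: "moment_kernel X \<nu>1" and \<nu>2: "moment_kernel X \<nu>2"
    and h: "h \<in> borel_measurable (X \<Otimes>\<^sub>M borel)"
  shows "(\<integral>\<^sup>+ q. h q \<partial>semiprod X (\<lambda>z. sum_measure (\<nu>1 z) (\<nu>2 z)))
    = (\<integral>\<^sup>+ q. h q \<partial>semiprod X \<nu>1) + (\<integral>\<^sup>+ q. h q \<partial>semiprod X \<nu>2)"
proof -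
  have "(\<integral>\<^sup>+ q. h q \<partial>semiprod X (\<lambda>z. sum_measure (\<nu>1 z) (\<nu>2 z)))
      = (\<integral>\<^sup>+ z. (\<integral>\<^sup>+ y. h (z, y) \<partial>sum_measure (\<nu>1 z) (\<nu>2 z)) \<partial>X)"
    by (rule nn_integral_semiprod[OF moment_kernel_sum_measure[OF \<nu>1 \<nu>2] h])
  also have "\<dots> = (\<integral>\<^sup>+ z. (\<integral>\<^sup>+ y. h (z, y) \<partial>\<nu>1 z) + (\<integral>\<^sup>+ y. h (z, y) \<partial>\<nu>2 z) \<partial>X)"
    using moment_kernelD(1)[OF \<nu>1] moment_kernelD(1)[OF \<nu>2] moment_kernel_nn_section[OF \<nu>1 h]
    by (intro nn_integral_cong nn_integral_sum_measure) auto
  also have "\<dots> = (\<integral>\<^sup>+ z. (\<integral>\<^sup>+ y. h (z, y) \<partial>\<nu>1 z) \<partial>X) + (\<integral>\<^sup>+ z. (\<integral>\<^sup>+ y. h (z, y) \<partial>\<nu>2 z) \<partial>X)"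
    by (intro nn_integral_add moment_kernel_measurable_pair \<nu>1 \<nu>2 h)
  finally show ?thesis
    by (simp add: nn_integral_semiprod[OF \<nu>1 h] nn_integral_semiprod[OF \<nu>2 h])
qed

text \<open>Radon-Nikodym is applied to the measures on the product space and disintegrated
  afterwards. This makes f jointly measurable in (z,y), which derivatives chosen fibre by fibre
  would not guarantee.\<close>

lemma common_density:
  assumes sf: "sigma_finite_measure X" and \<nu>1: "moment_kernel X \<nu>1" and \<nu>2: "moment_kernel X \<nu>2"
  defines "\<rho> \<equiv> \<lambda>z. sum_measure (\<nu>1 z) (\<nu>2 z)"
  obtains f :: "'a \<times> real \<Rightarrow> real" where "f \<in> borel_measurable (X \<Otimes>\<^sub>M borel)" "\<And>q. 0 \<le> f q" "\<And>q. f q \<le> 1"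
    "AE z in X. \<nu>1 z = density (\<rho> z) (\<lambda>y. ennreal (f (z, y)))"
    "AE z in X. \<nu>2 z = density (\<rho> z) (\<lambda>y. ennreal (1 - f (z, y)))"
proof -
  have \<rho>: "moment_kernel X \<rho>" unfolding \<rho>_def by (rule moment_kernel_sum_measure[OF \<nu>1 \<nu>2])
  let ?R = "semiprod X \<rho>" and ?R1 = "semiprod X \<nu>1" and ?R2 = "semiprod X \<nu>2"
  interpret R: sigma_finite_measure ?R by (rule sigma_finite_semiprod[OF sf \<rho>])
  have R: "emeasure ?R A = emeasure ?R1 A + emeasure ?R2 A" if "A \<in> sets (X \<Otimes>\<^sub>M borel)" for A
    using nn_integral_semiprod_sum_measure[OF \<nu>1 \<nu>2, of "indicator A"] that by (simp add: \<rho>_def)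
  have ac: "absolutely_continuous ?R ?R1" "absolutely_continuous ?R ?R2"
    unfolding absolutely_continuous_def null_sets_def using R by auto
  define f1 where "f1 = RN_deriv ?R ?R1"
  define f2 where "f2 = RN_deriv ?R ?R2"
  have [measurable]: "f1 \<in> borel_measurable (X \<Otimes>\<^sub>M borel)" "f2 \<in> borel_measurable (X \<Otimes>\<^sub>M borel)"
    using borel_measurable_RN_deriv[of ?R ?R1] borel_measurable_RN_deriv[of ?R ?R2]
    by (simp_all add: f1_def f2_def cong: measurable_cong_sets)
  have d1: "density ?R f1 = ?R1" and d2: "density ?R f2 = ?R2"
    unfolding f1_def f2_def by (auto intro!: R.density_RN_deriv ac)
  have "AE q in ?R. f1 q + f2 q = 1"
  proof (rule R.density_unique)
    show "density ?R (\<lambda>q. f1 q + f2 q) = density ?R (\<lambda>_. 1)"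
    proof (rule measure_eqI)
      fix A assume "A \<in> sets (density ?R (\<lambda>q. f1 q + f2 q))"
      then have A [measurable]: "A \<in> sets (X \<Otimes>\<^sub>M borel)" by simp
      have "emeasure (density ?R (\<lambda>q. f1 q + f2 q)) A = (\<integral>\<^sup>+ q. f1 q * indicator A q + f2 q * indicator A q \<partial>?R)"
        using A by (subst emeasure_density) (auto simp: distrib_right)
      also have "\<dots> = (\<integral>\<^sup>+ q. f1 q * indicator A q \<partial>?R) + (\<integral>\<^sup>+ q. f2 q * indicator A q \<partial>?R)"
        by (rule nn_integral_add) (use A in measurable)
      also have "\<dots> = emeasure (density ?R f1) A + emeasure (density ?R f2) A"
        using A by (simp add: emeasure_density)
      also have "\<dots> = emeasure ?R A" unfolding d1 d2 using A by (simp add: R)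
      finally show "emeasure (density ?R (\<lambda>q. f1 q + f2 q)) A = emeasure (density ?R (\<lambda>_. 1)) A"
        by (simp add: density_1)
    qed simp
  qed measurable
  then have fAE: "AE q in ?R. f1 q = ennreal (enn2real (min 1 (f1 q))) \<and> f2 q = ennreal (1 - enn2real (min 1 (f1 q)))"
  proof eventually_elim
    case (elim q)
    have le: "f1 q \<le> 1" "f2 q \<le> 1" by (simp_all add: elim[symmetric])
    then have fin: "f1 q < top" "f2 q < top" by (auto intro: le_less_trans)
    obtain u v where uv: "f1 q = ennreal u" "f2 q = ennreal v" "0 \<le> u" "0 \<le> v"
      using fin by (metis ennreal_cases less_irrefl)
    then have "ennreal (u + v) = ennreal 1" using elim by simp
    then have "u + v = 1" using uv by (subst (asm) ennreal_inj) auto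
    then show ?case using uv by (simp add: min_absorb2)
  qed
  \<comment> \<open>The truncation at 1 makes the bounds hold everywhere and changes the derivative
    only on a null set.\<close>
  define f where "f q = enn2real (min 1 (f1 q))" for q
  have [measurable]: "f \<in> borel_measurable (X \<Otimes>\<^sub>M borel)" unfolding f_def[abs_def] by measurable
  have f: "0 \<le> f q" "f q \<le> 1" for q
  proof -
    have "enn2real (min 1 (f1 q)) \<le> enn2real 1" by (rule enn2real_mono) auto
    then show "f q \<le> 1" by (simp add: f_def)
  qed (simp add: f_def)
  have "density ?R f1 = density ?R (\<lambda>q. ennreal (f q))" "density ?R f2 = density ?R (\<lambda>q. ennreal (1 - f q))"
  proof -
    have "AE q in ?R. f1 q = ennreal (f q)" "AE q in ?R. f2 q = ennreal (1 - f q)"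
      using fAE unfolding f_def by (eventually_elim, blast)+
    then show "density ?R f1 = density ?R (\<lambda>q. ennreal (f q))" "density ?R f2 = density ?R (\<lambda>q. ennreal (1 - f q))"
      by (intro density_cong; simp)+
  qed
  then have e: "?R1 = density ?R (\<lambda>q. ennreal (f q))" "?R2 = density ?R (\<lambda>q. ennreal (1 - f q))"
    using d1 d2 by auto
  show thesis
  proof (rule that[of f])
    show "AE z in X. \<nu>1 z = density (\<rho> z) (\<lambda>y. ennreal (f (z, y)))"
      by (rule semiprod_density_disintegrate[OF sf \<rho> \<nu>1 _ _ e(1)]) (use f in \<open>auto simp: ennreal_le_1\<close>)
    show "AE z in X. \<nu>2 z = density (\<rho> z) (\<lambda>y. ennreal (1 - f (z, y)))"
      by (rule semiprod_density_disintegrate[OF sf \<rho> \<nu>2 _ _ e(2)]) (use f in \<open>auto simp: ennreal_le_1\<close>)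
  qed (use f in auto)
qed

lemma nn_integral_semiprod_density:
  assumes \<kappa>: "moment_kernel X \<kappa>" and \<nu>: "moment_kernel X \<nu>"
    and g [measurable]: "g \<in> borel_measurable (X \<Otimes>\<^sub>M borel)" and F [measurable]: "F \<in> borel_measurable (X \<Otimes>\<^sub>M borel)"
    and eq: "AE z in X. \<nu> z = density (\<kappa> z) (\<lambda>y. g (z, y))"
  shows "(\<integral>\<^sup>+ q. F q \<partial>semiprod X \<nu>) = (\<integral>\<^sup>+ q. F q * g q \<partial>semiprod X \<kappa>)"
proof -
  have "(\<integral>\<^sup>+ q. F q \<partial>semiprod X \<nu>) = (\<integral>\<^sup>+ z. (\<integral>\<^sup>+ y. F (z, y) \<partial>\<nu> z) \<partial>X)"
    by (rule nn_integral_semiprod[OF \<nu> F])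
  also have "\<dots> = (\<integral>\<^sup>+ z. (\<integral>\<^sup>+ y. F (z, y) * g (z, y) \<partial>\<kappa> z) \<partial>X)"
  proof (rule nn_integral_cong_AE)
    show "AE z in X. (\<integral>\<^sup>+ y. F (z, y) \<partial>\<nu> z) = (\<integral>\<^sup>+ y. F (z, y) * g (z, y) \<partial>\<kappa> z)"
      using eq AE_space[of X]
    proof eventually_elim
      case (elim z)
      then show ?case
        using moment_kernel_nn_section[OF \<kappa> F elim(2)] moment_kernel_nn_section[OF \<kappa> g elim(2)]
        by (simp add: nn_integral_density mult.commute)
    qed
  qed
  also have "\<dots> = (\<integral>\<^sup>+ q. F q * g q \<partial>semiprod X \<kappa>)"
    by (rule nn_integral_semiprod[OF \<kappa>, symmetric]) measurable
  finally show ?thesis .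
qed

lemma nn_integral_semiprod2_density:
  assumes \<kappa>: "moment_kernel X \<kappa>" and \<nu>: "moment_kernel X \<nu>"
    and g [measurable]: "g \<in> borel_measurable (X \<Otimes>\<^sub>M borel)"
    and F [measurable]: "F \<in> borel_measurable ((X \<Otimes>\<^sub>M borel) \<Otimes>\<^sub>M borel)"
    and eq: "AE z in X. \<nu> z = density (\<kappa> z) (\<lambda>y. g (z, y))"
  shows "(\<integral>\<^sup>+ p. F p \<partial>semiprod2 X \<nu>) = (\<integral>\<^sup>+ p. F p * (g (fst p) * g (fst (fst p), snd p)) \<partial>semiprod2 X \<kappa>)"
proof -
  have "(\<integral>\<^sup>+ p. F p \<partial>semiprod2 X \<nu>) = (\<integral>\<^sup>+ z. (\<integral>\<^sup>+ y. (\<integral>\<^sup>+ y'. F ((z, y), y') \<partial>\<nu> z) \<partial>\<nu> z) \<partial>X)"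
    by (rule nn_integral_semiprod2[OF \<nu> F])
  also have "\<dots> = (\<integral>\<^sup>+ z. (\<integral>\<^sup>+ y. (\<integral>\<^sup>+ y'. F ((z, y), y') * (g (z, y) * g (z, y')) \<partial>\<kappa> z) \<partial>\<kappa> z) \<partial>X)"
  proof (rule nn_integral_cong_AE)
    show "AE z in X. (\<integral>\<^sup>+ y. (\<integral>\<^sup>+ y'. F ((z, y), y') \<partial>\<nu> z) \<partial>\<nu> z) =
        (\<integral>\<^sup>+ y. (\<integral>\<^sup>+ y'. F ((z, y), y') * (g (z, y) * g (z, y')) \<partial>\<kappa> z) \<partial>\<kappa> z)"
      using eq AE_space[of X]
    proof eventually_elim
      case (elim z)
      interpret N: sigma_finite_measure "\<kappa> z" by (rule sigma_finite_moment_kernel[OF \<kappa> elim(2)])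
      note [measurable_cong] = moment_kernelD(1)[OF \<kappa> elim(2)]
      have gz [measurable]: "(\<lambda>y. g (z, y)) \<in> borel_measurable borel" using measurable_Pair2[OF g elim(2)] .
      have Fz [measurable]: "(\<lambda>p. F ((z, fst p), snd p)) \<in> borel_measurable (borel \<Otimes>\<^sub>M borel)"
        using elim(2) by measurable
      have Fzy [measurable]: "(\<lambda>y'. F ((z, y), y')) \<in> borel_measurable borel" for y
        using elim(2) by measurable
      have m: "(\<lambda>y. \<integral>\<^sup>+ y'. F ((z, y), y') * g (z, y') \<partial>\<kappa> z) \<in> borel_measurable (\<kappa> z)"
        by (rule N.borel_measurable_nn_integral) (simp add: case_prod_beta')
      have "(\<integral>\<^sup>+ y. (\<integral>\<^sup>+ y'. F ((z, y), y') \<partial>\<nu> z) \<partial>\<nu> z) = (\<integral>\<^sup>+ y. (\<integral>\<^sup>+ y'. F ((z, y), y') * g (z, y') \<partial>\<kappa> z) \<partial>\<nu> z)"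
        unfolding elim(1) by (simp add: nn_integral_density mult.commute)
      also have "\<dots> = (\<integral>\<^sup>+ y. g (z, y) * (\<integral>\<^sup>+ y'. F ((z, y), y') * g (z, y') \<partial>\<kappa> z) \<partial>\<kappa> z)"
        unfolding elim(1) by (rule nn_integral_density[OF _ m]) measurable
      also have "\<dots> = (\<integral>\<^sup>+ y. (\<integral>\<^sup>+ y'. F ((z, y), y') * (g (z, y) * g (z, y')) \<partial>\<kappa> z) \<partial>\<kappa> z)"
      proof (rule nn_integral_cong)
        fix y
        have "g (z, y) * (\<integral>\<^sup>+ y'. F ((z, y), y') * g (z, y') \<partial>\<kappa> z) = (\<integral>\<^sup>+ y'. g (z, y) * (F ((z, y), y') * g (z, y')) \<partial>\<kappa> z)"
          by (rule nn_integral_cmult[symmetric]) measurable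
        then show "g (z, y) * (\<integral>\<^sup>+ y'. F ((z, y), y') * g (z, y') \<partial>\<kappa> z) = (\<integral>\<^sup>+ y'. F ((z, y), y') * (g (z, y) * g (z, y')) \<partial>\<kappa> z)"
          by (simp add: mult_ac)
    qed
    finally show ?case .
    qed
  qed
  also have "\<dots> = (\<integral>\<^sup>+ p. F p * (g (fst p) * g (fst (fst p), snd p)) \<partial>semiprod2 X \<kappa>)"
    by (subst nn_integral_semiprod2[OF \<kappa>]) auto
  finally show ?thesis .
qed

section \<open>Uniqueness\<close>

lemma restrict_time_measurable:
  fixes h :: "real \<times> (real ^ 'd) \<Rightarrow> ennreal"
  assumes h: "h \<in> borel_measurable (restrict_space borel {0..T} \<Otimes>\<^sub>M borel)"
  shows "(\<lambda>z. if fst z \<in> {0..T} then h z else c) \<in> borel_measurable spacetime"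
proof -
  let ?S = "restrict_space (borel \<Otimes>\<^sub>M borel) {z. fst z \<in> {0..T}} :: (real \<times> (real ^ 'd)) measure"
  have "(\<lambda>z. (fst z, snd z)) \<in> ?S \<rightarrow>\<^sub>M restrict_space borel {0..T} \<Otimes>\<^sub>M borel"
    by (intro measurable_Pair measurable_restrict_space2 measurable_restrict_space1)
       (auto simp: space_restrict_space)
  from measurable_compose[OF this h] have "h \<in> borel_measurable ?S"
    by (simp only: prod.collapse)
  then have "(\<lambda>z. if fst z \<in> {0..T} then h z else c) \<in> borel_measurable (borel \<Otimes>\<^sub>M borel)"
    by (subst measurable_If_restrict_space_iff) auto
  then show ?thesis by (simp cong: measurable_cong_sets sets_pair_measure_cong)
qed

lemma pairing_on_reals:
  assumes "sets M = sets masses" and "\<And>y. 0 < y \<Longrightarrow> f y = g y" "g \<in> borel_measurable borel"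
  shows "pairing f M = (\<integral>\<^sup>+ y. ennreal (g y) \<partial>on_reals M)"
proof -
  have "pairing f M = (\<integral>\<^sup>+ y. ennreal (g y) \<partial>M)"
    unfolding pairing_def using sets_eq_imp_space_eq[OF assms(1)] assms(2) by (intro nn_integral_cong) auto
  also have "\<dots> = (\<integral>\<^sup>+ y. ennreal (g y) \<partial>on_reals M)"
    by (rule nn_integral_on_reals[OF assms(1)]) (use assms(3) in measurable)
  finally show ?thesis .
qed

section \<open>From solutions to moment kernels\<close>

context coagulation_bound
begin

text \<open>Zero on the null set where a moment is infinite, hence sigma-finite everywhere.\<close>

definition bounded_part ::
    "real \<Rightarrow> ennreal \<Rightarrow> (real \<Rightarrow> real ^ 'd \<Rightarrow> real measure) \<Rightarrow> real \<times> (real ^ 'd) \<Rightarrow> real measure"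
  where "bounded_part T C \<mu> z =
    (if fst z \<in> {0..T} \<and> pairing (\<lambda>y. y) (\<mu> (fst z) (snd z)) < \<infinity> \<and>
        pairing (\<lambda>y. (w y)\<^sup>2) (\<mu> (fst z) (snd z)) \<le> C
     then on_reals (\<mu> (fst z) (snd z)) else null_measure borel)"

lemma time_kernels_sets:
  "\<mu> \<in> time_kernels T \<Longrightarrow> t \<in> {0..T} \<Longrightarrow> sets (\<mu> t x) = sets masses"
  by (auto simp: time_kernels_def measurable_kernel_def space_pair_measure space_restrict_space)

lemma time_kernels_pairing_measurable:
  fixes \<mu> :: "real \<Rightarrow> real ^ 'd \<Rightarrow> real measure"
  assumes \<mu>: "\<mu> \<in> time_kernels T" and f [measurable]: "f \<in> borel_measurable masses"
  shows "(\<lambda>z. pairing f (\<mu> (fst z) (snd z))) \<in> borel_measurable (restrict_space borel {0..T} \<Otimes>\<^sub>M borel)"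
  unfolding pairing_def
proof (rule kernel_nn_integral_measurable)
  show "\<And>z. z \<in> space (restrict_space borel {0..T} \<Otimes>\<^sub>M borel) \<Longrightarrow> sets (\<mu> (fst z) (snd z)) = sets masses"
    using time_kernels_sets[OF \<mu>] by (auto simp: space_pair_measure space_restrict_space)
  show "\<And>A. A \<in> sets masses \<Longrightarrow> (\<lambda>z. emeasure (\<mu> (fst z) (snd z)) A) \<in> borel_measurable (restrict_space borel {0..T} \<Otimes>\<^sub>M borel)"
    using \<mu> by (auto simp: time_kernels_def measurable_kernel_def case_prod_beta')
qed measurable

lemma identity_measurable_masses: "(\<lambda>y. y) \<in> borel_measurable masses"
  by (rule measurable_masses_borel) simp

lemma bounded_part_kernel:
  fixes \<mu> :: "real \<Rightarrow> real ^ 'd \<Rightarrow> real measure"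
  assumes \<mu>: "\<mu> \<in> time_kernels T"
  shows "moment_kernel spacetime (bounded_part T C \<mu>)"
  unfolding moment_kernel_def
proof (intro conjI ballI)
  fix z :: "real \<times> (real ^ 'd)"
  show "sets (bounded_part T C \<mu> z) = sets borel"
    by (simp add: bounded_part_def)
  have "{..0::real} \<inter> {0<..} = {}" by auto
  then show "emeasure (bounded_part T C \<mu> z) {..0} = 0"
    using time_kernels_sets[OF \<mu>] by (simp add: bounded_part_def emeasure_on_reals)
  show "pairing (\<lambda>y. y) (bounded_part T C \<mu> z) < \<infinity>"
    using pairing_on_reals[OF time_kernels_sets[OF \<mu>, of "fst z"], of "\<lambda>y. y" "\<lambda>y. y"]
    by (auto simp: bounded_part_def pairing_def)
next
  fix A :: "real set" assume A: "A \<in> sets borel"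
  let ?S = "restrict_space borel {0..T} \<Otimes>\<^sub>M borel :: (real \<times> (real ^ 'd)) measure"
  let ?good = "\<lambda>z. pairing (\<lambda>y. y) (\<mu> (fst z) (snd z)) < \<infinity> \<and> pairing (\<lambda>y. (w y)\<^sup>2) (\<mu> (fst z) (snd z)) \<le> C"
  have m: "(\<lambda>z. pairing (\<lambda>y. y) (\<mu> (fst z) (snd z))) \<in> borel_measurable ?S"
    "(\<lambda>z. pairing (\<lambda>y. (w y)\<^sup>2) (\<mu> (fst z) (snd z))) \<in> borel_measurable ?S"
    by (intro time_kernels_pairing_measurable[OF \<mu>] identity_measurable_masses borel_measurable_power w_measurable)+
  have "(\<lambda>z. emeasure (\<mu> (fst z) (snd z)) (A \<inter> {0<..})) \<in> borel_measurable ?S"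
    using \<mu> A by (auto simp: time_kernels_def measurable_kernel_def case_prod_beta' sets_masses)
  then have "(\<lambda>z. if ?good z then emeasure (\<mu> (fst z) (snd z)) (A \<inter> {0<..}) else 0) \<in> borel_measurable ?S"
    using m by measurable
  from restrict_time_measurable[OF this, of 0]
  have "(\<lambda>z. if fst z \<in> {0..T} then if ?good z then emeasure (\<mu> (fst z) (snd z)) (A \<inter> {0<..}) else 0 else 0) \<in> borel_measurable spacetime" .
  moreover have "(\<lambda>z. if fst z \<in> {0..T} then if ?good z then emeasure (\<mu> (fst z) (snd z)) (A \<inter> {0<..}) else 0 else 0)
      = (\<lambda>z. emeasure (bounded_part T C \<mu> z) A)"
    using emeasure_on_reals[OF time_kernels_sets[OF \<mu>] A] by (auto simp: bounded_part_def fun_eq_iff)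
  ultimately show "(\<lambda>z. emeasure (bounded_part T C \<mu> z) A) \<in> borel_measurable spacetime" by simp
qed

text \<open>The bound holds at every z because \<open>bounded_part\<close> discards the points where
  it fails; this turns the essential bound of the theorem into the pointwise one used above.\<close>

lemma bounded_part_square:
  assumes \<mu>: "\<mu> \<in> time_kernels T"
  shows "(\<integral>\<^sup>+ y. ennreal ((W y)\<^sup>2) \<partial>bounded_part T C \<mu> z) \<le> C"
  using pairing_on_reals[OF time_kernels_sets[OF \<mu>, of "fst z"], of "\<lambda>y. (w y)\<^sup>2" "\<lambda>y. (W y)\<^sup>2" "snd z"]
  by (auto simp: bounded_part_def W_eq)

lemma pairing_finite_AE:
  fixes \<mu> :: "real \<Rightarrow> real ^ 'd \<Rightarrow> real measure"
  assumes \<mu>: "\<mu> \<in> time_kernels T" and t: "t \<in> {0..T}"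
    and Y: "(\<integral>\<^sup>+ x. pairing (\<lambda>y. y) (\<mu> t x) \<partial>lborel) < \<infinity>"
  shows "AE x in lborel. pairing (\<lambda>y. y) (\<mu> t x) \<noteq> \<infinity>"
proof (rule nn_integral_PInf_AE)
  show "(\<lambda>x. pairing (\<lambda>y. y) (\<mu> t x)) \<in> borel_measurable lborel"
    using measurable_Pair2[OF time_kernels_pairing_measurable[OF \<mu> identity_measurable_masses], of t] t
    by (simp add: space_restrict_space)
qed (use Y in auto)

lemma bounded_part_AE_eq:
  fixes \<mu> :: "real \<Rightarrow> real ^ 'd \<Rightarrow> real measure"
  assumes \<mu>: "\<mu> \<in> time_kernels T" and t: "t \<in> {0..T}"
    and Y: "(\<integral>\<^sup>+ x. pairing (\<lambda>y. y) (\<mu> t x) \<partial>lborel) < \<infinity>"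
    and C: "AE x in lborel. pairing (\<lambda>y. (w y)\<^sup>2) (\<mu> t x) \<le> C"
  shows "AE x in lborel. bounded_part T C \<mu> (t, x) = on_reals (\<mu> t x)"
  using pairing_finite_AE[OF \<mu> t Y] C
  by eventually_elim (use t in \<open>auto simp: bounded_part_def top.not_eq_extremum\<close>)

lemma bounded_part_represents:
  fixes \<mu> :: "real \<Rightarrow> real ^ 'd \<Rightarrow> real measure"
  assumes \<mu>: "\<mu> \<in> time_kernels T"
    and Y: "\<And>t. t \<in> {0..T} \<Longrightarrow> (\<integral>\<^sup>+ x. pairing (\<lambda>y. y) (\<mu> t x) \<partial>lborel) < \<infinity>"
    and C: "\<And>t. t \<in> {0..T} \<Longrightarrow> AE x in lborel. pairing (\<lambda>y. (w y)\<^sup>2) (\<mu> t x) \<le> C"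
  shows "represents T \<mu> (bounded_part T C \<mu>)"
proof -
  let ?S = "restrict_space borel {0..T} \<Otimes>\<^sub>M borel :: (real \<times> (real ^ 'd)) measure"
  let ?good = "\<lambda>z. pairing (\<lambda>y. y) (\<mu> (fst z) (snd z)) < \<infinity> \<and> pairing (\<lambda>y. (w y)\<^sup>2) (\<mu> (fst z) (snd z)) \<le> C"
  have m: "(\<lambda>z. pairing (\<lambda>y. y) (\<mu> (fst z) (snd z))) \<in> borel_measurable ?S"
    "(\<lambda>z. pairing (\<lambda>y. (w y)\<^sup>2) (\<mu> (fst z) (snd z))) \<in> borel_measurable ?S"
    by (intro time_kernels_pairing_measurable[OF \<mu>] identity_measurable_masses borel_measurable_power w_measurable)+
  \<comment> \<open>The exceptional set is coded as a function with values 0 and 1: measurability is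
    known only over [0,T], and \<open>restrict_time_measurable\<close> extends functions.\<close>
  then have "(\<lambda>z. if ?good z then 0 else 1 :: ennreal) \<in> borel_measurable ?S"
    by measurable
  from restrict_time_measurable[OF this, of 0]
  have h [measurable]: "(\<lambda>z. if fst z \<in> {0..T} then if ?good z then 0 else 1 else 0 :: ennreal) \<in> borel_measurable spacetime" .
  \<comment> \<open>Each t has its own null set of points x. As the exceptional set is measurable,
    Fubini makes it null in space-time.\<close>
  have "AE z in spacetime. (if fst z \<in> {0..T} then if ?good z then 0 else 1 else 0 :: ennreal) = 0"
  proof (rule lborel_pair.AE_pair_measure)
    show "{z \<in> space spacetime. (if fst z \<in> {0..T} then if ?good z then 0 else 1 else 0 :: ennreal) = 0} \<in> sets spacetime"
      by measurable
    show "AE t in lborel. AE x in lborel. (if fst (t, x) \<in> {0..T} then if ?good (t, x) then 0 else 1 else 0 :: ennreal) = 0"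
    proof (rule AE_I2)
      fix t :: real
      show "AE x in lborel. (if fst (t, x) \<in> {0..T} then if ?good (t, x) then 0 else 1 else 0 :: ennreal) = 0"
      proof (cases "t \<in> {0..T}")
        case True
        show ?thesis
          using pairing_finite_AE[OF \<mu> True Y[OF True]] C[OF True]
          by eventually_elim (auto simp: top.not_eq_extremum)
      qed auto
    qed
  qed
  then have "AE z in spacetime. bounded_part T C \<mu> z = (if fst z \<in> {0..T} then on_reals (\<mu> (fst z) (snd z)) else null_measure borel)"
    by eventually_elim (auto simp: bounded_part_def split: if_splits)
  then show ?thesis
    unfolding represents_def using bounded_part_kernel[OF \<mu>] time_kernels_sets[OF \<mu>] by blast
qed

lemma bounded_part_mass_at:
  assumes \<mu>: "\<mu> \<in> time_kernels T" and t: "t \<in> {0..T}"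
  shows "(\<integral>\<^sup>+ x. (\<integral>\<^sup>+ y. ennreal y \<partial>bounded_part T C \<mu> (t, x)) \<partial>lborel) \<le> (\<integral>\<^sup>+ x. pairing (\<lambda>y. y) (\<mu> t x) \<partial>lborel)"
  using pairing_on_reals[OF time_kernels_sets[OF \<mu> t], of "\<lambda>y. y" "\<lambda>y. y"]
  by (intro nn_integral_mono) (auto simp: bounded_part_def)

lemma bounded_part_mass:
  fixes \<mu> :: "real \<Rightarrow> real ^ 'd \<Rightarrow> real measure"
  assumes \<mu>: "\<mu> \<in> time_kernels T" and T: "0 \<le> T"
    and Y: "\<And>t. t \<in> {0..T} \<Longrightarrow> (\<integral>\<^sup>+ x. pairing (\<lambda>y. y) (\<mu> t x) \<partial>lborel) \<le> B" and B: "B < \<infinity>"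
  shows "(\<integral>\<^sup>+ q. ennreal (snd q) \<partial>semiprod spacetime (bounded_part T C \<mu>)) < \<infinity>"
proof -
  note k = bounded_part_kernel[OF \<mu>, of C]
  have m: "(\<lambda>z. \<integral>\<^sup>+ y. ennreal y \<partial>bounded_part T C \<mu> z) \<in> borel_measurable spacetime"
    by (rule moment_kernel_measurable[OF k]) measurable
  have "(\<integral>\<^sup>+ q. ennreal (snd q) \<partial>semiprod spacetime (bounded_part T C \<mu>))
      = (\<integral>\<^sup>+ z. (\<integral>\<^sup>+ y. ennreal y \<partial>bounded_part T C \<mu> z) \<partial>spacetime)"
    by (subst nn_integral_semiprod[OF k]) auto
  also have "\<dots> = (\<integral>\<^sup>+ t. (\<integral>\<^sup>+ x. (\<integral>\<^sup>+ y. ennreal y \<partial>bounded_part T C \<mu> (t, x)) \<partial>lborel) \<partial>lborel)"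
    by (rule nn_integral_spacetime[OF m])
  also have "\<dots> \<le> (\<integral>\<^sup>+ t. B * indicator {0..T} t \<partial>lborel)"
  proof (rule nn_integral_mono)
    fix t :: real
    show "(\<integral>\<^sup>+ x. (\<integral>\<^sup>+ y. ennreal y \<partial>bounded_part T C \<mu> (t, x)) \<partial>lborel) \<le> B * indicator {0..T} t"
    proof (cases "t \<in> {0..T}")
      case True
      have "(\<integral>\<^sup>+ x. (\<integral>\<^sup>+ y. ennreal y \<partial>bounded_part T C \<mu> (t, x)) \<partial>lborel) \<le> (\<integral>\<^sup>+ x. pairing (\<lambda>y. y) (\<mu> t x) \<partial>lborel)"
        by (rule bounded_part_mass_at[OF \<mu> True])
      also have "\<dots> \<le> B" by (rule Y[OF True])
      finally show ?thesis using True by simp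
    next
      case False
      then have "bounded_part T C \<mu> (t, x) = null_measure borel" for x
        by (auto simp: bounded_part_def)
      then show ?thesis by simp
    qed
  qed
  also have "\<dots> = B * ennreal T" using T by (simp add: nn_integral_cmult)
  also have "\<dots> < \<infinity>" using B by (simp add: ennreal_mult_less_top)
  finally show ?thesis .
qed

section \<open>Integrability above a positive mass\<close>

lemma W_le_linear: "0 < \<delta> \<Longrightarrow> \<delta> \<le> y \<Longrightarrow> W y \<le> w \<delta> / \<delta> * y"
  using w_sublinear[unfolded sublinear_def, rule_format, of \<delta> "y / \<delta>"]
  by (simp add: W_eq mult.commute)

lemma W_le_square: "0 < \<delta> \<Longrightarrow> \<delta> \<le> y \<Longrightarrow> w \<delta> * W y \<le> (W y)\<^sup>2"
  using mono_onD[OF w_mono, of \<delta> y] w_pos[of y]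
  by (auto simp: W_eq power2_eq_square intro!: mult_right_mono)

text \<open>Above \<delta> a sublinear w is at most (w(\<delta>) / \<delta>) y, so the first moment
  controls it.\<close>

lemma W_integral_finite:
  assumes \<kappa>: "moment_kernel X \<kappa>" and \<delta>: "0 < \<delta>" and ge: "AE q in semiprod X \<kappa>. \<delta> \<le> snd q"
    and Y: "(\<integral>\<^sup>+ q. ennreal (snd q) \<partial>semiprod X \<kappa>) < \<infinity>"
  shows "(\<integral>\<^sup>+ q. ennreal (W (snd q)) \<partial>semiprod X \<kappa>) < \<infinity>"
proof -
  have "(\<integral>\<^sup>+ q. ennreal (W (snd q)) \<partial>semiprod X \<kappa>) \<le> (\<integral>\<^sup>+ q. ennreal (w \<delta> / \<delta>) * ennreal (snd q) \<partial>semiprod X \<kappa>)"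
  proof (rule nn_integral_mono_AE)
    show "AE q in semiprod X \<kappa>. ennreal (W (snd q)) \<le> ennreal (w \<delta> / \<delta>) * ennreal (snd q)"
      using ge
    proof eventually_elim
      case (elim q)
      have "ennreal (W (snd q)) \<le> ennreal (w \<delta> / \<delta> * snd q)"
        by (intro ennreal_leI W_le_linear \<delta> elim)
      then show ?case using \<delta> elim w_pos[OF \<delta>] by (subst ennreal_mult[symmetric]) auto
    qed
  qed
  also have "\<dots> = ennreal (w \<delta> / \<delta>) * (\<integral>\<^sup>+ q. ennreal (snd q) \<partial>semiprod X \<kappa>)"
    by (rule nn_integral_cmult) measurable
  also have "\<dots> < \<infinity>" using Y by (simp add: ennreal_mult_less_top)
  finally show ?thesis .
qed

lemma initial_term_finite:
  fixes \<nu>0 :: "real ^ 'd \<Rightarrow> real measure"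
  assumes \<nu>0: "moment_kernel lborel \<nu>0" and T: "0 \<le> T"
    and fin: "(\<integral>\<^sup>+ p. ennreal (W (snd p)) \<partial>semiprod lborel \<nu>0) < \<infinity>"
  shows "initial_term b \<nu>0 (\<lambda>q. ennreal (W (snd q)) * indicator {0..T} (fst (fst q))) < \<infinity>"
proof -
  interpret S: sigma_finite_measure "spacetime :: (real \<times> (real ^ 'd)) measure"
    by (rule sigma_finite_spacetime)
  interpret S0: sigma_finite_measure "semiprod lborel \<nu>0"
    using \<nu>0 by (intro sigma_finite_semiprod lborel.sigma_finite_measure_axioms)
  interpret P: pair_sigma_finite "semiprod lborel \<nu>0" "spacetime :: (real \<times> (real ^ 'd)) measure" ..
  let ?F = "\<lambda>p z. ennreal (W (snd p)) * indicator {0..T} (fst z) * ennreal (heat_density b (fst z) (fst p) (snd z) (snd p))"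
  have "initial_term b \<nu>0 (\<lambda>q. ennreal (W (snd q)) * indicator {0..T} (fst (fst q)))
      = (\<integral>\<^sup>+ p. (\<integral>\<^sup>+ z. ?F p z \<partial>spacetime) \<partial>semiprod lborel \<nu>0)"
    unfolding initial_term_def fst_conv snd_conv by (rule P.Fubini') measurable
  also have "\<dots> \<le> (\<integral>\<^sup>+ p. ennreal (W (snd p)) * ennreal T \<partial>semiprod lborel \<nu>0)"
  proof (rule nn_integral_mono)
    fix p :: "(real ^ 'd) \<times> real"
    have "(\<integral>\<^sup>+ z. ?F p z \<partial>spacetime) = (\<integral>\<^sup>+ t. (\<integral>\<^sup>+ x. ?F p (t, x) \<partial>lborel) \<partial>lborel)"
      by (rule nn_integral_spacetime) measurable
    also have "\<dots> \<le> (\<integral>\<^sup>+ t. ennreal (W (snd p)) * indicator {0..T} t \<partial>lborel)"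
    proof (rule nn_integral_mono)
      fix t :: real
      have "(\<integral>\<^sup>+ x. ?F p (t, x) \<partial>lborel) = ennreal (W (snd p)) * indicator {0..T} t *
          (\<integral>\<^sup>+ x. ennreal (heat_density b t (fst p) x (snd p)) \<partial>lborel)"
        unfolding fst_conv snd_conv by (rule nn_integral_cmult) measurable
      also have "\<dots> \<le> ennreal (W (snd p)) * indicator {0..T} t * 1"
      proof (cases "0 < t")
        case True
        then show ?thesis using nn_integral_heat_density[of b "snd p" t "fst p"] by simp
      next
        case False
        show ?thesis
        \<comment> \<open>At t = 0 the density formula contains \<open>0 powr _ = 0\<close> and the
          integral is 0; at negative times the indicator vanishes.\<close>
        proof (cases "t = 0")
          case True
          then show ?thesis by (simp add: heat_density_def)
        next
          case nz: False
          then show ?thesis using False by (simp add: indicator_def)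
        qed
      qed
      finally show "(\<integral>\<^sup>+ x. ?F p (t, x) \<partial>lborel) \<le> ennreal (W (snd p)) * indicator {0..T} t" by simp
    qed
    also have "\<dots> = ennreal (W (snd p)) * ennreal T"
      using T by (simp add: nn_integral_cmult)
    finally show "(\<integral>\<^sup>+ z. ?F p z \<partial>spacetime) \<le> ennreal (W (snd p)) * ennreal T" .
  qed
  also have "\<dots> = (\<integral>\<^sup>+ p. ennreal (W (snd p)) \<partial>semiprod lborel \<nu>0) * ennreal T"
    by (rule nn_integral_multc) measurable
  also have "\<dots> < \<infinity>" using fin by (simp add: ennreal_mult_less_top)
  finally show ?thesis .
qed

section \<open>Comparison of two solutions\<close>

lemma weak_formulation_density:
  fixes \<mu> :: "real \<Rightarrow> real ^ 'd \<Rightarrow> real measure" and \<Phi> :: "(real \<times> (real ^ 'd)) \<times> real \<Rightarrow> ennreal"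
  assumes \<nu>: "represents T \<mu> \<nu>" and \<nu>0: "represents_initial \<mu>0 \<nu>0"
    and eqn: "\<And>t. t \<in> {0..T} \<Longrightarrow> coag_diff_equation K a \<mu>0 \<mu> t"
    and \<rho>: "moment_kernel spacetime \<rho>" and h [measurable]: "h \<in> borel_measurable phase"
    and dens: "AE z in spacetime. \<nu> z = density (\<rho> z) (\<lambda>y. ennreal (h (z, y)))"
    and \<Phi> [measurable]: "\<Phi> \<in> borel_measurable phase"
    and supp: "\<And>t x y. t \<notin> {0..T} \<Longrightarrow> \<Phi> ((t, x), y) = 0"
  shows "(\<integral>\<^sup>+ q. \<Phi> q * ennreal (h q) \<partial>semiprod spacetime \<rho>) +
      (\<integral>\<^sup>+ p. resolvent b 0 \<Phi> (fst p) * ennreal (kp p) *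
        (ennreal (h (fst p)) * ennreal (h (fst (fst p), snd p))) \<partial>semiprod2 spacetime \<rho>)
      = initial_term b \<nu>0 \<Phi> + (\<integral>\<^sup>+ p. resolvent b 0 \<Phi> (fst (fst p), snd (fst p) + snd p) * ennreal (kp p / 2) *
        (ennreal (h (fst p)) * ennreal (h (fst (fst p), snd p))) \<partial>semiprod2 spacetime \<rho>)"
proof -
  have \<nu>k: "moment_kernel spacetime \<nu>" using \<nu> by (rule represents_kernel)
  have hm: "(\<lambda>q. ennreal (h q)) \<in> borel_measurable phase" by measurable
  have 1: "(\<integral>\<^sup>+ q. \<Phi> q \<partial>semiprod spacetime \<nu>) = (\<integral>\<^sup>+ q. \<Phi> q * ennreal (h q) \<partial>semiprod spacetime \<rho>)"
    by (rule nn_integral_semiprod_density[OF \<rho> \<nu>k hm \<Phi> dens])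
  have 2: "(\<integral>\<^sup>+ p. F p \<partial>semiprod2 spacetime \<nu>) =
      (\<integral>\<^sup>+ p. F p * (ennreal (h (fst p)) * ennreal (h (fst (fst p), snd p))) \<partial>semiprod2 spacetime \<rho>)"
    if "F \<in> borel_measurable phase2" for F
    by (rule nn_integral_semiprod2_density[OF \<rho> \<nu>k hm that dens])
  have "(\<integral>\<^sup>+ p. resolvent b 0 \<Phi> (fst p) * ennreal (kp p) \<partial>semiprod2 spacetime \<nu>) =
      (\<integral>\<^sup>+ p. resolvent b 0 \<Phi> (fst p) * ennreal (kp p) *
        (ennreal (h (fst p)) * ennreal (h (fst (fst p), snd p))) \<partial>semiprod2 spacetime \<rho>)"
    by (rule 2) measurable
  moreover have "(\<integral>\<^sup>+ p. resolvent b 0 \<Phi> (fst (fst p), snd (fst p) + snd p) * ennreal (kp p / 2) \<partial>semiprod2 spacetime \<nu>) =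
      (\<integral>\<^sup>+ p. resolvent b 0 \<Phi> (fst (fst p), snd (fst p) + snd p) * ennreal (kp p / 2) *
        (ennreal (h (fst p)) * ennreal (h (fst (fst p), snd p))) \<partial>semiprod2 spacetime \<rho>)"
    by (rule 2) measurable
  moreover have "(\<integral>\<^sup>+ q. \<Phi> q \<partial>semiprod spacetime \<nu>) +
      (\<integral>\<^sup>+ p. resolvent b 0 \<Phi> (fst p) * ennreal (kp p) \<partial>semiprod2 spacetime \<nu>)
    = initial_term b \<nu>0 \<Phi> + (\<integral>\<^sup>+ p. resolvent b 0 \<Phi> (fst (fst p), snd (fst p) + snd p) *
        ennreal (kp p / 2) \<partial>semiprod2 spacetime \<nu>)"
    by (rule weak_formulation[OF a_measurable K \<nu> \<nu>0 eqn \<Phi> supp])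
  ultimately show ?thesis
    by (simp only: 1)
qed

text \<open>An instance of \<open>density_pair\<close> with \<rho> = \<nu>1 + \<nu>2 and \<beta> =
  C1 + C2. The exclusion of masses below \<delta>, for both solutions and for the initial kernel,
  supplies the finiteness of the integrals of w.\<close>

lemma AE_kernels_eq:
  fixes \<mu>1 \<mu>2 :: "real \<Rightarrow> real ^ 'd \<Rightarrow> real measure"
  assumes \<nu>1: "represents T \<mu>1 \<nu>1" and \<nu>2: "represents T \<mu>2 \<nu>2" and \<nu>0: "represents_initial \<mu>0 \<nu>0"
    and eqn: "\<And>t. t \<in> {0..T} \<Longrightarrow> coag_diff_equation K a \<mu>0 \<mu>1 t"
      "\<And>t. t \<in> {0..T} \<Longrightarrow> coag_diff_equation K a \<mu>0 \<mu>2 t"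
    and loss: "loss_term_integrable K a \<mu>1 T" "loss_term_integrable K a \<mu>2 T"
    and T: "0 \<le> T" and \<delta>: "0 < \<delta>" and small: "\<And>x. emeasure (\<mu>0 x) {0<..<\<delta>} = 0"
    and C: "\<And>z. (\<integral>\<^sup>+ y. ennreal ((W y)\<^sup>2) \<partial>\<nu>1 z) \<le> C1" "C1 < \<infinity>"
      "\<And>z. (\<integral>\<^sup>+ y. ennreal ((W y)\<^sup>2) \<partial>\<nu>2 z) \<le> C2" "C2 < \<infinity>"
    and Y: "(\<integral>\<^sup>+ q. ennreal (snd q) \<partial>semiprod spacetime \<nu>1) < \<infinity>"
      "(\<integral>\<^sup>+ q. ennreal (snd q) \<partial>semiprod spacetime \<nu>2) < \<infinity>"
      "(\<integral>\<^sup>+ p. ennreal (snd p) \<partial>semiprod lborel \<nu>0) < \<infinity>"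
  shows "AE z in spacetime. \<nu>1 z = \<nu>2 z"
proof -
  have k1: "moment_kernel spacetime \<nu>1" and k2: "moment_kernel spacetime \<nu>2"
    using \<nu>1 \<nu>2 by (auto intro: represents_kernel)
  have k0: "moment_kernel lborel \<nu>0" using \<nu>0 by (simp add: represents_initial_def)
  define \<rho> where "\<rho> = (\<lambda>z. sum_measure (\<nu>1 z) (\<nu>2 z))"
  have \<rho>: "moment_kernel spacetime \<rho>" unfolding \<rho>_def by (rule moment_kernel_sum_measure[OF k1 k2])
  obtain f :: "(real \<times> (real ^ 'd)) \<times> real \<Rightarrow> real" where f: "f \<in> borel_measurable phase"
      "\<And>q. 0 \<le> f q" "\<And>q. f q \<le> 1"
    and d1: "AE z in spacetime. \<nu>1 z = density (\<rho> z) (\<lambda>y. ennreal (f (z, y)))"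
    and d2: "AE z in spacetime. \<nu>2 z = density (\<rho> z) (\<lambda>y. ennreal (1 - f (z, y)))"
    using common_density[OF sigma_finite_spacetime k1 k2] unfolding \<rho>_def by blast
  note [measurable] = f(1)
  have ge1: "AE q in semiprod spacetime \<nu>1. \<delta> \<le> snd q"
    by (rule no_small_masses[OF \<nu>1 \<nu>0 eqn(1) loss(1) T \<delta> small C(1,2) Y(1)])
  have ge2: "AE q in semiprod spacetime \<nu>2. \<delta> \<le> snd q"
    by (rule no_small_masses[OF \<nu>2 \<nu>0 eqn(2) loss(2) T \<delta> small C(3,4) Y(2)])
  have W1: "(\<integral>\<^sup>+ q. ennreal (W (snd q)) \<partial>semiprod spacetime \<nu>1) < \<infinity>"
    and W2: "(\<integral>\<^sup>+ q. ennreal (W (snd q)) \<partial>semiprod spacetime \<nu>2) < \<infinity>"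
    and W0: "(\<integral>\<^sup>+ p. ennreal (W (snd p)) \<partial>semiprod lborel \<nu>0) < \<infinity>"
    using W_integral_finite[OF k1 \<delta> ge1 Y(1)] W_integral_finite[OF k2 \<delta> ge2 Y(2)]
      W_integral_finite[OF k0 \<delta> initial_no_small_masses[OF \<nu>0 small] Y(3)] by auto
  \<comment> \<open>Outside [0,T] both summands are null measures; their \<open>sum_measure\<close>
    gives mass 0 to the line, which confines \<rho> to [0,T].\<close>
  have null: "AE z in spacetime. fst z \<in> {0..T} \<or> \<rho> z = sum_measure (null_measure borel) (null_measure borel)"
  proof -
    have "AE z in spacetime. \<nu>1 z = (if fst z \<in> {0..T} then on_reals (\<mu>1 (fst z) (snd z)) else null_measure borel)"
      "AE z in spacetime. \<nu>2 z = (if fst z \<in> {0..T} then on_reals (\<mu>2 (fst z) (snd z)) else null_measure borel)"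
      using \<nu>1 \<nu>2 by (auto simp: represents_def)
    then show ?thesis unfolding \<rho>_def by eventually_elim simp
  qed
  interpret D: density_pair K w a \<rho> f "initial_term b \<nu>0" T "enn2real (C1 + C2)"
  proof unfold_locales
    show "moment_kernel spacetime \<rho>" by (rule \<rho>)
    show "f \<in> borel_measurable phase" by (rule f)
    show "0 \<le> f q" "f q \<le> 1" for q by (rule f)+
    show "0 \<le> T" by (rule T)
    show "0 \<le> enn2real (C1 + C2)" by simp
    show "AE q in semiprod spacetime \<rho>. fst (fst q) \<in> {0..T}"
    proof (subst AE_semiprod[OF \<rho>])
      show "AE z in spacetime. AE y in \<rho> z. fst (fst (z, y)) \<in> {0..T}"
        using null
      proof eventually_elim
        case (elim z)
        have "emeasure (sum_measure (null_measure borel) (null_measure borel :: real measure)) UNIV = 0"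
          by (subst emeasure_sum_measure) auto
        then have none: "AE y in sum_measure (null_measure borel) (null_measure borel :: real measure). False"
          by (intro AE_I[of _ _ UNIV]) auto
        show ?case
        proof (cases "fst z \<in> {0..T}")
          case False
          then have eq: "\<rho> z = sum_measure (null_measure borel) (null_measure borel)" using elim by blast
          have "AE y in \<rho> z. False" unfolding eq by (rule none)
          then show ?thesis by (rule eventually_mono) simp
        qed simp
      qed
    qed measurable
    show "(\<integral>\<^sup>+ y. ennreal ((W y)\<^sup>2) \<partial>\<rho> z) \<le> ennreal (enn2real (C1 + C2))" for z
    proof -
      have s: "sets (\<nu>1 z) = sets borel" "sets (\<nu>2 z) = sets borel"
        using moment_kernelD(1)[OF k1, of z] moment_kernelD(1)[OF k2, of z] by (auto simp: space_pair_measure)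
      have "(\<integral>\<^sup>+ y. ennreal ((W y)\<^sup>2) \<partial>\<rho> z) = (\<integral>\<^sup>+ y. ennreal ((W y)\<^sup>2) \<partial>\<nu>1 z) + (\<integral>\<^sup>+ y. ennreal ((W y)\<^sup>2) \<partial>\<nu>2 z)"
        unfolding \<rho>_def using s by (intro nn_integral_sum_measure) (simp_all cong: measurable_cong_sets)
      also have "\<dots> \<le> C1 + C2" by (intro add_mono C)
      finally show ?thesis using C by simp
    qed
    show "(\<integral>\<^sup>+ q. ennreal (W (snd q)) \<partial>semiprod spacetime \<rho>) < \<infinity>"
      unfolding \<rho>_def using W1 W2 by (subst nn_integral_semiprod_sum_measure[OF k1 k2]) auto
    show "initial_term b \<nu>0 (\<lambda>q. ennreal (W (snd q)) * indicator {0..T} (fst (fst q))) < \<infinity>"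
      by (rule initial_term_finite[OF k0 T W0])
    show "initial_term b \<nu>0 \<Phi> \<le> initial_term b \<nu>0 \<Psi>" if "\<And>q. \<Phi> q \<le> \<Psi> q"
      for \<Phi> \<Psi> :: "(real \<times> (real ^ 'd)) \<times> real \<Rightarrow> ennreal"
      unfolding initial_term_def by (intro nn_integral_mono mult_right_mono that) auto
  next
    fix \<Phi> :: "(real \<times> (real ^ 'd)) \<times> real \<Rightarrow> ennreal"
    assume \<Phi>: "\<Phi> \<in> borel_measurable phase" and supp: "\<And>t x y. t \<notin> {0..T} \<Longrightarrow> \<Phi> ((t, x), y) = 0"
    show "(\<integral>\<^sup>+ q. \<Phi> q * ennreal (f q) \<partial>semiprod spacetime \<rho>) +
      (\<integral>\<^sup>+ p. resolvent b 0 \<Phi> (fst p) * ennreal (kp p) *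
        (ennreal (f (fst p)) * ennreal (f (fst (fst p), snd p))) \<partial>semiprod2 spacetime \<rho>)
      = initial_term b \<nu>0 \<Phi> + (\<integral>\<^sup>+ p. resolvent b 0 \<Phi> (fst (fst p), snd (fst p) + snd p) * ennreal (kp p / 2) *
        (ennreal (f (fst p)) * ennreal (f (fst (fst p), snd p))) \<partial>semiprod2 spacetime \<rho>)"
      by (rule weak_formulation_density[OF \<nu>1 \<nu>0 eqn(1) \<rho> f(1) d1 \<Phi> supp])
    show "(\<integral>\<^sup>+ q. \<Phi> q * ennreal (1 - f q) \<partial>semiprod spacetime \<rho>) +
      (\<integral>\<^sup>+ p. resolvent b 0 \<Phi> (fst p) * ennreal (kp p) *
        (ennreal (1 - f (fst p)) * ennreal (1 - f (fst (fst p), snd p))) \<partial>semiprod2 spacetime \<rho>)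
      = initial_term b \<nu>0 \<Phi> + (\<integral>\<^sup>+ p. resolvent b 0 \<Phi> (fst (fst p), snd (fst p) + snd p) * ennreal (kp p / 2) *
        (ennreal (1 - f (fst p)) * ennreal (1 - f (fst (fst p), snd p))) \<partial>semiprod2 spacetime \<rho>)"
      by (rule weak_formulation_density[OF \<nu>2 \<nu>0 eqn(2) \<rho> _ d2 \<Phi> supp]) measurable
  qed
  have "AE q in semiprod spacetime \<rho>. 2 * f q - 1 = 0"
    using D.g_eq_0 by (simp add: D.g_def)
  then have "AE z in spacetime. AE y in \<rho> z. 2 * f (z, y) - 1 = 0"
    by (subst (asm) AE_semiprod[OF \<rho>]) measurable
  then show ?thesis
    using d1 d2
  proof eventually_elim
    case (elim z)
    have s: "sets (\<rho> z) = sets borel"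
      using moment_kernelD(1)[OF \<rho>, of z] by (simp add: space_pair_measure)
    have fz: "(\<lambda>y. f (z, y)) \<in> borel_measurable (\<rho> z)"
      using moment_kernel_nn_section[OF \<rho>, of "\<lambda>q. ennreal (f q)" z] measurable_Pair2[OF f(1), of z]
      by (simp add: space_pair_measure measurable_cong_sets[OF s refl])
    \<comment> \<open>Vanishing of g means f = 1/2, so the two densities f and 1 - f
      coincide.\<close>
    have "density (\<rho> z) (\<lambda>y. ennreal (f (z, y))) = density (\<rho> z) (\<lambda>y. ennreal (1 - f (z, y)))"
    proof (rule density_cong)
      show "AE y in \<rho> z. ennreal (f (z, y)) = ennreal (1 - f (z, y))"
        using elim(1)
      proof eventually_elim
        case (elim y)
        then have "f (z, y) = 1 - f (z, y)" by linarith
        then show ?case by metis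
      qed
    qed (use fz in measurable)
    then show ?case using elim by simp
  qed
qed

text \<open>On masses with 1/n \<le> a \<le> n the heat kernel is at most n^d times a Gaussian of
  constant diffusivity n. The bound K \<le> w w' then factorises the two mass integrals, and the
  Gaussian integrates to one over its starting point, leaving a multiple of t. Finiteness at every
  (t,x) results, not only after integration.\<close>

lemma loss_finite_pointwise:
  fixes \<mu> :: "real \<Rightarrow> real ^ 'd \<Rightarrow> real measure"
  assumes \<nu>: "represents T \<mu> \<nu>" and C: "\<And>z. (\<integral>\<^sup>+ y. ennreal ((W y)\<^sup>2) \<partial>\<nu> z) \<le> C" "C < \<infinity>"
    and \<delta>: "0 < \<delta>" and ge: "AE q in semiprod spacetime \<nu>. \<delta> \<le> snd q"
    and t: "t \<in> {0..T}" and A: "A \<in> sets masses" and n: "1 \<le> n" and An: "\<And>y. y \<in> A \<Longrightarrow> 1 / n \<le> a y \<and> a y \<le> n"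
  shows "duhamel a t (\<lambda>s x. coag_loss K (\<mu> s x)) x A < \<infinity>"
proof -
  have \<nu>k: "moment_kernel spacetime \<nu>" using \<nu> by (rule represents_kernel)
  have [measurable]: "A \<in> sets borel" and Apos: "A \<subseteq> {0<..}" using A by (auto simp: sets_masses)
  have [simp]: "u \<in> space (borel \<Otimes>\<^sub>M borel)" for u :: "real \<times> (real ^ 'd)"
    by (simp add: space_pair_measure)
  \<comment> \<open>A bound for the integral of w: above \<delta>, monotonicity gives w \<le> w^2 /
    w(\<delta>).\<close>
  define D where "D = ennreal (1 / w \<delta>) * C"
  have D: "D < \<infinity>" using C by (simp add: D_def ennreal_mult_less_top)
  \<comment> \<open>The majorant has constant diffusivity n, so its mass argument 0 is only a
    placeholder.\<close>
  define r where "r z = ennreal (n ^ CARD('d) * resolvent_density (\<lambda>_. n) 0 0 z (t, x))" for z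
  have rm [measurable]: "r \<in> borel_measurable spacetime" unfolding r_def[abs_def] by measurable
  let ?F = "\<lambda>z y y'. indicator A y * ennreal (resolvent_density b 0 y z (t, x)) * ennreal (k y y')"
  have AEz: "AE z in spacetime. AE y in \<nu> z. \<delta> \<le> y"
    using ge by (subst (asm) AE_semiprod[OF \<nu>k]) auto
  have "duhamel a t (\<lambda>s x. coag_loss K (\<mu> s x)) x A = (\<integral>\<^sup>+ z. (\<integral>\<^sup>+ y. (\<integral>\<^sup>+ y'. ?F z y y' \<partial>\<nu> z) \<partial>\<nu> z) \<partial>spacetime)"
    using t by (subst duhamel_loss[OF a_measurable K \<nu> _ A]) (auto simp: nn_integral_semiprod2[OF \<nu>k])
  also have "\<dots> \<le> (\<integral>\<^sup>+ z. r z * (D * D) \<partial>spacetime)"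
  proof (rule nn_integral_mono_AE)
    show "AE z in spacetime. (\<integral>\<^sup>+ y. (\<integral>\<^sup>+ y'. ?F z y y' \<partial>\<nu> z) \<partial>\<nu> z) \<le> r z * (D * D)"
      using AEz
    proof eventually_elim
      case (elim z)
      have s [measurable_cong]: "sets (\<nu> z) = sets borel"
        using moment_kernelD(1)[OF \<nu>k, of z] by (simp add: space_pair_measure)
      have WD: "(\<integral>\<^sup>+ y. ennreal (W y) \<partial>\<nu> z) \<le> D"
      proof -
        have "(\<integral>\<^sup>+ y. ennreal (W y) \<partial>\<nu> z) \<le> (\<integral>\<^sup>+ y. ennreal (1 / w \<delta>) * ennreal ((W y)\<^sup>2) \<partial>\<nu> z)"
        proof (rule nn_integral_mono_AE)
          show "AE y in \<nu> z. ennreal (W y) \<le> ennreal (1 / w \<delta>) * ennreal ((W y)\<^sup>2)"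
            using elim
          proof eventually_elim
            case (elim y)
            have "W y \<le> 1 / w \<delta> * (W y)\<^sup>2"
              using W_le_square[OF \<delta> elim] w_pos[OF \<delta>] by (simp add: field_simps)
            then show ?case
              using w_pos[OF \<delta>] by (subst ennreal_mult[symmetric]) (auto intro: ennreal_leI)
          qed
        qed
        also have "\<dots> = ennreal (1 / w \<delta>) * (\<integral>\<^sup>+ y. ennreal ((W y)\<^sup>2) \<partial>\<nu> z)"
          by (rule nn_integral_cmult) measurable
        also have "\<dots> \<le> D" unfolding D_def by (intro mult_left_mono C) auto
        finally show ?thesis .
      qed
      have Fle: "?F z y y' \<le> r z * (ennreal (W y) * ennreal (W y'))" for y y'
      proof (cases "y \<in> A")
        case True
        then have "0 < y" using Apos by auto
        have rd: "resolvent_density b 0 y z (t, x) \<le> n ^ CARD('d) * resolvent_density (\<lambda>_. n) 0 0 z (t, x)"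
        proof (cases "0 \<le> fst z \<and> fst z < t")
          case ineq: True
          have "heat_density b (t - fst z) (snd z) x y \<le> n ^ CARD('d) * heat_density (\<lambda>_. n) (t - fst z) (snd z) x y"
            using An[OF True] \<open>0 < y\<close> n ineq by (intro heat_density_le_const) (auto simp: extend1_def)
          then show ?thesis using ineq by (simp add: resolvent_density_def heat_density_def)
        next
          case False
          then have "resolvent_density b 0 y z (t, x) = 0" by (auto simp: resolvent_density_def)
          then show ?thesis using n by simp
        qed
        have "?F z y y' = ennreal (resolvent_density b 0 y z (t, x)) * ennreal (k y y')"
          using True by simp
        also have "\<dots> \<le> r z * ennreal (W y * W y')"
          unfolding r_def by (intro mult_mono ennreal_leI rd k_le) auto
        finally show ?thesis by (simp add: ennreal_mult)
      qed simp
      have "(\<integral>\<^sup>+ y. (\<integral>\<^sup>+ y'. ?F z y y' \<partial>\<nu> z) \<partial>\<nu> z) \<le> (\<integral>\<^sup>+ y. (\<integral>\<^sup>+ y'. r z * ennreal (W y) * ennreal (W y') \<partial>\<nu> z) \<partial>\<nu> z)"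
        using Fle by (intro nn_integral_mono) (simp add: mult.assoc)
      also have "\<dots> = (\<integral>\<^sup>+ y. r z * (\<integral>\<^sup>+ y'. ennreal (W y') \<partial>\<nu> z) * ennreal (W y) \<partial>\<nu> z)"
      proof (rule nn_integral_cong)
        fix y
        have "(\<integral>\<^sup>+ y'. r z * ennreal (W y) * ennreal (W y') \<partial>\<nu> z) = r z * ennreal (W y) * (\<integral>\<^sup>+ y'. ennreal (W y') \<partial>\<nu> z)"
          by (rule nn_integral_cmult) measurable
        then show "(\<integral>\<^sup>+ y'. r z * ennreal (W y) * ennreal (W y') \<partial>\<nu> z) = r z * (\<integral>\<^sup>+ y'. ennreal (W y') \<partial>\<nu> z) * ennreal (W y)"
          by (simp only: mult_ac)
      qed
      also have "\<dots> = r z * (\<integral>\<^sup>+ y'. ennreal (W y') \<partial>\<nu> z) * (\<integral>\<^sup>+ y. ennreal (W y) \<partial>\<nu> z)"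
        by (rule nn_integral_cmult) measurable
      also have "\<dots> \<le> r z * D * D" by (intro mult_mono WD) auto
      finally show ?case by (simp only: mult.assoc)
    qed
  qed
  also have "\<dots> = (\<integral>\<^sup>+ z. r z \<partial>spacetime) * (D * D)"
    by (rule nn_integral_multc) measurable
  also have "\<dots> < \<infinity>"
  proof -
    have "(\<integral>\<^sup>+ z. r z \<partial>spacetime) = (\<integral>\<^sup>+ s. (\<integral>\<^sup>+ x'. r (s, x') \<partial>lborel) \<partial>lborel)"
      by (rule nn_integral_spacetime[OF rm])
    also have "\<dots> \<le> (\<integral>\<^sup>+ s. ennreal (n ^ CARD('d)) * indicator {0..t} s \<partial>lborel)"
    proof (rule nn_integral_mono)
      fix s :: real
      show "(\<integral>\<^sup>+ x'. r (s, x') \<partial>lborel) \<le> ennreal (n ^ CARD('d)) * indicator {0..t} s"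
      proof (cases "0 \<le> s \<and> s < t")
        case True
        have "(\<integral>\<^sup>+ x'. r (s, x') \<partial>lborel) = (\<integral>\<^sup>+ x'. ennreal (n ^ CARD('d)) * ennreal (heat_density (\<lambda>_. n) (t - s) x' x 0) \<partial>lborel)"
          using True n by (simp add: r_def resolvent_density_def ennreal_mult)
        also have "\<dots> = ennreal (n ^ CARD('d)) * (\<integral>\<^sup>+ x'. ennreal (heat_density (\<lambda>_. n) (t - s) x' x 0) \<partial>lborel)"
          by (rule nn_integral_cmult) measurable
        also have "\<dots> = ennreal (n ^ CARD('d))"
          using nn_integral_heat_density'[of "\<lambda>_. n" 0 "t - s" x] True n by simp
        finally show ?thesis using True by simp
      next
        case False
        then have "r (s, x') = 0" for x' by (auto simp: r_def resolvent_density_def)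
        then show ?thesis by simp
      qed
    qed
    also have "\<dots> = ennreal (n ^ CARD('d)) * ennreal t"
      using t by (simp add: nn_integral_cmult)
    finally have "(\<integral>\<^sup>+ z. r z \<partial>spacetime) < \<infinity>"
      by (auto intro: le_less_trans simp: ennreal_mult_less_top)
    then show ?thesis using D by (simp add: ennreal_mult_less_top)
  qed
  finally show ?thesis .
qed

end

section \<open>Time zero and equality at every point\<close>

lemma duhamel_0: "duhamel a 0 \<kappa> x A = 0"
proof -
  have "duhamel a 0 \<kappa> x A = (\<integral>\<^sup>+ (s :: real). 0 \<partial>lborel)"
    unfolding duhamel_def
  proof (rule nn_integral_cong_AE)
    show "AE s in lborel. heat_flow a (0 - s) (\<kappa> s) x A * indicator {0..0} s = 0"
      using AE_lborel_singleton[of "0::real"] by eventually_elim auto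
  qed
  then show ?thesis by simp
qed

text \<open>At time 0 both Duhamel integrals run over a single instant and P_0 is the identity. The
  solution therefore starts from \<mu>0 at every x, and \<mu>0 inherits the moment bounds of the
  solution.\<close>

lemma coag_diff_equation_0:
  assumes "\<mu> \<in> time_kernels T" "0 \<le> T" "measurable_kernel borel \<mu>0" "coag_diff_equation K a \<mu>0 \<mu> 0"
  shows "\<mu> 0 x = \<mu>0 x"
proof (rule measure_eqI)
  have s: "sets (\<mu> 0 x) = sets masses" "sets (\<mu>0 x) = sets masses"
    using assms by (auto simp: time_kernels_def measurable_kernel_def space_pair_measure space_restrict_space)
  then show "sets (\<mu> 0 x) = sets (\<mu>0 x)" by simp
  fix A assume "A \<in> sets (\<mu> 0 x)"
  then show "emeasure (\<mu> 0 x) A = emeasure (\<mu>0 x) A"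
    using assms(4) s by (simp add: coag_diff_equation_def duhamel_0 heat_flow_def)
qed

theorem theorem2p5:
  fixes K :: "real \<Rightarrow> real \<Rightarrow> real"
    and w a :: "real \<Rightarrow> real"
    and T \<delta> :: real
    and \<mu>0 :: "real ^ 'd \<Rightarrow> real measure"
    and \<mu>1 \<mu>2 :: "real \<Rightarrow> real ^ 'd \<Rightarrow> real measure"
  assumes "3 \<le> CARD('d)"
    and "coagulation_kernel K"
    and "\<And>y. 0 < y \<Longrightarrow> 0 < w y"
    and "mono_on {0<..} w"
    and "sublinear w"
    and "\<And>y z. 0 < y \<Longrightarrow> 0 < z \<Longrightarrow> K y z \<le> w y * w z"
    and "measurable_kernel borel \<mu>0"
    and "0 < \<delta>"
    and "\<And>x. emeasure (\<mu>0 x) {0<..<\<delta>} = 0"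
    and "\<And>y. 0 < y \<Longrightarrow> 0 < a y"
    and "a \<in> borel_measurable masses"
    and "coag_diff_solution K a \<mu>0 T \<mu>1"
    and "coag_diff_solution K a \<mu>0 T \<mu>2"
    and "(SUP t\<in>{0..T}. esssup lborel (\<lambda>x. pairing (\<lambda>y. (w y)\<^sup>2) (\<mu>1 t x))) < \<infinity>"
    and "(SUP t\<in>{0..T}. esssup lborel (\<lambda>x. pairing (\<lambda>y. (w y)\<^sup>2) (\<mu>2 t x))) < \<infinity>"
  shows "\<forall>t\<in>{0..T}. \<forall>x. \<mu>1 t x = \<mu>2 t x"
proof (cases "0 \<le> T")
  case T: True
  interpret coagulation_bound K w a
    by unfold_locales (use assms in auto)
  define C where "C \<mu> = (SUP t\<in>{0..T}. esssup lborel (\<lambda>x. pairing (\<lambda>y. (w y)\<^sup>2) (\<mu> t x)))"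
    for \<mu> :: "real \<Rightarrow> real ^ 'd \<Rightarrow> real measure"
  define B where "B \<mu> = (SUP t\<in>{0..T}. \<integral>\<^sup>+ x. pairing (\<lambda>y. y) (\<mu> t x) \<partial>lborel)"
    for \<mu> :: "real \<Rightarrow> real ^ 'd \<Rightarrow> real measure"
  define \<nu>1 where "\<nu>1 = bounded_part T (C \<mu>1) \<mu>1"
  define \<nu>2 where "\<nu>2 = bounded_part T (C \<mu>2) \<mu>2"
  \<comment> \<open>The moment bounds for the initial kernel are those of the first solution at t =
    0, where it equals \<mu>0.\<close>
  define \<nu>0 where "\<nu>0 x = \<nu>1 (0, x)" for x
  have C: "C \<mu>1 < \<infinity>" "C \<mu>2 < \<infinity>" using assms(14,15) by (auto simp: C_def)
  have sol: "\<mu>1 \<in> time_kernels T" "\<mu>2 \<in> time_kernels T" "B \<mu>1 < \<infinity>" "B \<mu>2 < \<infinity>"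
    and eqn: "\<And>t. t \<in> {0..T} \<Longrightarrow> coag_diff_equation K a \<mu>0 \<mu>1 t" "\<And>t. t \<in> {0..T} \<Longrightarrow> coag_diff_equation K a \<mu>0 \<mu>2 t"
    and loss: "loss_term_integrable K a \<mu>1 T" "loss_term_integrable K a \<mu>2 T"
    using assms(12,13) T by (auto simp: coag_diff_solution_def B_def)
  have CAE: "AE x in lborel. pairing (\<lambda>y. (w y)\<^sup>2) (\<mu> t x) \<le> C \<mu>" if "t \<in> {0..T}" for t \<mu>
  proof -
    have "esssup lborel (\<lambda>x. pairing (\<lambda>y. (w y)\<^sup>2) (\<mu> t x)) \<le> C \<mu>"
      unfolding C_def by (rule SUP_upper[OF that])
    with esssup_AE[of "\<lambda>x. pairing (\<lambda>y. (w y)\<^sup>2) (\<mu> t x)" lborel] show ?thesis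
      by (auto elim: eventually_mono intro: order.trans)
  qed
  have BY: "(\<integral>\<^sup>+ x. pairing (\<lambda>y. y) (\<mu> t x) \<partial>lborel) \<le> B \<mu>" if "t \<in> {0..T}" for t \<mu>
    unfolding B_def by (rule SUP_upper[OF that])
  have fin: "(\<integral>\<^sup>+ x. pairing (\<lambda>y. y) (\<mu>1 t x) \<partial>lborel) < \<infinity>" "(\<integral>\<^sup>+ x. pairing (\<lambda>y. y) (\<mu>2 t x) \<partial>lborel) < \<infinity>"
    if "t \<in> {0..T}" for t
    using le_less_trans[OF BY[OF that] sol(3)] le_less_trans[OF BY[OF that] sol(4)] .
  have rep: "represents T \<mu>1 \<nu>1" "represents T \<mu>2 \<nu>2"
    unfolding \<nu>1_def \<nu>2_def
    by (intro bounded_part_represents sol(1) fin(1) CAE; assumption)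
       (intro bounded_part_represents sol(2) fin(2) CAE; assumption)
  have init: "\<mu>1 0 x = \<mu>0 x" for x
    by (rule coag_diff_equation_0[OF sol(1) T assms(7) eqn(1)]) (use T in auto)
  have rep0: "represents_initial \<mu>0 \<nu>0"
    unfolding represents_initial_def
  proof (intro conjI allI)
    show "moment_kernel lborel \<nu>0"
      unfolding \<nu>0_def[abs_def] by (rule moment_kernel_compose[OF represents_kernel[OF rep(1)]]) measurable
    show "sets (\<mu>0 x) = sets masses" for x
      using assms(7) by (auto simp: measurable_kernel_def)
    have "AE x in lborel. bounded_part T (C \<mu>1) \<mu>1 (0, x) = on_reals (\<mu>1 0 x)"
      by (intro bounded_part_AE_eq sol fin CAE) (use T in auto)
    then show "AE x in lborel. \<nu>0 x = on_reals (\<mu>0 x)"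
      by (simp add: \<nu>0_def \<nu>1_def init)
  qed
  have Y: "(\<integral>\<^sup>+ q. ennreal (snd q) \<partial>semiprod spacetime \<nu>1) < \<infinity>"
      "(\<integral>\<^sup>+ q. ennreal (snd q) \<partial>semiprod spacetime \<nu>2) < \<infinity>"
    unfolding \<nu>1_def \<nu>2_def using bounded_part_mass[OF sol(1) T BY sol(3)] bounded_part_mass[OF sol(2) T BY sol(4)] by auto
  have Y0: "(\<integral>\<^sup>+ p. ennreal (snd p) \<partial>semiprod lborel \<nu>0) < \<infinity>"
  proof -
    have "(\<integral>\<^sup>+ p. ennreal (snd p) \<partial>semiprod lborel \<nu>0) = (\<integral>\<^sup>+ x. (\<integral>\<^sup>+ y. ennreal y \<partial>bounded_part T (C \<mu>1) \<mu>1 (0, x)) \<partial>lborel)"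
      using rep0 by (subst nn_integral_semiprod) (auto simp: represents_initial_def \<nu>0_def \<nu>1_def)
    also have "\<dots> \<le> (\<integral>\<^sup>+ x. pairing (\<lambda>y. y) (\<mu>1 0 x) \<partial>lborel)"
      by (rule bounded_part_mass_at[OF sol(1)]) (use T in auto)
    also have "\<dots> \<le> B \<mu>1" by (rule BY) (use T in auto)
    finally show ?thesis using sol(3) by (rule le_less_trans)
  qed
  have Csq: "(\<integral>\<^sup>+ y. ennreal ((W y)\<^sup>2) \<partial>\<nu>1 z) \<le> C \<mu>1" "(\<integral>\<^sup>+ y. ennreal ((W y)\<^sup>2) \<partial>\<nu>2 z) \<le> C \<mu>2" for z
    unfolding \<nu>1_def \<nu>2_def by (intro bounded_part_square sol)+
  have eq: "AE z in spacetime. \<nu>1 z = \<nu>2 z"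
    by (rule AE_kernels_eq[OF rep rep0 eqn loss T assms(8,9) Csq(1) C(1) Csq(2) C(2) Y Y0])
  have ge: "AE q in semiprod spacetime \<nu>1. \<delta> \<le> snd q"
    by (rule no_small_masses[OF rep(1) rep0 eqn(1) loss(1) T assms(8,9) Csq(1) C(1) Y(1)])
  \<comment> \<open>Representation is an almost-everywhere notion, so \<nu>1 represents both
    solutions. The Duhamel terms depend only on the representative, hence they coincide for every t
    and every x.\<close>
  have rep21: "represents T \<mu>2 \<nu>1"
  proof -
    have "AE z in spacetime. \<nu>2 z = (if fst z \<in> {0..T} then on_reals (\<mu>2 (fst z) (snd z)) else null_measure borel)"
      using rep(2) by (simp add: represents_def)
    with eq have "AE z in spacetime. \<nu>1 z = (if fst z \<in> {0..T} then on_reals (\<mu>2 (fst z) (snd z)) else null_measure borel)"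
      by eventually_elim simp
    then show ?thesis using rep unfolding represents_def by blast
  qed
  show ?thesis
  proof (intro ballI allI)
    fix t x assume t: "t \<in> {0..T}"
    then have tT: "t \<le> T" by simp
    have s: "sets (\<mu>1 t x) = sets masses" "sets (\<mu>2 t x) = sets masses"
      using time_kernels_sets[OF sol(1) t] time_kernels_sets[OF sol(2) t] by auto
    show "\<mu>1 t x = \<mu>2 t x"
    proof (rule measure_eqI)
      fix A assume "A \<in> sets (\<mu>1 t x)"
      then have A: "A \<in> sets masses" using s by simp
      \<comment> \<open>On these masses the loss is finite at (t,x) and can be cancelled from the
        two equations. As a is positive, the sets increase to A.\<close>
      define A' where "A' n = A \<inter> {y \<in> space masses. 1 / real (Suc n) \<le> a y \<and> a y \<le> real (Suc n)}" for n
      have A': "A' n \<in> sets masses" for n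
      proof -
        have "{y \<in> space masses. 1 / real (Suc n) \<le> a y \<and> a y \<le> real (Suc n)} \<in> sets masses" by measurable
        then show ?thesis unfolding A'_def by (rule sets.Int[OF A])
      qed
      have eqn': "emeasure (\<mu>1 t x) (A' n) = emeasure (\<mu>2 t x) (A' n)" for n
      proof -
        have fin: "duhamel a t (\<lambda>s x. coag_loss K (\<mu>1 s x)) x (A' n) < \<infinity>"
          by (rule loss_finite_pointwise[OF rep(1) Csq(1) C(1) assms(8) ge t A', where n = "real (Suc n)"])
             (auto simp: A'_def)
        have e1: "emeasure (\<mu>1 t x) (A' n) + duhamel a t (\<lambda>s x. coag_loss K (\<mu>1 s x)) x (A' n) =
            heat_flow a t \<mu>0 x (A' n) + duhamel a t (\<lambda>s x. coag_gain K (\<mu>1 s x)) x (A' n)"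
          using eqn(1)[OF t] A' by (auto simp: coag_diff_equation_def)
        have e2: "emeasure (\<mu>2 t x) (A' n) + duhamel a t (\<lambda>s x. coag_loss K (\<mu>2 s x)) x (A' n) =
            heat_flow a t \<mu>0 x (A' n) + duhamel a t (\<lambda>s x. coag_gain K (\<mu>2 s x)) x (A' n)"
          using eqn(2)[OF t] A' by (auto simp: coag_diff_equation_def)
        have l: "duhamel a t (\<lambda>s x. coag_loss K (\<mu>2 s x)) x (A' n) = duhamel a t (\<lambda>s x. coag_loss K (\<mu>1 s x)) x (A' n)"
          "duhamel a t (\<lambda>s x. coag_gain K (\<mu>2 s x)) x (A' n) = duhamel a t (\<lambda>s x. coag_gain K (\<mu>1 s x)) x (A' n)"
          by (simp_all only: duhamel_loss[OF a_measurable K rep(1) tT A'] duhamel_loss[OF a_measurable K rep21 tT A']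
              duhamel_gain[OF a_measurable K rep(1) tT A'] duhamel_gain[OF a_measurable K rep21 tT A'])
        have "duhamel a t (\<lambda>s x. coag_loss K (\<mu>1 s x)) x (A' n) + emeasure (\<mu>1 t x) (A' n) =
            duhamel a t (\<lambda>s x. coag_loss K (\<mu>1 s x)) x (A' n) + emeasure (\<mu>2 t x) (A' n)"
          using e1 e2 unfolding l by (simp only: add.commute)
        then show ?thesis using fin by (auto simp: ennreal_add_left_cancel)
      qed
      have inc: "incseq A'"
      proof (rule incseq_SucI)
        fix n
        have "1 / real (Suc (Suc n)) \<le> 1 / real (Suc n)" by (rule divide_left_mono) auto
        then show "A' n \<le> A' (Suc n)"
          unfolding A'_def by (auto simp del: of_nat_Suc intro: order.trans)
      qed
      have un: "(\<Union>n. A' n) = A"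
      proof (intro antisym subsetI)
        fix y assume y: "y \<in> A"
        then have y0: "0 < y" using A by (auto simp: sets_masses)
        obtain n1 :: nat where n1: "1 / a y < real n1" using reals_Archimedean2 by blast
        obtain n2 :: nat where n2: "a y < real n2" using reals_Archimedean2 by blast
        have "1 / a y \<le> real (Suc (n1 + n2))" "a y \<le> real (Suc (n1 + n2))" using n1 n2 by auto
        moreover then have "1 / real (Suc (n1 + n2)) \<le> a y"
          using a_pos[OF y0] by (simp add: field_simps del: of_nat_Suc)
        ultimately have "y \<in> A' (n1 + n2)" using y y0 unfolding A'_def by auto
        then show "y \<in> (\<Union>n. A' n)" by blast
      qed (auto simp: A'_def)
      have "emeasure (\<mu>1 t x) (\<Union>n. A' n) = (SUP n. emeasure (\<mu>1 t x) (A' n))"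
        using A' s by (intro SUP_emeasure_incseq[symmetric] inc) auto
      also have "\<dots> = (SUP n. emeasure (\<mu>2 t x) (A' n))" by (simp add: eqn')
      also have "\<dots> = emeasure (\<mu>2 t x) (\<Union>n. A' n)"
        using A' s by (intro SUP_emeasure_incseq inc) auto
      finally show "emeasure (\<mu>1 t x) A = emeasure (\<mu>2 t x) A" by (simp only: un)
    qed (use s in simp)
  qed
qed auto

end
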